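(* Let $d\in\mathbb{N}$ and $1\le p<\infty$. Then there is a constant $C>0$, independent of $n$ and $f$, such that $$\|f-I_nf\|_{L_p([0,1]^d)}\le C\,2^{-n/p}\,n^{d-1}\,\|f|S^{1/p}_{p,1}B([0,1]^d)\|$$ holds for all $n\in\mathbb{N}$ and all $f\in S^{1/p}_{p,1}B([0,1]^d)$, where $I_n$ is the truncated Faber-Schauder series operator.
   Context: Notation: $\mathbb{N}=\{1,2,\dots\}$, $\mathbb{N}_0=\mathbb{N}\cup\{0\}$, $\mathbb{N}_{-1}=\mathbb{N}_0\cup\{-1\}$, $a_+=\max\{a,0\}$, $|x|_1=\sum_i|x_i|$. Function spaces. Let $\mathcal{F}$ be the Fourier transform on $\mathbb{R}^d$, $\mathcal{F}f(\xi)=(2\pi)^{-d/2}\int_{\mathbb{R}^d}f(x)e^{-i\xi\cdot x}dx$. Fix a system $\varphi=\{\varphi_n\}_{n=0}^\infty\subset C_0^\infty(\mathbb{R})$ with (i) $\operatorname{supp}\varphi_0\subset\{|x|\le 2\}$; (ii) $\operatorname{supp}\varphi_n\subset\{2^{n-1}\le|x|\le 2^{n+1}\}$ for $n\ge1$; (iii) for every $\ell\in\mathbb{N}_0$, $\sup_{x,n}2^{n\ell}|D^\ell\varphi_n(x)|<\infty$; (iv) $\sum_{n=0}^\infty\varphi_n(x)=1$ for all $x\in\mathbb{R}$. For $f\in L_1(\mathbb{R}^d)$ and $\ell\in\mathbb{N}_0^d$ put $f_\ell=\mathcal{F}^{-1}[\varphi_{\ell_1}(\xi_1)\cdots\varphi_{\ell_d}(\xi_d)\mathcal{F}f(\xi)]$.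 For $0<p,q\le\infty$ and $r>(1/p-1)_+$, $S^r_{p,q}B(\mathbb{R}^d)$ is the set of all $f\in L_1(\mathbb{R}^d)$ with $\|f|S^r_{p,q}B(\mathbb{R}^d)\|=\big(\sum_{j\in\mathbb{N}_0^d}2^{|j|_1rq}\|f_j\|_p^q\big)^{1/q}<\infty$ (usual modification for $q=\infty$). The space $S^r_{p,q}B([0,1]^d)$ consists of all $f\in L_1([0,1]^d)$ that are restrictions to $[0,1]^d$ of some $g\in S^r_{p,q}B(\mathbb{R}^d)$, with $\|f|S^r_{p,q}B([0,1]^d)\|$ the infimum of $\|g|S^r_{p,q}B(\mathbb{R}^d)\|$ over all such $g$. Elements of $S^{1/p}_{p,1}B([0,1]^d)$ are identified with their continuous representatives. Faber-Schauder system on $[0,1]^d$. Let $v:\mathbb{R}\to\mathbb{R}$ be the hat function supported on $[0,1]$, $v(x)=2x$ on $[0,1/2]$, $v(x)=2(1-x)$ on $[1/2,1]$, and $0$ otherwise. For $j\in\mathbb{N}_0$ put $\mathbb{D}_j=\{0,1,\dots,2^j-1\}$ and $v_{j,k}(x)=v(2^jx-k)$; for $j=-1$ put $\mathbb{D}_{-1}=\{0,1\}$, $v_{-1,0}(x)=1-x$, $v_{-1,1}(x)=x$. For $j\in\mathbb{N}_{-1}^d$ put $\mathbb{D}_j=\mathbb{D}_{j_1}\times\cdots\times\mathbb{D}_{j_d}$ and $v_{j,k}(x)=\prod_{i=1}^dv_{j_i,k_i}(x_i)$. For $f\in C([0,1]^d)$, $j\in\mathbb{N}_{-1}^d$, $k\in\mathbb{D}_j$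 let $e(j)=\{i:j_i\ne-1\}$, $x_{j,k}=(2^{-(j_1)_+}k_1,\dots,2^{-(j_d)_+}k_d)$ and $$d^2_{j,k}(f)=(-2)^{-|e(j)|}\Big(\prod_{i\in e(j)}\Delta^{2,i}_{2^{-(j_i+1)}}\Big)f(x_{j,k}),$$ where $|e(j)|$ is the cardinality of $e(j)$ and $\Delta^{2,i}_hf(x)=f(x+2he_i)-2f(x+he_i)+f(x)$, with $e_i$ the $i$-th unit vector. The truncated Faber-Schauder series is $$I_nf=\sum_{j\in\mathbb{N}_{-1}^d,\ |j|_1\le n}\ \sum_{k\in\mathbb{D}_j}d^2_{j,k}(f)\,v_{j,k}.$$ *)

theory Defs
  imports "HOL-Analysis.Analysis"
begin

definition fourier :: "(real^'d \<Rightarrow> complex) \<Rightarrow> real^'d \<Rightarrow> complex" where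
  "fourier f \<xi> = of_real ((2 * pi) powr (- real CARD('d) / 2)) *
     integral\<^sup>L lebesgue (\<lambda>x. f x * exp (- \<i> * of_real (\<xi> \<bullet> x)))"

definition inv_fourier :: "(real^'d \<Rightarrow> complex) \<Rightarrow> real^'d \<Rightarrow> complex" where
  "inv_fourier g x = of_real ((2 * pi) powr (- real CARD('d) / 2)) *
     integral\<^sup>L lebesgue (\<lambda>\<xi>. g \<xi> * exp (\<i> * of_real (\<xi> \<bullet> x)))"

definition iter_deriv :: "nat \<Rightarrow> (real \<Rightarrow> complex) \<Rightarrow> real \<Rightarrow> complex" where
  "iter_deriv l = (\<lambda>g x. vector_derivative g (at x)) ^^ l"

definition supp :: "(real \<Rightarrow> complex) \<Rightarrow> real set" where
  "supp g = closure {x. g x \<noteq> 0}"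

definition test_function :: "(real \<Rightarrow> complex) \<Rightarrow> bool" where
  "test_function g \<longleftrightarrow> compact (supp g) \<and> (\<forall>l x. iter_deriv l g differentiable (at x))"

definition dyadic_resolution :: "(nat \<Rightarrow> real \<Rightarrow> complex) \<Rightarrow> bool" where
  "dyadic_resolution \<phi> \<longleftrightarrow>
     (\<forall>n. test_function (\<phi> n)) \<and>
     supp (\<phi> 0) \<subseteq> {x. \<bar>x\<bar> \<le> 2} \<and>
     (\<forall>n\<ge>1. supp (\<phi> n) \<subseteq> {x. 2 ^ (n - 1) \<le> \<bar>x\<bar> \<and> \<bar>x\<bar> \<le> 2 ^ (n + 1)}) \<and>
     (\<forall>l. \<exists>B. \<forall>n x. 2 ^ (n * l) * norm (iter_deriv l (\<phi> n) x) \<le> B) \<and>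
     (\<forall>x. (\<lambda>n. \<phi> n x) sums 1)"

definition dyadic_block ::
    "(nat \<Rightarrow> real \<Rightarrow> complex) \<Rightarrow> (real^'d \<Rightarrow> complex) \<Rightarrow> ('d \<Rightarrow> nat) \<Rightarrow> real^'d \<Rightarrow> complex" where
  "dyadic_block \<phi> f l = inv_fourier (\<lambda>\<xi>. (\<Prod>i\<in>UNIV. \<phi> (l i) (\<xi> $ i)) * fourier f \<xi>)"

text \<open>Norms are real-valued, so finiteness of each norm is a separate condition in the
  corresponding space.  The exponents are finite, \<open>0 < p\<close> and \<open>0 < q\<close>, and
  \<open>r > max (1/p - 1) 0\<close> is intended.\<close>

definition in_Lp :: "real \<Rightarrow> (real^'d) set \<Rightarrow> (real^'d \<Rightarrow> complex) \<Rightarrow> bool" where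
  "in_Lp p S f \<longleftrightarrow>
     set_borel_measurable lebesgue S f \<and> set_integrable lebesgue S (\<lambda>x. norm (f x) powr p)"

definition Lp_norm :: "real \<Rightarrow> (real^'d) set \<Rightarrow> (real^'d \<Rightarrow> complex) \<Rightarrow> real" where
  "Lp_norm p S f = (LINT x:S|lebesgue. norm (f x) powr p) powr (1 / p)"

definition SB_terms :: "(nat \<Rightarrow> real \<Rightarrow> complex) \<Rightarrow> real \<Rightarrow> real \<Rightarrow> real \<Rightarrow>
    (real^'d \<Rightarrow> complex) \<Rightarrow> ('d \<Rightarrow> nat) \<Rightarrow> real" where
  "SB_terms \<phi> r p q f j =
     2 powr (real (\<Sum>i\<in>UNIV. j i) * r * q) * Lp_norm p UNIV (dyadic_block \<phi> f j) powr q"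

definition SB :: "(nat \<Rightarrow> real \<Rightarrow> complex) \<Rightarrow> real \<Rightarrow> real \<Rightarrow> real \<Rightarrow> (real^'d \<Rightarrow> complex) set" where
  "SB \<phi> r p q = {f. integrable lebesgue f \<and> (\<forall>j. in_Lp p UNIV (dyadic_block \<phi> f j)) \<and>
                    SB_terms \<phi> r p q f summable_on UNIV}"

definition SB_norm :: "(nat \<Rightarrow> real \<Rightarrow> complex) \<Rightarrow> real \<Rightarrow> real \<Rightarrow> real \<Rightarrow>
    (real^'d \<Rightarrow> complex) \<Rightarrow> real" where
  "SB_norm \<phi> r p q f = (\<Sum>\<^sub>\<infinity>j. SB_terms \<phi> r p q f j) powr (1 / q)"

definition unit_cube :: "(real^'d) set" where
  "unit_cube = {x. \<forall>i. 0 \<le> x $ i \<and> x $ i \<le> 1}"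

text \<open>Elements of \<open>L\<^sub>1\<close> are functions here, so restriction to the cube is equality
  almost everywhere on the cube.\<close>

definition SB_extensions :: "(nat \<Rightarrow> real \<Rightarrow> complex) \<Rightarrow> real \<Rightarrow> real \<Rightarrow> real \<Rightarrow>
    (real^'d \<Rightarrow> complex) \<Rightarrow> (real^'d \<Rightarrow> complex) set" where
  "SB_extensions \<phi> r p q f =
     {g \<in> SB \<phi> r p q. AE x in lebesgue. x \<in> unit_cube \<longrightarrow> g x = f x}"

definition SB_cube :: "(nat \<Rightarrow> real \<Rightarrow> complex) \<Rightarrow> real \<Rightarrow> real \<Rightarrow> real \<Rightarrow>
    (real^'d \<Rightarrow> complex) set" where
  "SB_cube \<phi> r p q =
     {f. set_integrable lebesgue unit_cube f \<and> SB_extensions \<phi> r p q f \<noteq> {}}"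

definition SB_cube_norm :: "(nat \<Rightarrow> real \<Rightarrow> complex) \<Rightarrow> real \<Rightarrow> real \<Rightarrow> real \<Rightarrow>
    (real^'d \<Rightarrow> complex) \<Rightarrow> real" where
  "SB_cube_norm \<phi> r p q f = (INF g\<in>SB_extensions \<phi> r p q f. SB_norm \<phi> r p q g)"

definition hat :: "real \<Rightarrow> real" where
  "hat x = (if 0 \<le> x \<and> x \<le> 1/2 then 2 * x else if 1/2 \<le> x \<and> x \<le> 1 then 2 * (1 - x) else 0)"

text \<open>Levels are integers \<open>j \<ge> -1\<close>; the value \<open>-1\<close> is the level of the two boundary functions.\<close>

definition dyadic_shifts :: "int \<Rightarrow> nat set" where
  "dyadic_shifts j = (if j = -1 then {0, 1} else {0..<2 ^ nat j})"

definition faber1 :: "int \<Rightarrow> nat \<Rightarrow> real \<Rightarrow> real" where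
  "faber1 j k x =
     (if j = -1 then (if k = 0 then 1 - x else x) else hat (2 ^ nat j * x - real k))"

definition faber :: "('d \<Rightarrow> int) \<Rightarrow> ('d \<Rightarrow> nat) \<Rightarrow> real^'d \<Rightarrow> real" where
  "faber j k x = (\<Prod>i\<in>UNIV. faber1 (j i) (k i) (x $ i))"

definition second_diff :: "'d \<Rightarrow> real \<Rightarrow> (real^'d \<Rightarrow> complex) \<Rightarrow> real^'d \<Rightarrow> complex" where
  "second_diff i h f x = f (x + (2 * h) *\<^sub>R axis i 1) - 2 * f (x + h *\<^sub>R axis i 1) + f x"

definition active :: "('d \<Rightarrow> int) \<Rightarrow> 'd set" where
  "active j = {i. j i \<noteq> -1}"

definition dyadic_point :: "('d \<Rightarrow> int) \<Rightarrow> ('d \<Rightarrow> nat) \<Rightarrow> real^'d" where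
  "dyadic_point j k = (\<chi> i. 2 powi (- max (j i) 0) * real (k i))"

text \<open>The product of the difference operators is their composition; the order does not matter
  by the following lemma.\<close>

lemma comp_fun_commute_second_diff: "comp_fun_commute (\<lambda>i. second_diff i (h i))"
  by unfold_locales (auto simp: fun_eq_iff second_diff_def algebra_simps)

definition mixed_diff :: "'d set \<Rightarrow> ('d \<Rightarrow> real) \<Rightarrow> (real^'d \<Rightarrow> complex) \<Rightarrow> real^'d \<Rightarrow> complex" where
  "mixed_diff e h f = Finite_Set.fold (\<lambda>i. second_diff i (h i)) f e"

definition faber_coeff :: "(real^'d \<Rightarrow> complex) \<Rightarrow> ('d \<Rightarrow> int) \<Rightarrow> ('d \<Rightarrow> nat) \<Rightarrow> complex" where
  "faber_coeff f j k = (-2) powi (- int (card (active j))) *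
     mixed_diff (active j) (\<lambda>i. 2 powi (- (j i + 1))) f (dyadic_point j k)"

text \<open>A level \<open>-1\<close> contributes \<open>1\<close> to \<open>|j|\<^sub>1\<close>.\<close>

definition faber_truncation :: "nat \<Rightarrow> (real^'d \<Rightarrow> complex) \<Rightarrow> real^'d \<Rightarrow> complex" where
  "faber_truncation n f x =
     (\<Sum>j | (\<forall>i. j i \<ge> -1) \<and> (\<Sum>i\<in>UNIV. \<bar>j i\<bar>) \<le> int n.
        \<Sum>k | \<forall>i. k i \<in> dyadic_shifts (j i).
          faber_coeff f j k * of_real (faber j k x))"

end

(*
  A building block whose frequencies lie in a dyadic box of size 2^l reproduces itself under
  convolution with a tensor product of one-dimensional low-pass kernels K.  Since K has L1 norm O(1)
  and total variation O(2^l), the level-j Faber coefficients of the block have l^p norm at most a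
  constant times 2^(|l|/p) times its L^p norm, uniformly in j (the first difference of K suffices
  because p >= 1).  Summing over l, all levels of coefficients of f have l^p norm at most a constant
  times the Besov norm.  The hats of one level sum to at most 1, so level j contributes
  O(2^(-|j|/p)) to the L^p error; summing over |j| > n gives the rate.
*)
theory Submission
  imports Defs "HOL-Probability.Characteristic_Functions" "HOL-Probability.Sinc_Integral"
begin

text \<open>The indices r = 1/p and q = 1 are what the estimate of one block produces: 2^(|l|/p)
  times its L^p norm, added over l by a triangle inequality. No gain in j is extracted from the
  second differences; all decay in j comes from the supports of the Faber functions. The factor
  n^(d-1) counts the levels with a given |j|_1.

  The inequalities of Hoelder and Minkowski all appear through one device: Young's inequality with a
  free parameter b, linear in p-th powers, is summed or integrated termwise, and b is optimised only
  at the end.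

  The main obstacle is point evaluation. Faber coefficients sample f at points, while an extension g
  equals f only almost everywhere on the cube. The blocks of g sum uniformly to a continuous
  function, which must be identified with f. Testing against boxes does this, since tensor products
  of K form an approximate identity bounded in L1.

  In d dimensions every object is kept as a product over coordinates, so that the analysis takes
  place on the line.\<close>

section \<open>Weighted Young inequalities and product integrals\<close>

text \<open>Young's inequality rescaled by c = a/b, with equality at a = b. The bound is linear in
  \<open>a powr p\<close>, so it can be summed or integrated before b is chosen.\<close>

lemma young_weighted:
  fixes a b p :: real
  assumes "a \<ge> 0" "b > 0" "p \<ge> 1"
  shows "a \<le> b powr (1 - p) * a powr p / p + (1 - 1 / p) * b"
proof (cases "a = 0")
  case True
  have "(1 - 1 / p) * b \<ge> 0" using assms by (intro mult_nonneg_nonneg) auto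
  then show ?thesis using True by simp
next
  case False
  then have a: "a > 0" using assms by simp
  define c where "c = a / b"
  have c: "c > 0" "a = c * b" using a assms by (auto simp: c_def)
  have "(c powr p) powr (1 / p) * 1 powr (1 - 1 / p) \<le> (1 / p) * c powr p + (1 - 1 / p) * 1"
    using assms c by (intro Youngs_inequality_0) auto
  then have "c \<le> c powr p / p + (1 - 1 / p)" using assms c by (simp add: powr_powr)
  then have "c * b \<le> (c powr p / p + (1 - 1 / p)) * b" using assms by (intro mult_right_mono) auto
  also have "c powr p * b = b powr (1 - p) * (c * b) powr p"
    using assms c by (simp add: powr_mult powr_diff)
  then have "(c powr p / p + (1 - 1 / p)) * b = b powr (1 - p) * (c * b) powr p / p + (1 - 1 / p) * b"
    by (simp add: distrib_right)
  finally show ?thesis using c by simp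
qed

text \<open>Minimising the right side over b returns an inequality of Hoelder or Jensen type. Y
  stands for a weighted sum of p-th powers and Z for a bound of the total weight.\<close>

lemma powr_le_of_young:
  fixes X Y Z p :: real
  assumes p: "p \<ge> 1" and XYZ: "X \<ge> 0" "Y \<ge> 0" "Z > 0"
    and le: "\<And>b. b > 0 \<Longrightarrow> X \<le> b powr (1 - p) * Y / p + (1 - 1 / p) * b * Z"
  shows "X powr p \<le> Z powr (p - 1) * Y"
proof (cases "Y = 0")
  case True
  \<comment> \<open>The optimal b would be 0 here, so b = e / Z is made arbitrarily small
    instead.\<close>
  have "X \<le> e" if "e > 0" for e
  proof -
    have "X \<le> (1 - 1 / p) * (e / Z) * Z" using le[of "e / Z"] True that XYZ by simp
    also have "\<dots> = (1 - 1 / p) * e" using XYZ by simp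
    also have "\<dots> \<le> 1 * e" using that p by (intro mult_right_mono) auto
    finally show "X \<le> e" by simp
  qed
  then have "X \<le> 0" using field_le_epsilon[of X 0] by simp
  then have "X = 0" using XYZ by simp
  then show ?thesis using True p by simp
next
  case False
  \<comment> \<open>The minimiser: with \<open>Y = b powr p * Z\<close> both terms are multiples of
    b * Z, and their coefficients 1/p and 1 - 1/p add up to 1.\<close>
  define b where "b = (Y / Z) powr (1 / p)"
  have b: "b > 0" using False XYZ by (simp add: b_def)
  have "b powr p = Y / Z" using p XYZ False by (simp add: b_def powr_powr)
  then have Y: "Y = b powr p * Z" using XYZ by simp
  have "X \<le> b powr (1 - p) * (b powr p * Z) / p + (1 - 1 / p) * b * Z"
    using le[OF b] Y by simp
  also have "b powr (1 - p) * (b powr p * Z) = b * Z"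
    using b by (simp add: powr_diff)
  also have "b * Z / p + (1 - 1 / p) * b * Z = b * Z" using p by (simp add: field_simps)
  finally have "X powr p \<le> (b * Z) powr p" using XYZ p by (intro powr_mono2) auto
  also have "\<dots> = Z powr (p - 1) * Y"
    using b XYZ by (simp add: Y powr_mult powr_diff)
  finally show ?thesis .
qed

text \<open>Jensen's inequality for the values a_i / w_i with weights w_i. With w_i a known size of
  the i-th summand it takes the place of Minkowski's inequality when the blocks are added.\<close>

lemma powr_sum_le_weighted:
  fixes a w :: "'a \<Rightarrow> real"
  assumes p: "p \<ge> 1" and fin: "finite A" and a: "\<And>i. i \<in> A \<Longrightarrow> a i \<ge> 0"
    and w: "\<And>i. i \<in> A \<Longrightarrow> w i > 0" and Z: "sum w A \<le> Z" "Z > 0"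
  shows "(\<Sum>i\<in>A. a i) powr p \<le> Z powr (p - 1) * (\<Sum>i\<in>A. w i powr (1 - p) * a i powr p)"
proof (rule powr_le_of_young[OF p])
  fix b :: real assume b: "b > 0"
  have "(\<Sum>i\<in>A. a i) \<le> (\<Sum>i\<in>A. (b * w i) powr (1 - p) * a i powr p / p + (1 - 1 / p) * (b * w i))"
    using a w b p by (intro sum_mono young_weighted) auto
  also have "\<dots> = (\<Sum>i\<in>A. (b * w i) powr (1 - p) * a i powr p / p) + (\<Sum>i\<in>A. (1 - 1 / p) * (b * w i))"
    by (rule sum.distrib)
  also have "(\<Sum>i\<in>A. (1 - 1 / p) * (b * w i)) = (1 - 1 / p) * b * sum w A"
    unfolding sum_distrib_left by (simp add: mult.assoc)
  also have "(\<Sum>i\<in>A. (b * w i) powr (1 - p) * a i powr p / p)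
      = b powr (1 - p) * (\<Sum>i\<in>A. w i powr (1 - p) * a i powr p) / p"
    using b w by (simp add: sum_distrib_left sum_divide_distrib powr_mult less_imp_le mult_ac cong: sum.cong)
  also have "(1 - 1 / p) * b * sum w A \<le> (1 - 1 / p) * b * Z"
    using b p Z by (intro mult_left_mono mult_nonneg_nonneg) auto
  finally show "(\<Sum>i\<in>A. a i) \<le> b powr (1 - p) * (\<Sum>i\<in>A. w i powr (1 - p) * a i powr p) / p + (1 - 1 / p) * b * Z"
    by simp
qed (use a Z in \<open>auto intro!: sum_nonneg\<close>)

text \<open>Hoelder's inequality for the measure with density K, the form needed for convolution
  integrals.\<close>

lemma powr_integral_le:
  fixes K g :: "'a \<Rightarrow> real"
  assumes p: "p \<ge> 1" and int: "integrable M K" "integrable M (\<lambda>x. K x * g x powr p)"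
      "integrable M (\<lambda>x. K x * g x)"
    and nonneg: "\<And>x. K x \<ge> 0" "\<And>x. g x \<ge> 0" and Z: "integral\<^sup>L M K \<le> Z" "Z > 0"
  shows "(\<integral>x. K x * g x \<partial>M) powr p \<le> Z powr (p - 1) * (\<integral>x. K x * g x powr p \<partial>M)"
proof (rule powr_le_of_young[OF p])
  fix b :: real assume b: "b > 0"
  have "(\<integral>x. K x * g x \<partial>M) \<le>
      (\<integral>x. (b powr (1 - p) / p) * (K x * g x powr p) + ((1 - 1 / p) * b) * K x \<partial>M)"
  proof (rule integral_mono)
    fix x
    have "K x * g x \<le> K x * (b powr (1 - p) * g x powr p / p + (1 - 1 / p) * b)"
      using young_weighted[OF nonneg(2) b p] nonneg by (intro mult_left_mono) auto
    also have "\<dots> = (b powr (1 - p) / p) * (K x * g x powr p) + ((1 - 1 / p) * b) * K x"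
      by (simp add: algebra_simps)
    finally show "K x * g x \<le> (b powr (1 - p) / p) * (K x * g x powr p) + ((1 - 1 / p) * b) * K x" .
  qed (use int in auto)
  also have "\<dots> = b powr (1 - p) * (\<integral>x. K x * g x powr p \<partial>M) / p + (1 - 1 / p) * b * integral\<^sup>L M K"
    using int by simp
  also have "(1 - 1 / p) * b * integral\<^sup>L M K \<le> (1 - 1 / p) * b * Z"
    using b p Z by (intro mult_left_mono mult_nonneg_nonneg) auto
  finally show "(\<integral>x. K x * g x \<partial>M) \<le> b powr (1 - p) * (\<integral>x. K x * g x powr p \<partial>M) / p + (1 - 1 / p) * b * Z"
    by simp
qed (use nonneg Z in auto)

section \<open>Integrals of tensor products and exchange of integrals\<close>

lemma bij_betw_axis: "bij_betw (\<lambda>i::'d::finite. axis i (1::real)) UNIV Basis"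
  unfolding bij_betw_def
  by (auto simp: inj_on_def axis_eq_axis Basis_vec_def image_def)

lemma
  fixes f :: "'d::finite \<Rightarrow> real \<Rightarrow> 'b::{real_normed_field,banach,second_countable_topology}"
  assumes f: "\<And>i. integrable lborel (f i)"
  shows integrable_prod_vec: "integrable lborel (\<lambda>x::real^'d. \<Prod>i\<in>UNIV. f i (x $ i))"
    and integral_prod_vec: "integral\<^sup>L lborel (\<lambda>x::real^'d. \<Prod>i\<in>UNIV. f i (x $ i)) = (\<Prod>i\<in>UNIV. integral\<^sup>L lborel (f i))"
proof -
  \<comment> \<open>\<open>lborel_eq\<close> indexes the coordinates by basis vectors, so each
    factor is looked up through its basis vector.\<close>
  define F where "F b = f (THE i. b = axis i (1::real))" for b :: "real^'d"
  have F: "F (axis i 1) = f i" for i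
    by (simp add: F_def axis_eq_axis)
  interpret product_sigma_finite "\<lambda>b::real^'d. lborel :: real measure" ..
  let ?\<phi> = "\<lambda>g::real^'d \<Rightarrow> real. \<Sum>b\<in>Basis. g b *\<^sub>R b"
  have FB: "integrable lborel (F b)" if "b \<in> Basis" for b
    using that f by (auto simp: Basis_vec_def F)
  have eq: "(\<Prod>i\<in>UNIV. f i (x $ i)) = (\<Prod>b\<in>Basis. F b (x \<bullet> b))" for x :: "real^'d"
    using prod.reindex_bij_betw[OF bij_betw_axis, of "\<lambda>b. F b (x \<bullet> b)"]
    by (simp add: F inner_axis)
  have meas: "?\<phi> \<in> (\<Pi>\<^sub>M b\<in>Basis. lborel) \<rightarrow>\<^sub>M borel"
    by measurable
  have mF: "(\<lambda>x::real^'d. \<Prod>b\<in>Basis. F b (x \<bullet> b)) \<in> borel_measurable borel"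
  proof (rule borel_measurable_prod)
    fix b :: "real^'d" assume "b \<in> Basis"
    then have [measurable]: "F b \<in> borel_measurable borel" using FB by force
    show "(\<lambda>x. F b (x \<bullet> b)) \<in> borel_measurable borel" by measurable
  qed
  have "integrable (\<Pi>\<^sub>M b\<in>Basis. lborel) (\<lambda>g::real^'d \<Rightarrow> real. \<Prod>b\<in>Basis. F b (g b))"
    by (intro product_integrable_prod FB) auto
  then have "integrable (\<Pi>\<^sub>M b\<in>Basis. lborel) (\<lambda>g::real^'d \<Rightarrow> real. \<Prod>b\<in>Basis. F b (?\<phi> g \<bullet> b))"
    by (simp cong: prod.cong)
  then show "integrable lborel (\<lambda>x::real^'d. \<Prod>i\<in>UNIV. f i (x $ i))"
    unfolding eq by (subst lborel_eq) (simp add: integrable_distr_eq[OF meas mF])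
  have "integral\<^sup>L lborel (\<lambda>x::real^'d. \<Prod>i\<in>UNIV. f i (x $ i))
      = (\<integral>g. (\<Prod>b\<in>Basis. F b (?\<phi> g \<bullet> b)) \<partial>(\<Pi>\<^sub>M b\<in>Basis. lborel))"
    unfolding eq by (subst lborel_eq) (simp add: integral_distr[OF meas mF])
  also have "\<dots> = (\<integral>g. (\<Prod>b\<in>Basis. F b (g b)) \<partial>(\<Pi>\<^sub>M b\<in>Basis. lborel))"
    by (simp cong: prod.cong)
  also have "\<dots> = (\<Prod>b\<in>Basis. integral\<^sup>L lborel (F b))"
    by (intro product_integral_prod FB) auto
  also have "\<dots> = (\<Prod>i\<in>UNIV. integral\<^sup>L lborel (f i))"
    using prod.reindex_bij_betw[OF bij_betw_axis, of "\<lambda>b. integral\<^sup>L lborel (F b)"] by (simp add: F)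
  finally show "integral\<^sup>L lborel (\<lambda>x::real^'d. \<Prod>i\<in>UNIV. f i (x $ i)) = (\<Prod>i\<in>UNIV. integral\<^sup>L lborel (f i))" .
qed

text \<open>Domination by a product a(x) b(y) gives integrability on the product space at once.
  Every exchange of integrals below has this shape.\<close>

lemma fubini_dominated:
  fixes f :: "'a::euclidean_space \<Rightarrow> 'b::euclidean_space \<Rightarrow> complex" and a :: "'a \<Rightarrow> real" and b :: "'b \<Rightarrow> real"
  assumes meas: "case_prod f \<in> borel_measurable borel"
    and le: "\<And>x y. norm (f x y) \<le> a x * b y"
    and int: "integrable lborel a" "integrable lborel b"
  shows "(LBINT x. (LBINT y. f x y)) = (LBINT y. (LBINT x. f x y))"
proof -
  have m: "case_prod f \<in> borel_measurable (lborel \<Otimes>\<^sub>M lborel)"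
    using meas by (simp add: lborel_prod)
  have ab: "integrable (lborel \<Otimes>\<^sub>M lborel) (\<lambda>(x, y). a x * b y)"
  proof (rule lborel_pair.Fubini_integrable)
    have "(\<lambda>(x,y). a x * b y) \<in> borel_measurable (borel \<Otimes>\<^sub>M borel)" using int by measurable
    then show "(\<lambda>(x,y). a x * b y) \<in> borel_measurable (lborel \<Otimes>\<^sub>M lborel)"
      by (simp cong: measurable_cong_sets)
    show "AE x in lborel. integrable lborel (\<lambda>y. case (x, y) of (x, y) \<Rightarrow> a x * b y)"
      using int by auto
    show "integrable lborel (\<lambda>x. LBINT y. norm (case (x, y) of (x, y) \<Rightarrow> a x * b y))"
      using int by (simp add: abs_mult)
  qed
  have i: "integrable (lborel \<Otimes>\<^sub>M lborel) (case_prod f)"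
    by (rule Bochner_Integration.integrable_bound[OF ab m])
      (auto intro!: AE_I2 order_trans[OF le] simp: split: prod.splits)
  show "(LBINT x. (LBINT y. f x y)) = (LBINT y. (LBINT x. f x y))"
    by (rule lborel_pair.Fubini_integral[OF i, symmetric])
qed

section \<open>Kernels with compactly supported symbol\<close>

lemma integrable_dominated:
  fixes f :: "'a \<Rightarrow> 'b::{banach,second_countable_topology}" and g :: "'a \<Rightarrow> real"
  assumes "integrable M g" "f \<in> borel_measurable M" "\<And>x. norm (f x) \<le> g x"
  shows "integrable M f"
  by (rule Bochner_Integration.integrable_bound[OF assms(1,2)])
    (auto simp only: real_norm_def intro!: AE_I2 order_trans[OF assms(3) abs_ge_self])

text \<open>The inverse Fourier integral on the line, with the factor 1 / (2 pi) instead of the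
  unitary one: convolution with \<open>kern h\<close> is then the Fourier multiplier with symbol h,
  with no constant left over.\<close>

definition kern :: "(real \<Rightarrow> complex) \<Rightarrow> real \<Rightarrow> complex" where
  "kern h t = (LBINT \<eta>. h \<eta> * cis (\<eta> * t)) / (2 * pi)"

lemma borel_measurable_cis [measurable]: "cis \<in> borel_measurable borel"
  by (intro borel_measurable_continuous_onI continuous_intros)

lemma borel_measurable_kern [measurable]:
  assumes [measurable]: "h \<in> borel_measurable borel"
  shows "kern h \<in> borel_measurable borel"
  unfolding kern_def by measurable

lemma integrable_inverse_1_plus_square': "integrable lborel (\<lambda>x::real. inverse (1 + x\<^sup>2))"
  and integral_inverse_1_plus_square: "(LBINT x. inverse (1 + (x::real)\<^sup>2)) = pi"
  using integrable_inverse_1_plus_square LBINT_inverse_1_plus_square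
  by (auto simp: set_integrable_def interval_lebesgue_integral_def set_lebesgue_integral_def)

text \<open>The mass 2 * B * pi does not involve R. This scale invariance is the source of L1 bounds
  that are uniform over all dyadic scales.\<close>

lemma
  fixes R B :: real
  assumes "R > 0"
  shows integrable_cauchy_scaled: "integrable lborel (\<lambda>t. 2 * R * B / (1 + (R * t)\<^sup>2))"
    and integral_cauchy_scaled: "(LBINT t. 2 * R * B / (1 + (R * t)\<^sup>2)) = 2 * B * pi"
proof -
  have "integrable lborel (\<lambda>t. inverse (1 + (0 + R * t)\<^sup>2))"
    using assms by (intro lborel_integrable_real_affine[OF integrable_inverse_1_plus_square']) auto
  then have "integrable lborel (\<lambda>t. (2 * R * B) * inverse (1 + (R * t)\<^sup>2))"
    by simp
  then show "integrable lborel (\<lambda>t. 2 * R * B / (1 + (R * t)\<^sup>2))"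
    by (simp add: field_simps)
  have "pi = R * (LBINT t. inverse (1 + (0 + R * t)\<^sup>2))"
    using lborel_integral_real_affine[of R "\<lambda>x. inverse (1 + x\<^sup>2)" 0] assms
    by (simp add: integral_inverse_1_plus_square)
  moreover have "(LBINT t. 2 * R * B / (1 + (R * t)\<^sup>2)) = 2 * R * B * (LBINT t. inverse (1 + (0 + R * t)\<^sup>2))"
    by (simp add: divide_inverse)
  ultimately show "(LBINT t. 2 * R * B / (1 + (R * t)\<^sup>2)) = 2 * B * pi"
    by simp
qed

text \<open>A symbol living on scale R, with bounds in scale-invariant form. Two derivatives suffice
  for an integrable kernel. The instances are the low-pass symbol and \<eta> times it, with R =
  2^N.\<close>

locale bump =
  fixes h h1 h2 :: "real \<Rightarrow> complex" and R B :: real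
  assumes R: "R > 0"
    and h1: "\<And>x. (h has_vector_derivative h1 x) (at x)"
    and h2: "\<And>x. (h1 has_vector_derivative h2 x) (at x)"
    and h2_cont: "continuous_on UNIV h2"
    and h_supp: "\<And>x. \<bar>x\<bar> > 2 * R \<Longrightarrow> h x = 0"
    and h_le: "\<And>x. norm (h x) \<le> B"
    and h2_le: "\<And>x. norm (h2 x) \<le> B / R\<^sup>2"
begin

lemma B_nonneg: "B \<ge> 0"
  using h_le[of 0] norm_ge_zero[of "h 0"] by linarith

lemma h_cont: "continuous_on A h"
  using h1 by (meson continuous_on_vector_derivative has_vector_derivative_at_within)

lemma h_meas [measurable]: "h \<in> borel_measurable borel"
  by (intro borel_measurable_continuous_onI h_cont)

lemma h2_meas [measurable]: "h2 \<in> borel_measurable borel"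
  by (intro borel_measurable_continuous_onI h2_cont)

lemma derivative_zero_outside:
  fixes f f' :: "real \<Rightarrow> complex"
  assumes "\<And>x. (f has_vector_derivative f' x) (at x)" "\<And>x. \<bar>x\<bar> > c \<Longrightarrow> f x = 0" "\<bar>x\<bar> > c"
  shows "f' x = 0"
proof -
  have "open {x::real. \<bar>x\<bar> > c}" by (intro open_Collect_less continuous_intros)
  then have "(f has_vector_derivative 0) (at x)"
    by (rule has_vector_derivative_transform_within_open[OF has_vector_derivative_const[of 0]])
      (use assms in auto)
  then show ?thesis using assms(1) vector_derivative_unique_at by blast
qed

lemma h1_supp: "\<bar>x\<bar> > 2 * R \<Longrightarrow> h1 x = 0"
  using derivative_zero_outside[OF h1 h_supp] by blast

lemma h2_supp: "\<bar>x\<bar> > 2 * R \<Longrightarrow> h2 x = 0"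
  using derivative_zero_outside[OF h2 h1_supp] by blast

lemma norm_supported_integral_le:
  fixes f :: "real \<Rightarrow> complex"
  assumes "\<And>x. norm (f x) \<le> c" "\<And>x. \<bar>x\<bar> > 2 * R \<Longrightarrow> f x = 0" "f \<in> borel_measurable borel"
  shows "integrable lborel f" "norm (integral\<^sup>L lborel f) \<le> 4 * R * c"
proof -
  have i: "integrable lborel (\<lambda>x::real. c * indicator {-(2*R)..2*R} x)"
    using R by (intro integrable_mult_right integrable_real_indicator) auto
  have le: "norm (f x) \<le> c * indicator {-(2*R)..2*R} x" for x
    using assms(1)[of x] assms(2)[of x] by (auto simp: indicator_def)
  show *: "integrable lborel f"
    by (rule integrable_dominated[OF i _ le]) (use assms in simp)
  have "norm (integral\<^sup>L lborel f) \<le> (LBINT x. c * indicator {-(2*R)..2*R} x)"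
    by (intro order_trans[OF integral_norm_bound] integral_mono integrable_norm * i le)
  also have "\<dots> = 4 * R * c" using R by simp
  finally show "norm (integral\<^sup>L lborel f) \<le> 4 * R * c" .
qed

lemma h_integrable: "integrable lborel h"
  by (rule norm_supported_integral_le[OF h_le h_supp h_meas])

text \<open>Two integrations by parts at once: F is an antiderivative of the combined integrand f
  and vanishes outside the support of h.\<close>

lemma second_moment:
  "complex_of_real (t\<^sup>2) * (LBINT \<eta>. h \<eta> * cis (\<eta> * t)) = - (LBINT \<eta>. h2 \<eta> * cis (\<eta> * t))"
proof -
  define F where "F \<eta> = h1 \<eta> * cis (\<eta> * t) - (\<i> * t) * (h \<eta> * cis (\<eta> * t))" for \<eta>
  define f where "f \<eta> = h2 \<eta> * cis (\<eta> * t) + t\<^sup>2 * (h \<eta> * cis (\<eta> * t))" for \<eta>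
  have dc: "((\<lambda>\<eta>. cis (\<eta> * t)) has_vector_derivative (t *\<^sub>R (\<i> * cis (\<eta> * t)))) (at \<eta>)" for \<eta>
    unfolding has_vector_derivative_def
    by (rule derivative_eq_intros refl | simp add: algebra_simps)+
  have dF: "(F has_vector_derivative f \<eta>) (at \<eta>)" for \<eta>
  proof -
    have "(F has_vector_derivative (h1 \<eta> * (t *\<^sub>R (\<i> * cis (\<eta> * t))) + h2 \<eta> * cis (\<eta> * t))
        - (\<i> * t) * (h \<eta> * (t *\<^sub>R (\<i> * cis (\<eta> * t))) + h1 \<eta> * cis (\<eta> * t))) (at \<eta>)"
      unfolding F_def
      by (intro has_vector_derivative_diff has_vector_derivative_mult_right has_vector_derivative_mult dc h1 h2)
    then show ?thesis unfolding f_def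
      by (rule back_subst[of "\<lambda>y. (F has_vector_derivative y) (at \<eta>)"])
        (simp add: scaleR_conv_of_real power2_eq_square algebra_simps)
  qed
  \<comment> \<open>The endpoints are 3 * R since h and h1 are only known to vanish strictly beyond
    2 * R.\<close>
  have "integral\<^sup>L lborel (\<lambda>x. indicator {-(3*R)..3*R} x *\<^sub>R f x) = F (3*R) - F (-(3*R))"
  proof (rule integral_FTC_atLeastAtMost)
    show "continuous_on {-(3*R)..3*R} f" unfolding f_def
      by (intro continuous_intros h_cont continuous_on_subset[OF h2_cont]) auto
  qed (use R dF in \<open>auto intro: has_vector_derivative_at_within\<close>)
  also have "\<dots> = 0" using R by (simp add: F_def h_supp h1_supp)
  also have "(\<lambda>x. indicator {-(3*R)..3*R} x *\<^sub>R f x) = f"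
    using R by (auto simp: fun_eq_iff f_def h_supp h2_supp indicator_def)
  finally have "integral\<^sup>L lborel f = 0" .
  moreover have "integrable lborel (\<lambda>\<eta>. h2 \<eta> * cis (\<eta> * t))"
    by (rule norm_supported_integral_le[where c="B / R\<^sup>2"]) (auto simp: norm_mult h2_le h2_supp)
  moreover have "integrable lborel (\<lambda>\<eta>. h \<eta> * cis (\<eta> * t))"
    by (rule norm_supported_integral_le[where c="B"]) (auto simp: norm_mult h_le h_supp)
  ultimately show ?thesis unfolding f_def by (simp add: add_eq_0_iff2)
qed

text \<open>The plain bound handles small t and the second moment handles large t; adding them gives
  the Cauchy-type majorant.\<close>

lemma kern_le: "norm (kern h t) \<le> 2 * R * B / (1 + (R * t)\<^sup>2)"
proof -
  let ?I = "\<integral>\<eta>. h \<eta> * cis (\<eta> * t) \<partial>lborel"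
  have 1: "norm ?I \<le> 4 * R * B"
    by (rule norm_supported_integral_le) (auto simp: norm_mult h_le h_supp)
  have "norm (complex_of_real (t\<^sup>2) * ?I) \<le> 4 * R * (B / R\<^sup>2)"
    unfolding second_moment norm_minus_cancel
    by (rule norm_supported_integral_le) (auto simp: norm_mult h2_le h2_supp)
  then have "t\<^sup>2 * norm ?I \<le> 4 * R * (B / R\<^sup>2)" by (simp add: norm_mult norm_power)
  then have "R\<^sup>2 * (t\<^sup>2 * norm ?I) \<le> R\<^sup>2 * (4 * R * (B / R\<^sup>2))"
    by (intro mult_left_mono) auto
  then have 2: "(R * t)\<^sup>2 * norm ?I \<le> 4 * R * B" using R by (simp add: power_mult_distrib mult_ac)
  have "(1 + (R * t)\<^sup>2) * norm ?I \<le> 8 * R * B" using 1 2 by (simp add: algebra_simps)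
  moreover have "1 + (R * t)\<^sup>2 > 0" by (simp add: add_pos_nonneg)
  ultimately have "norm ?I \<le> 8 * R * B / (1 + (R * t)\<^sup>2)" by (simp add: field_simps)
  \<comment> \<open>Replacing 2 * pi by the smaller 4 turns the factor 8 into the 2 of the
    claim.\<close>
  moreover have "norm (kern h t) \<le> norm ?I / 4"
  proof -
    have "norm (kern h t) = norm ?I / (2 * pi)" by (simp add: kern_def norm_divide norm_mult)
    also have "\<dots> \<le> norm ?I / 4" using pi_gt3 by (intro divide_left_mono) auto
    finally show ?thesis .
  qed
  ultimately show ?thesis by simp
qed

lemma kern_integrable: "integrable lborel (kern h)"
  by (rule integrable_dominated[OF integrable_cauchy_scaled[OF R] _ kern_le]) simp

lemma kern_L1_le: "(LBINT t. norm (kern h t)) \<le> 2 * B * pi"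
  unfolding integral_cauchy_scaled[OF R, of B, symmetric]
  by (intro integral_mono kern_le integrable_cauchy_scaled R integrable_norm kern_integrable)

lemma kern_sup_le: "norm (kern h t) \<le> 2 * R * B"
proof -
  have "2 * R * B / (1 + (R * t)\<^sup>2) \<le> 2 * R * B / 1"
    using R B_nonneg by (intro divide_left_mono) (auto simp: add_pos_nonneg)
  then show ?thesis using kern_le[of t] by simp
qed

text \<open>The symbol \<i> \<eta> h belongs to the derivative of \<open>kern h\<close>. In
  integrated form this follows from Fubini, without differentiating under the integral sign.\<close>

lemma kern_diff:
  assumes "a \<le> b"
  shows "kern h b - kern h a = (LBINT t. indicator {a..b} t * kern (\<lambda>\<eta>. \<i> * \<eta> * h \<eta>) t)"
proof -
  let ?f = "\<lambda>t \<eta>. indicator {a..b} t *\<^sub>R (\<i> * complex_of_real \<eta> * cis (\<eta> * t))"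
  have ftc: "(LBINT t. ?f t \<eta>) = cis (\<eta> * b) - cis (\<eta> * a)" for \<eta>
  proof (rule integral_FTC_atLeastAtMost[OF assms])
    show "((\<lambda>a. cis (\<eta> * a)) has_vector_derivative \<i> * complex_of_real \<eta> * cis (\<eta> * x)) (at x within {a..b})" for x
      unfolding has_vector_derivative_def
      by (rule derivative_eq_intros refl | simp add: scaleR_conv_of_real algebra_simps)+
  qed (intro continuous_intros)
  have i1: "integrable lborel (\<lambda>\<eta>. h \<eta> * cis (\<eta> * c))" for c
    by (rule norm_supported_integral_le[where c="B"]) (auto simp: norm_mult h_le h_supp)
  have "(LBINT t. indicator {a..b} t * kern (\<lambda>\<eta>. \<i> * \<eta> * h \<eta>) t)
      = (LBINT t. (LBINT \<eta>. h \<eta> * ?f t \<eta>)) / (2 * pi)"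
    unfolding kern_def integral_divide_zero[symmetric]
    by (intro Bochner_Integration.integral_cong refl)
      (auto simp: indicator_def mult_ac intro!: Bochner_Integration.integral_cong)
  also have "(LBINT t. (LBINT \<eta>. h \<eta> * ?f t \<eta>)) = (LBINT \<eta>. (LBINT t. h \<eta> * ?f t \<eta>))"
  proof (rule fubini_dominated[where a="indicator {a..b}" and b="\<lambda>\<eta>. norm (of_real \<eta> * h \<eta>)"])
    show "integrable lborel (\<lambda>\<eta>. norm (of_real \<eta> * h \<eta>))"
    proof (rule integrable_norm, rule norm_supported_integral_le[where c="2 * R * B"])
      fix x show "cmod (complex_of_real x * h x) \<le> 2 * R * B"
      proof (cases "\<bar>x\<bar> > 2 * R")
        case False
        then show ?thesis using h_le[of x] B_nonneg by (auto simp: norm_mult intro!: mult_mono)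
      qed (use R B_nonneg h_supp in auto)
    qed (auto simp: h_supp)
    show "integrable lborel (indicator {a..b} :: real \<Rightarrow> real)"
      by (intro integrable_real_indicator) (use assms in auto)
    show "(\<lambda>(t, \<eta>). h \<eta> * ?f t \<eta>) \<in> borel_measurable borel"
      unfolding borel_prod[symmetric] by measurable
    show "norm (h \<eta> * ?f t \<eta>) \<le> indicator {a..b} t * norm (of_real \<eta> * h \<eta>)" for t \<eta>
      by (auto simp: norm_mult indicator_def)
  qed
  also have "\<dots> = (LBINT \<eta>. h \<eta> * cis (\<eta> * b) - h \<eta> * cis (\<eta> * a))"
    by (simp only: integral_mult_right_zero ftc right_diff_distrib)
  also have "\<dots> = (LBINT \<eta>. h \<eta> * cis (\<eta> * b)) - (LBINT \<eta>. h \<eta> * cis (\<eta> * a))"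
    by (intro Bochner_Integration.integral_diff i1)
  finally show ?thesis by (simp add: kern_def diff_divide_distrib)
qed

end

section \<open>Fourier inversion on the line\<close>

lemma char_gaussian_scaled:
  fixes \<epsilon> \<eta> :: real
  assumes "\<epsilon> > 0"
  shows "(LBINT t. std_normal_density (\<epsilon> * t) * cis (\<eta> * t)) = of_real (exp (- (\<eta> / \<epsilon>)\<^sup>2 / 2) / \<epsilon>)"
proof -
  have "of_real (exp (- (\<eta> / \<epsilon>)\<^sup>2 / 2)) = char std_normal_distribution (\<eta> / \<epsilon>)"
    by (simp add: char_std_normal_distribution)
  also have "\<dots> = (LBINT s. std_normal_density s *\<^sub>R iexp (\<eta> / \<epsilon> * s))"
    unfolding char_def by (subst integral_density) auto
  also have "\<dots> = \<bar>\<epsilon>\<bar> *\<^sub>R (LBINT t. std_normal_density (0 + \<epsilon> * t) *\<^sub>R iexp (\<eta> / \<epsilon> * (0 + \<epsilon> * t)))"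
    using assms by (intro lborel_integral_real_affine) auto
  also have "\<dots> = \<epsilon> *\<^sub>R (LBINT t. std_normal_density (\<epsilon> * t) * cis (\<eta> * t))"
    using assms by (simp add: cis_conv_exp scaleR_conv_of_real)
  finally show ?thesis using assms by (simp add: scaleR_conv_of_real field_simps)
qed

text \<open>Multiplying the kernel by a Gaussian of width \<open>1 / \<epsilon>\<close> mollifies the symbol at scale \<open>\<epsilon>\<close>;
  both sides converge as \<open>\<epsilon> \<rightarrow> 0\<close>.\<close>

lemma integral_kern:
  fixes h :: "real \<Rightarrow> complex"
  assumes cont: "continuous_on UNIV h" and le: "\<And>x. norm (h x) \<le> B"
    and int: "integrable lborel h" "integrable lborel (kern h)"
  shows "(LBINT t. kern h t) = h 0"
proof -
  have [measurable]: "h \<in> borel_measurable borel" using cont by (rule borel_measurable_continuous_onI)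
  define \<epsilon> where "\<epsilon> n = 1 / real (Suc n)" for n
  have \<epsilon>: "\<epsilon> n > 0" for n by (simp add: \<epsilon>_def)
  have \<epsilon>0: "\<epsilon> \<longlonglongrightarrow> 0" unfolding \<epsilon>_def using LIMSEQ_inverse_real_of_nat by (simp add: inverse_eq_divide)
  \<comment> \<open>Normalised to \<open>?G 0 = 1\<close>, so that the Gaussian factor tends to 1 as
    \<epsilon> tends to 0.\<close>
  let ?G = "\<lambda>s. std_normal_density s / std_normal_density 0"
  have G0: "?G s = exp (- s\<^sup>2 / 2)" for s by (simp add: std_normal_density_def)
  have "(\<lambda>n. LBINT t. kern h t * ?G (\<epsilon> n * t)) \<longlonglongrightarrow> (LBINT t. kern h t)"
  proof (rule integral_dominated_convergence[where w="\<lambda>t. norm (kern h t)"])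
    show "AE t in lborel. (\<lambda>n. kern h t * ?G (\<epsilon> n * t)) \<longlonglongrightarrow> kern h t"
    proof (rule AE_I2)
      fix t
      have "(\<lambda>n. kern h t * of_real (exp (- (\<epsilon> n * t)\<^sup>2 / 2))) \<longlonglongrightarrow> kern h t * of_real (exp (- (0 * t)\<^sup>2 / 2))"
        by (intro tendsto_intros \<epsilon>0) auto
      then show "(\<lambda>n. kern h t * ?G (\<epsilon> n * t)) \<longlonglongrightarrow> kern h t" unfolding G0 by simp
    qed
    show "AE x in lborel. cmod (kern h x * complex_of_real (?G (\<epsilon> n * x))) \<le> cmod (kern h x)" for n
      unfolding G0 by (intro AE_I2) (simp add: norm_mult mult_left_le)
  qed (use int in auto)
  moreover have "(LBINT t. kern h t * ?G (\<epsilon> n * t)) = (LBINT s. h (\<epsilon> n * s) * std_normal_density s)" for n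
  proof -
    have "integrable lborel (\<lambda>t. std_normal_density (0 + \<epsilon> n * t))"
      using \<epsilon>[of n] by (intro lborel_integrable_real_affine integrable_normal_density) auto
    then have iG: "integrable lborel (\<lambda>t. ?G (\<epsilon> n * t))" by simp
    have "(LBINT t. kern h t * ?G (\<epsilon> n * t))
        = (LBINT t. (LBINT \<eta>. h \<eta> * (?G (\<epsilon> n * t) * cis (\<eta> * t))) / complex_of_real (2 * pi))"
    proof (intro Bochner_Integration.integral_cong refl)
      fix t
      have "(LBINT \<eta>. h \<eta> * (?G (\<epsilon> n * t) * cis (\<eta> * t))) = ?G (\<epsilon> n * t) * (LBINT \<eta>. h \<eta> * cis (\<eta> * t))"
        unfolding integral_mult_right_zero[symmetric]
        by (intro Bochner_Integration.integral_cong refl) (simp only: mult_ac)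
      then have *: "(LBINT \<eta>. h \<eta> * (?G (\<epsilon> n * t) * cis (\<eta> * t))) / complex_of_real (2 * pi)
          = ?G (\<epsilon> n * t) * (LBINT \<eta>. h \<eta> * cis (\<eta> * t)) / complex_of_real (2 * pi)"
        by (rule arg_cong)
      show "kern h t * ?G (\<epsilon> n * t)
          = (LBINT \<eta>. h \<eta> * (?G (\<epsilon> n * t) * cis (\<eta> * t))) / complex_of_real (2 * pi)"
        unfolding * by (simp only: kern_def times_divide_eq_left times_divide_eq_right mult.commute)
    qed
    also have "\<dots> = (LBINT t. (LBINT \<eta>. h \<eta> * (?G (\<epsilon> n * t) * cis (\<eta> * t)))) / complex_of_real (2 * pi)"
      by (rule integral_divide_zero)
    also have "(LBINT t. (LBINT \<eta>. h \<eta> * (?G (\<epsilon> n * t) * cis (\<eta> * t))))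
        = (LBINT \<eta>. (LBINT t. h \<eta> * (?G (\<epsilon> n * t) * cis (\<eta> * t))))"
    proof (rule fubini_dominated[where a="\<lambda>t. ?G (\<epsilon> n * t)" and b="\<lambda>\<eta>. norm (h \<eta>)"])
      show "(\<lambda>(t, \<eta>). h \<eta> * (?G (\<epsilon> n * t) * cis (\<eta> * t))) \<in> borel_measurable borel"
        unfolding G0 borel_prod[symmetric] by measurable
      show "norm (h \<eta> * (?G (\<epsilon> n * t) * cis (\<eta> * t))) \<le> ?G (\<epsilon> n * t) * norm (h \<eta>)" for t \<eta>
        unfolding G0 by (simp add: norm_mult)
    qed (use int iG in auto)
    also have "\<dots> = (LBINT \<eta>. h \<eta> * (exp (- (\<eta> / \<epsilon> n)\<^sup>2 / 2) / \<epsilon> n / std_normal_density 0))"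
    proof -
      have "(LBINT t. h \<eta> * (?G (\<epsilon> n * t) * cis (\<eta> * t)))
          = h \<eta> * ((LBINT t. std_normal_density (\<epsilon> n * t) * cis (\<eta> * t)) / std_normal_density 0)" for \<eta>
      proof -
        have "(LBINT t. h \<eta> * (?G (\<epsilon> n * t) * cis (\<eta> * t)))
            = (LBINT t. h \<eta> * ((std_normal_density (\<epsilon> n * t) * cis (\<eta> * t)) / std_normal_density 0))"
          by simp
        then show ?thesis by (simp only: integral_mult_right_zero integral_divide_zero)
      qed
      then show ?thesis by (simp add: char_gaussian_scaled[OF \<epsilon>])
    qed
    also have "\<dots> = \<bar>\<epsilon> n\<bar> *\<^sub>R (LBINT s. h (0 + \<epsilon> n * s) * (exp (- ((0 + \<epsilon> n * s) / \<epsilon> n)\<^sup>2 / 2) / \<epsilon> n / std_normal_density 0))"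
      using \<epsilon>[of n] by (intro lborel_integral_real_affine) auto
    also have "\<dots> = (LBINT s. h (\<epsilon> n * s) * exp (- s\<^sup>2 / 2) / std_normal_density 0)"
      using \<epsilon>[of n] by (simp flip: integral_scaleR_right add: scaleR_conv_of_real field_simps)
    finally have *: "(LBINT t. kern h t * ?G (\<epsilon> n * t))
        = (LBINT s. h (\<epsilon> n * s) * exp (- s\<^sup>2 / 2) / std_normal_density 0) / (2 * pi)" .
    \<comment> \<open>Dividing by \<open>std_normal_density 0\<close> multiplies by sqrt (2 pi); the
      1 / (2 pi) of \<open>kern\<close> turns this into the normalising factor 1 / sqrt (2 pi) of
      the density.\<close>
    have "sqrt (2 * pi) * sqrt (2 * pi) = 2 * pi" by simp
    then have "complex_of_real (sqrt (2 * pi)) * complex_of_real (sqrt (2 * pi)) = 2 * complex_of_real pi"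
      by (metis of_real_mult of_real_numeral)
    then show ?thesis
      unfolding * unfolding integral_divide_zero[symmetric] std_normal_density_def
      by (intro Bochner_Integration.integral_cong refl) (simp add: field_simps)
  qed
  moreover have "(\<lambda>n. LBINT s. h (\<epsilon> n * s) * std_normal_density s) \<longlonglongrightarrow> (LBINT s. h 0 * std_normal_density s)"
  proof (rule integral_dominated_convergence[where w="\<lambda>s. B * std_normal_density s"])
    show "AE s in lborel. (\<lambda>n. h (\<epsilon> n * s) * std_normal_density s) \<longlonglongrightarrow> h 0 * std_normal_density s"
    proof (rule AE_I2)
      fix s
      have "isCont h 0" using cont by (simp add: continuous_on_eq_continuous_at)
      moreover have "(\<lambda>n. \<epsilon> n * s) \<longlonglongrightarrow> 0" using tendsto_mult_left_zero[OF \<epsilon>0] .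
      ultimately have "(\<lambda>n. h (\<epsilon> n * s)) \<longlonglongrightarrow> h 0" by (metis isCont_tendsto_compose)
      then show "(\<lambda>n. h (\<epsilon> n * s) * std_normal_density s) \<longlonglongrightarrow> h 0 * std_normal_density s"
        by (intro tendsto_intros)
    qed
    show "AE s in lborel. norm (h (\<epsilon> n * s) * std_normal_density s) \<le> B * std_normal_density s" for n
      using le by (intro AE_I2) (auto simp: norm_mult intro!: mult_right_mono)
  qed (auto intro!: integrable_mult_right integrable_normal_density)
  moreover have "(LBINT s. h 0 * std_normal_density s) = h 0"
  proof -
    have "(LBINT s. h 0 * std_normal_density s) = h 0 * of_real (LBINT s. std_normal_density s)"
      by (simp only: integral_mult_right_zero integral_complex_of_real)
    then show ?thesis by simp
  qed
  ultimately show ?thesis using LIMSEQ_unique by fastforce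
qed

text \<open>Translating the symbol by \<xi> modulates its kernel, so inversion at \<xi> is inversion
  at 0 for the translated symbol.\<close>

lemma fourier_inversion_kern:
  fixes h :: "real \<Rightarrow> complex"
  assumes cont: "continuous_on UNIV h" and le: "\<And>x. norm (h x) \<le> B"
    and int: "integrable lborel h" "integrable lborel (kern h)"
  shows "(LBINT t. kern h t * cis (- (\<xi> * t))) = h \<xi>"
proof -
  let ?h = "\<lambda>\<eta>. h (\<xi> + 1 * \<eta>)"
  have [measurable]: "h \<in> borel_measurable borel" using cont by (rule borel_measurable_continuous_onI)
  have k: "kern ?h t = kern h t * cis (- (\<xi> * t))" for t
  proof -
    have "(LBINT \<eta>. h \<eta> * cis (\<eta> * t)) = \<bar>1\<bar> *\<^sub>R (LBINT \<eta>. h (\<xi> + 1 * \<eta>) * cis ((\<xi> + 1 * \<eta>) * t))"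
      by (rule lborel_integral_real_affine) simp
    also have "\<dots> = cis (\<xi> * t) * (LBINT \<eta>. h (\<xi> + 1 * \<eta>) * cis (\<eta> * t))"
    proof -
      have "cis ((\<xi> + 1 * \<eta>) * t) = cis (\<xi> * t) * cis (\<eta> * t)" for \<eta>
        by (simp add: cis_mult distrib_right)
      then show ?thesis
        unfolding integral_mult_right_zero[symmetric]
        by (simp only: mult_ac abs_one scaleR_one)
    qed
    finally have "(LBINT \<eta>. h \<eta> * cis (\<eta> * t)) * cis (- (\<xi> * t))
        = (cis (\<xi> * t) * cis (- (\<xi> * t))) * (LBINT \<eta>. h (\<xi> + 1 * \<eta>) * cis (\<eta> * t))"
      by simp
    then show ?thesis by (simp add: kern_def cis_mult)
  qed
  have "(LBINT t. kern ?h t) = ?h 0"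
  proof (rule integral_kern)
    show "continuous_on UNIV ?h" by (intro continuous_intros continuous_on_compose2[OF cont]) auto
    show "integrable lborel ?h" by (intro lborel_integrable_real_affine int) simp
    show "integrable lborel (kern ?h)"
      unfolding k by (rule Bochner_Integration.integrable_bound[OF int(2)]) (auto simp: norm_mult)
  qed (use le in auto)
  then show ?thesis by (simp only: k) simp
qed

section \<open>Low-pass kernels of a dyadic resolution\<close>

locale resolution =
  fixes \<phi> :: "nat \<Rightarrow> real \<Rightarrow> complex"
  assumes resolution: "dyadic_resolution \<phi>"
begin

text \<open>The l-th derivative of \<phi>_0 + ... + \<phi>_N, written as a sum of derivatives so
  that differentiation raises l by one.\<close>

definition low_pass :: "nat \<Rightarrow> nat \<Rightarrow> real \<Rightarrow> complex" where
  "low_pass l N x = (\<Sum>n\<le>N. iter_deriv l (\<phi> n) x)"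

abbreviation "K N \<equiv> kern (low_pass 0 N)"

text \<open>The derivative of \<open>K N\<close>, represented by its symbol.\<close>

abbreviation "K' N \<equiv> kern (\<lambda>\<eta>. \<i> * \<eta> * low_pass 0 N \<eta>)"

lemma iter_deriv_0: "iter_deriv 0 f = f"
  by (simp add: iter_deriv_def)

lemma iter_deriv_has_vector_derivative:
  "(iter_deriv l (\<phi> n) has_vector_derivative iter_deriv (Suc l) (\<phi> n) x) (at x)"
proof -
  have "iter_deriv l (\<phi> n) differentiable (at x)"
    using resolution by (simp add: dyadic_resolution_def test_function_def)
  then show ?thesis by (simp add: iter_deriv_def vector_derivative_works)
qed

lemma low_pass_has_vector_derivative:
  "(low_pass l N has_vector_derivative low_pass (Suc l) N x) (at x)"
  unfolding low_pass_def[abs_def] by (intro has_vector_derivative_sum iter_deriv_has_vector_derivative)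

lemma continuous_on_low_pass: "continuous_on A (low_pass l N)"
  using low_pass_has_vector_derivative
  by (meson continuous_on_vector_derivative has_vector_derivative_at_within)

lemma supp_zero: "x \<notin> supp f \<Longrightarrow> f x = 0"
  using closure_subset[of "{x. f x \<noteq> 0}"] by (auto simp: supp_def)

lemma
  shows phi_zero_above: "\<bar>x\<bar> > 2 ^ (n + 1) \<Longrightarrow> \<phi> n x = 0"
    and phi_zero_below: "n \<ge> 1 \<Longrightarrow> \<bar>x\<bar> < 2 ^ (n - 1) \<Longrightarrow> \<phi> n x = 0"
proof -
  have s: "supp (\<phi> 0) \<subseteq> {x. \<bar>x\<bar> \<le> 2}"
    "n \<ge> 1 \<Longrightarrow> supp (\<phi> n) \<subseteq> {x. 2 ^ (n - 1) \<le> \<bar>x\<bar> \<and> \<bar>x\<bar> \<le> 2 ^ (n + 1)}"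
    using resolution by (auto simp: dyadic_resolution_def)
  show "\<bar>x\<bar> > 2 ^ (n + 1) \<Longrightarrow> \<phi> n x = 0"
    using s by (cases "n = 0") (auto intro!: supp_zero)
  show "n \<ge> 1 \<Longrightarrow> \<bar>x\<bar> < 2 ^ (n - 1) \<Longrightarrow> \<phi> n x = 0"
    using s by (auto intro!: supp_zero)
qed

lemma iter_deriv_zero_above: "\<bar>x\<bar> > 2 ^ (n + 1) \<Longrightarrow> iter_deriv l (\<phi> n) x = 0"
proof (induction l arbitrary: x)
  case (Suc l)
  have "open {x::real. \<bar>x\<bar> > 2 ^ (n + 1)}" by (intro open_Collect_less continuous_intros)
  then have "(iter_deriv l (\<phi> n) has_vector_derivative 0) (at x)"
    by (rule has_vector_derivative_transform_within_open[OF has_vector_derivative_const[of 0]])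
      (use Suc in auto)
  then show ?case using iter_deriv_has_vector_derivative vector_derivative_unique_at by blast
qed (simp add: iter_deriv_0 phi_zero_above)

lemma low_pass_zero: "\<bar>x\<bar> > 2 * 2 ^ N \<Longrightarrow> low_pass l N x = 0"
  unfolding low_pass_def
proof (intro sum.neutral ballI iter_deriv_zero_above)
  fix n assume "\<bar>x\<bar> > 2 * 2 ^ N" "n \<in> {..N}"
  moreover from this have "(2::real) ^ (n + 1) \<le> 2 ^ (N + 1)" by (intro power_increasing) auto
  ultimately show "\<bar>x\<bar> > 2 ^ (n + 1)" unfolding power_add power_one_right by linarith
qed

text \<open>For n > N the support of \<phi>_n starts at 2^(n-1) \<ge> 2^N, so the partial sum is
  already the whole partition of unity.\<close>

lemma low_pass_one: "\<bar>x\<bar> < 2 ^ N \<Longrightarrow> low_pass 0 N x = 1"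
proof -
  assume x: "\<bar>x\<bar> < 2 ^ N"
  have "\<phi> n x = 0" if "n \<notin> {..N}" for n
  proof (rule phi_zero_below)
    have "(2::real) ^ N \<le> 2 ^ (n - 1)" using that by (intro power_increasing) auto
    then show "\<bar>x\<bar> < 2 ^ (n - 1)" using x by linarith
  qed (use that in auto)
  then have "(\<lambda>n. \<phi> n x) sums (\<Sum>n\<le>N. \<phi> n x)" by (intro sums_finite) auto
  moreover have "(\<lambda>n. \<phi> n x) sums 1" using resolution by (auto simp: dyadic_resolution_def)
  ultimately show "low_pass 0 N x = 1" using sums_unique2 by (auto simp: low_pass_def iter_deriv_0)
qed

lemma low_pass_deriv_zero:
  assumes "\<bar>x\<bar> < 2 ^ N" "l \<ge> 1"
  shows "low_pass l N x = 0"
  using assms(2,1)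
proof (induction l arbitrary: x rule: nat_induct_at_least)
  have op: "open {x::real. \<bar>x\<bar> < 2 ^ N}" by (intro open_Collect_less continuous_intros)
  {
    case (base x)
    have "(low_pass 0 N has_vector_derivative 0) (at x)"
      using op by (rule has_vector_derivative_transform_within_open[OF has_vector_derivative_const[of 1]])
        (use base low_pass_one in auto)
    then show ?case using low_pass_has_vector_derivative[of 0 N x] vector_derivative_unique_at by fastforce
  next
    case (Suc l x)
    have "(low_pass l N has_vector_derivative 0) (at x)"
      using op by (rule has_vector_derivative_transform_within_open[OF has_vector_derivative_const[of 0]])
        (use Suc in auto)
    then show ?case using low_pass_has_vector_derivative vector_derivative_unique_at by blast
  }
qed

text \<open>Below 2^N the symbol is constant, and beyond it only \<phi>_(N-1) and \<phi>_N are left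
  of the sum; so the bound does not grow with the number of summands.\<close>

lemma low_pass_bound: "\<exists>C\<ge>0. \<forall>N x. norm (low_pass l N x) \<le> C / 2 ^ (N * l)"
proof -
  obtain B where "\<And>n x. 2 ^ (n * l) * norm (iter_deriv l (\<phi> n) x) \<le> B"
    using resolution by (fastforce simp: dyadic_resolution_def)
  then have B: "norm (iter_deriv l (\<phi> n) x) \<le> B / 2 ^ (n * l)" for n x
    by (simp add: pos_le_divide_eq mult.commute[of _ "2 ^ (n * l)"])
  have B0: "B \<ge> 0" using order_trans[OF norm_ge_zero B[of 0 0]] by simp
  \<comment> \<open>The 1 covers the constant value below 2^N when l = 0; B and 2^l B come from n =
    N and from n = N - 1, which is one scale coarser.\<close>
  have "norm (low_pass l N x) \<le> (1 + (1 + 2 ^ l) * B) / 2 ^ (N * l)" for N x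
  proof (cases "\<bar>x\<bar> < 2 ^ N")
    case True
    then show ?thesis using B0 low_pass_one[OF True] low_pass_deriv_zero[OF True, of l] by (cases "l = 0") auto
  next
    case False
    have z: "iter_deriv l (\<phi> n) x = 0" if "Suc n < N" for n
    proof (rule iter_deriv_zero_above)
      have "(2::real) ^ (n + 1) < 2 ^ N" using that by (intro power_strict_increasing) auto
      then show "2 ^ (n + 1) < \<bar>x\<bar>" using False by linarith
    qed
    have "low_pass l N x = (\<Sum>n\<in>{N-1..N}. iter_deriv l (\<phi> n) x)"
      unfolding low_pass_def by (intro sum.mono_neutral_right) (auto intro!: z)
    also have "norm \<dots> \<le> (\<Sum>n\<in>{N-1..N}. B / 2 ^ (n * l))"
      by (intro order_trans[OF norm_sum] sum_mono B)
    also have "\<dots> \<le> (1 + 2 ^ l) * B / 2 ^ (N * l)"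
    proof (cases N)
      case 0
      then show ?thesis using B0 by (simp add: mult_right_mono[of 1 _ B, simplified])
    next
      case (Suc M)
      then have "{N-1..N} = {M, N}" by auto
      then show ?thesis using Suc B0 by (simp add: power_add field_simps)
    qed
    also have "\<dots> \<le> (1 + (1 + 2 ^ l) * B) / 2 ^ (N * l)"
      by (intro divide_right_mono) auto
    finally show ?thesis .
  qed
  moreover have "1 + (1 + 2 ^ l) * B \<ge> 0" using B0 by simp
  ultimately show ?thesis by blast
qed

abbreviation "low_bump N \<equiv> bump (low_pass 0 N) (low_pass 1 N) (low_pass 2 N) (2 ^ N)"

abbreviation "deriv_bump N \<equiv> bump (\<lambda>\<eta>. \<i> * \<eta> * low_pass 0 N \<eta>)
   (\<lambda>\<eta>. \<i> * \<eta> * low_pass 1 N \<eta> + \<i> * low_pass 0 N \<eta>)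
   (\<lambda>\<eta>. \<i> * \<eta> * low_pass 2 N \<eta> + 2 * \<i> * low_pass 1 N \<eta>) (2 ^ N)"

text \<open>On the support |\<eta>| \<le> 2 * 2^N, so the factor \<eta> costs one power 2^N. This is
  the origin of the O(2^N) variation of K.\<close>

lemma bump_low_pass:
  "\<exists>C>0. \<forall>N. low_bump N C \<and>
     deriv_bump N (C * 2 ^ N)"
proof -
  obtain C0 C1 C2 where C: "C0 \<ge> 0" "\<And>N x. norm (low_pass 0 N x) \<le> C0"
    "C1 \<ge> 0" "\<And>N x. norm (low_pass 1 N x) \<le> C1 / 2 ^ N"
    "C2 \<ge> 0" "\<And>N x. norm (low_pass 2 N x) \<le> C2 / 2 ^ (N * 2)"
    using low_pass_bound[of 0] low_pass_bound[of 1] low_pass_bound[of 2] by auto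
  define D where "D = 1 + 2 * C0 + 2 * C1 + 2 * C2"
  have i: "((\<lambda>\<eta>. \<i> * complex_of_real \<eta>) has_vector_derivative \<i>) (at x)" for x
    by (auto intro!: derivative_eq_intros)
  have D: "D > 0" "C0 \<le> D" "C2 \<le> D" "2 * C0 \<le> D" "2 * C1 + 2 * C2 \<le> D"
    using C(1,3,5) by (auto simp: D_def)
  have ld1: "(low_pass 0 N has_vector_derivative low_pass 1 N x) (at x)"
    and ld2: "(low_pass 1 N has_vector_derivative low_pass 2 N x) (at x)" for N x
    using low_pass_has_vector_derivative[of 0 N x] low_pass_has_vector_derivative[of 1 N x]
    by (auto simp: numeral_2_eq_2)
  have sq: "((2::real) ^ N)\<^sup>2 = 2 ^ (N * 2)" for N by (simp add: power_mult)
  have small: "\<bar>x\<bar> \<le> 2 * 2 ^ N" if "low_pass l N x \<noteq> 0" for l N x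
    using that low_pass_zero[of N x l] by fastforce
  have xle: "\<bar>x\<bar> * norm (low_pass l N x) \<le> 2 * 2 ^ N * norm (low_pass l N x)" for x l N
    using small[of l N x] by (cases "low_pass l N x = 0") (auto intro!: mult_right_mono)
  have "low_bump N D" for N
  proof
    show "norm (low_pass 2 N x) \<le> D / (2 ^ N)\<^sup>2" for x
      unfolding sq by (rule order_trans[OF C(6)]) (use D in \<open>auto intro!: divide_right_mono\<close>)
    show "norm (low_pass 0 N x) \<le> D" for x by (rule order_trans[OF C(2) D(2)])
  qed (use low_pass_zero ld1 ld2 continuous_on_low_pass in auto)
  moreover have "deriv_bump N (D * 2 ^ N)" for N
  proof
    show "((\<lambda>\<eta>. \<i> * \<eta> * low_pass 0 N \<eta>) has_vector_derivative (\<i> * x * low_pass 1 N x + \<i> * low_pass 0 N x)) (at x)" for x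
      by (intro has_vector_derivative_mult i ld1)
    have "((\<lambda>\<eta>. \<i> * \<eta> * low_pass 1 N \<eta> + \<i> * low_pass 0 N \<eta>) has_vector_derivative
        (\<i> * x * low_pass 2 N x + \<i> * low_pass 1 N x) + \<i> * low_pass 1 N x) (at x)" for x
      by (intro has_vector_derivative_mult has_vector_derivative_add has_vector_derivative_mult_right i ld1 ld2)
    then show "((\<lambda>\<eta>. \<i> * \<eta> * low_pass 1 N \<eta> + \<i> * low_pass 0 N \<eta>) has_vector_derivative
        (\<i> * x * low_pass 2 N x + 2 * \<i> * low_pass 1 N x)) (at x)" for x
      by (simp add: algebra_simps)
    show "norm (\<i> * x * low_pass 0 N x) \<le> D * 2 ^ N" for x
    proof -
      have "norm (\<i> * x * low_pass 0 N x) = \<bar>x\<bar> * norm (low_pass 0 N x)" by (simp add: norm_mult)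
      also have "\<dots> \<le> 2 * 2 ^ N * C0" by (rule order_trans[OF xle]) (use C in auto)
      also have "\<dots> \<le> D * 2 ^ N" using D by simp
      finally show ?thesis .
    qed
    show "norm (\<i> * x * low_pass 2 N x + 2 * \<i> * low_pass 1 N x) \<le> D * 2 ^ N / (2 ^ N)\<^sup>2" for x
    proof -
      have "norm (\<i> * x * low_pass 2 N x + 2 * \<i> * low_pass 1 N x)
          \<le> \<bar>x\<bar> * norm (low_pass 2 N x) + 2 * norm (low_pass 1 N x)"
        by (rule order_trans[OF norm_triangle_ineq]) (simp add: norm_mult)
      also have "\<dots> \<le> 2 * 2 ^ N * (C2 / 2 ^ (N * 2)) + 2 * (C1 / 2 ^ N)"
        by (intro add_mono order_trans[OF xle] mult_left_mono C) auto
      also have "\<dots> = (2 * C1 + 2 * C2) / 2 ^ N"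
        by (simp add: power_mult power2_eq_square field_simps)
      also have "\<dots> \<le> D / 2 ^ N" using D by (intro divide_right_mono) auto
      also have "\<dots> = D * 2 ^ N / (2 ^ N)\<^sup>2" by (simp add: power2_eq_square)
      finally show ?thesis .
    qed
  qed (auto simp: low_pass_zero intro!: continuous_intros continuous_on_low_pass)
  ultimately show ?thesis using D by blast
qed

lemma low_pass_measurable [measurable]: "low_pass l N \<in> borel_measurable borel"
  by (intro borel_measurable_continuous_onI continuous_on_low_pass)

lemma
  shows low_pass_integrable: "integrable lborel (low_pass 0 N)"
    and K_integrable: "integrable lborel (K N)"
    and K'_integrable: "integrable lborel (K' N)"
    and K_inversion: "(LBINT t. K N t * cis (- (\<xi> * t))) = low_pass 0 N \<xi>"
proof -
  obtain C where C: "low_bump N C"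
     "deriv_bump N (C * 2 ^ N)"
    using bump_low_pass by blast
  show "integrable lborel (low_pass 0 N)" by (rule bump.h_integrable[OF C(1)])
  show "integrable lborel (K N)" by (rule bump.kern_integrable[OF C(1)])
  show "integrable lborel (K' N)" by (rule bump.kern_integrable[OF C(2)])
  show "(LBINT t. K N t * cis (- (\<xi> * t))) = low_pass 0 N \<xi>"
    by (rule fourier_inversion_kern[OF continuous_on_low_pass bump.h_le[OF C(1)]
          bump.h_integrable[OF C(1)] bump.kern_integrable[OF C(1)]])
qed

definition K_bounded :: "real \<Rightarrow> bool" where
  "K_bounded C \<longleftrightarrow> C > 0 \<and> (\<forall>N. (LBINT t. norm (K N t)) \<le> C \<and> (LBINT t. norm (K' N t)) \<le> C * 2 ^ N \<and>
     (\<forall>t. norm (K N t) \<le> C * 2 ^ N) \<and> (\<forall>t. norm (K N t) \<le> C * 2 ^ N / (1 + (2 ^ N * t)\<^sup>2)) \<and>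
     (\<forall>a b. a \<le> b \<longrightarrow> K N b - K N a = (LBINT t. indicator {a..b} t * K' N t)))"

lemma K_bounds: "\<exists>C. K_bounded C"
proof -
  obtain C where C: "C > 0" "\<And>N. low_bump N C"
     "\<And>N. deriv_bump N (C * 2 ^ N)"
    using bump_low_pass by blast
  have le: "2 * 2 ^ N * C \<le> (2 * C * pi) * 2 ^ N" for N
    using C pi_gt3 by (simp add: field_simps)
  have "norm (K N t) \<le> (2 * C * pi) * 2 ^ N / (1 + (2 ^ N * t)\<^sup>2)" for N t
    by (rule order_trans[OF bump.kern_le[OF C(2)]])
      (intro divide_right_mono le, simp add: add_pos_nonneg)
  moreover have "norm (K N t) \<le> (2 * C * pi) * 2 ^ N" for N t
    by (rule order_trans[OF bump.kern_sup_le[OF C(2)] le])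
  moreover have "(LBINT t. norm (K' N t)) \<le> (2 * C * pi) * 2 ^ N" for N
    using bump.kern_L1_le[OF C(3), of N] by (simp add: mult_ac)
  ultimately show ?thesis
    unfolding K_bounded_def
    using C(1) bump.kern_L1_le[OF C(2)] bump.kern_diff[OF C(2)]
    by (intro exI[of _ "2 * C * pi"]) auto
qed

text \<open>Fixed by choice from \<phi> alone, so that constants built from it are explicit terms
  free of n, f and g.\<close>

definition K_const :: real where
  "K_const = (SOME C. K_bounded C)"

lemma
  shows K_const_pos: "K_const > 0"
    and K_L1: "(LBINT t. norm (K N t)) \<le> K_const"
    and K'_L1: "(LBINT t. norm (K' N t)) \<le> K_const * 2 ^ N"
    and K_sup: "norm (K N t) \<le> K_const * 2 ^ N"
    and K_decay: "norm (K N t) \<le> K_const * 2 ^ N / (1 + (2 ^ N * t)\<^sup>2)"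
    and K_diff: "a \<le> b \<Longrightarrow> K N b - K N a = (LBINT t. indicator {a..b} t * K' N t)"
  using someI_ex[OF K_bounds, folded K_const_def] by (auto simp: K_bounded_def)

text \<open>The running integral V of |K'| dominates the increments of K, and the increments of V
  telescope. Hence the bound depends neither on the mesh nor on the number of steps nor on the
  shift.\<close>

lemma K_total_variation:
  assumes "h \<ge> 0"
  shows "(\<Sum>m<M. norm (K N (h * real (Suc m) - y) - K N (h * real m - y))) \<le> K_const * 2 ^ N"
proof -
  define V where "V t = (LBINT s. indicator {..t} s * norm (K' N s))" for t
  have [measurable]: "K' N \<in> borel_measurable borel" using K'_integrable by simp
  have i: "integrable lborel (\<lambda>s. indicator {..t} s * norm (K' N s))" for t
    by (rule integrable_dominated[OF integrable_norm[OF K'_integrable]]) (auto simp: indicator_def)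
  have V: "norm (K N b - K N a) \<le> V b - V a" if "a \<le> b" for a b
  proof -
    have i2: "integrable lborel (\<lambda>s. indicator {a..b} s * K' N s)"
      by (rule integrable_dominated[OF integrable_norm[OF K'_integrable]]) (auto simp: indicator_def)
    have "norm (K N b - K N a) \<le> (LBINT s. norm (indicator {a..b} s * K' N s))"
      unfolding K_diff[OF that] by (rule integral_norm_bound)
    also have "\<dots> = (LBINT s. indicator {..b} s * norm (K' N s) - indicator {..a} s * norm (K' N s))"
    proof (rule integral_cong_AE)
      \<comment> \<open>The two sides can differ only at the endpoint s = a.\<close>
      show "AE s in lborel. norm (indicator {a..b} s * K' N s)
          = indicator {..b} s * norm (K' N s) - indicator {..a} s * norm (K' N s)"
        using AE_lborel_singleton[of a]
        by eventually_elim (use that in \<open>auto simp: indicator_def norm_mult\<close>)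
    qed auto
    also have "\<dots> = V b - V a" unfolding V_def by (intro Bochner_Integration.integral_diff i)
    finally show ?thesis .
  qed
  have "(\<Sum>m<M. norm (K N (h * real (Suc m) - y) - K N (h * real m - y)))
      \<le> (\<Sum>m<M. V (h * real (Suc m) - y) - V (h * real m - y))"
    by (intro sum_mono V diff_right_mono mult_left_mono) (use assms in auto)
  also have "\<dots> = V (h * real M - y) - V (h * real 0 - y)"
    by (rule sum_lessThan_telescope)
  also have "\<dots> \<le> (LBINT t. norm (K' N t)) - 0"
  proof (rule diff_mono)
    show "V (h * real M - y) \<le> (LBINT t. norm (K' N t))"
      unfolding V_def by (intro integral_mono i integrable_norm K'_integrable) (auto simp: indicator_def)
  qed (auto simp: V_def intro!: Bochner_Integration.integral_nonneg)
  finally show ?thesis using K'_L1[of N] by simp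
qed

lemma K_shift_integrable: "integrable lborel (\<lambda>y. K N (x - y))"
  using lborel_integrable_real_affine[OF K_integrable, of "-1" N x] by simp

lemma K_shift_L1: "(LBINT y. norm (K N (x - y))) \<le> K_const"
  using lborel_integral_real_affine[of "-1" "\<lambda>t. norm (K N t)" x] K_L1[of N] by simp

lemma K_interval_le: "norm (LBINT t. indicator {a..b} t * K N (t - y)) \<le> K_const"
proof -
  have i: "integrable lborel (\<lambda>t. K N (t - y))"
    using lborel_integrable_real_affine[OF K_integrable, of 1 N "-y"] by simp
  have [measurable]: "K N \<in> borel_measurable borel" using K_integrable by simp
  have "norm (LBINT t. indicator {a..b} t * K N (t - y)) \<le> (LBINT t. norm (K N (t - y)))"
    by (intro order_trans[OF integral_norm_bound] integral_mono integrable_norm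
        integrable_dominated[OF integrable_norm[OF i]] i) (auto simp: indicator_def)
  then show ?thesis
    using lborel_integral_real_affine[of 1 "\<lambda>t. norm (K N t)" "-y"] K_L1[of N] by simp
qed

text \<open>K N has integral 1 and concentrates at scale 2^(-N). Since y has a positive distance
  \<delta> from both endpoints, the indicator is constant near y and the decay of K handles the
  rest, with the rate W 2^(-N).\<close>

lemma K_interval_tendsto:
  assumes "y \<noteq> a" "y \<noteq> b"
  shows "(\<lambda>N. LBINT t. indicator {a..b} t * K N (t - y)) \<longlonglongrightarrow> indicator {a..b} y"
proof -
  define c d \<delta> \<theta> where "c = a - y" and "d = b - y" and "\<delta> = min \<bar>c\<bar> \<bar>d\<bar>" and "\<theta> = (indicator {a..b} y :: real)"
  have \<delta>: "\<delta> > 0" using assms by (auto simp: \<delta>_def c_def d_def)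
  define W where "W = K_const * (1 + 1 / \<delta>\<^sup>2) * pi"
  have K1: "(LBINT t. K N t) = 1" for N using K_inversion[of N 0] low_pass_one[of 0 N] by simp
  have meas [measurable]: "K N \<in> borel_measurable borel" for N using K_integrable by simp
  have le: "norm ((LBINT t. indicator {a..b} t * K N (t - y)) - of_real \<theta>) \<le> W * (1 / 2) ^ N" for N
  proof -
    have i: "integrable lborel (\<lambda>t. indicator {c..d} t * K N t)"
      by (rule integrable_dominated[OF integrable_norm[OF K_integrable]]) (auto simp: indicator_def)
    have "(LBINT t. indicator {a..b} t * K N (t - y))
        = (LBINT t. indicator {a..b} (y + 1 * t) * K N ((y + 1 * t) - y))"
      using lborel_integral_real_affine[of 1 "\<lambda>t. indicator {a..b} t * K N (t - y)" y] by simp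
    also have "\<dots> = (LBINT t. indicator {c..d} t * K N t)"
      by (intro Bochner_Integration.integral_cong refl) (auto simp: indicator_def c_def d_def)
    finally have "(LBINT t. indicator {a..b} t * K N (t - y)) - of_real \<theta>
        = (LBINT t. indicator {c..d} t * K N t) - of_real \<theta> * (LBINT t. K N t)"
      by (simp add: K1)
    also have "\<dots> = (LBINT t. indicator {c..d} t * K N t - of_real \<theta> * K N t)"
      using i K_integrable by simp
    also have "norm \<dots> \<le> (LBINT t. norm (indicator {c..d} t * K N t - of_real \<theta> * K N t))"
      by (rule integral_norm_bound)
    also have "\<dots> \<le> (LBINT t. (K_const * (1 + 1 / \<delta>\<^sup>2) * (1 / 2) ^ N) * inverse (1 + t\<^sup>2))"
    proof (rule integral_mono)
      fix t
      show "norm (indicator {c..d} t * K N t - of_real \<theta> * K N t) \<le> (K_const * (1 + 1 / \<delta>\<^sup>2) * (1 / 2) ^ N) * inverse (1 + t\<^sup>2)"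
      proof (cases "\<bar>t\<bar> < \<delta>")
        case True
        then have th: "indicator {c..d} t = \<theta>" using assms
          by (auto simp: \<delta>_def \<theta>_def c_def d_def indicator_def split: if_splits)
        have "indicator {c..d} t = complex_of_real \<theta>"
          unfolding th[symmetric] by (simp add: indicator_def)
        then show ?thesis using K_const_pos by (simp add: add_pos_nonneg add_nonneg_nonneg)
      next
        case False
        have "norm (indicator {c..d} t * K N t - of_real \<theta> * K N t) \<le> norm (K N t)"
          by (auto simp: indicator_def \<theta>_def)
        also have "\<dots> \<le> K_const * 2 ^ N / (1 + (2 ^ N * t)\<^sup>2)" by (rule K_decay)
        \<comment> \<open>For |t| \<ge> \<delta> the square t^2 dominates a multiple of 1 + t^2; the
          majorant stays integrable over the line and gains the factor 2^(-N).\<close>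
        also have "\<dots> \<le> K_const * 2 ^ N / ((2 ^ N)\<^sup>2 * (\<delta>\<^sup>2 / (1 + \<delta>\<^sup>2) * (1 + t\<^sup>2)))"
        proof (rule divide_left_mono)
          have "\<delta>\<^sup>2 \<le> t\<^sup>2" using False \<delta> by (simp add: abs_le_square_iff[symmetric])
          then have "\<delta>\<^sup>2 * (1 + t\<^sup>2) \<le> t\<^sup>2 * (1 + \<delta>\<^sup>2)" by (simp add: algebra_simps)
          then have "\<delta>\<^sup>2 / (1 + \<delta>\<^sup>2) * (1 + t\<^sup>2) \<le> t\<^sup>2" by (simp add: divide_simps add_pos_nonneg)
          then have "(2 ^ N)\<^sup>2 * (\<delta>\<^sup>2 / (1 + \<delta>\<^sup>2) * (1 + t\<^sup>2)) \<le> (2 ^ N)\<^sup>2 * t\<^sup>2"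
            by (intro mult_left_mono) auto
          then show "(2 ^ N)\<^sup>2 * (\<delta>\<^sup>2 / (1 + \<delta>\<^sup>2) * (1 + t\<^sup>2)) \<le> 1 + (2 ^ N * t)\<^sup>2"
            by (simp add: power_mult_distrib)
        qed (use K_const_pos \<delta> in \<open>auto intro!: mult_pos_pos divide_pos_pos add_pos_nonneg\<close>)
        also have "\<dots> = (K_const * (1 + 1 / \<delta>\<^sup>2) * (1 / 2) ^ N) * inverse (1 + t\<^sup>2)"
        proof -
          have "1 + 1 / \<delta>\<^sup>2 = (1 + \<delta>\<^sup>2) / \<delta>\<^sup>2" using \<delta> by (simp add: field_simps)
          then have "(K_const * (1 + 1 / \<delta>\<^sup>2) * (1 / 2) ^ N) * inverse (1 + t\<^sup>2)
              = K_const * ((1 + \<delta>\<^sup>2) / \<delta>\<^sup>2) * (1 / 2 ^ N) * (1 / (1 + t\<^sup>2))"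
            by (simp only: power_one_over inverse_eq_divide)
          moreover have "K_const * x / (x\<^sup>2 * (u / v * w)) = K_const * (v / u) * (1 / x) * (1 / w)" if "x > 0" for x u v w :: real
            using that by (simp add: power2_eq_square)
          ultimately show ?thesis by simp
        qed
        finally show ?thesis .
      qed
    qed (use i K_integrable integrable_inverse_1_plus_square' in auto)
    also have "\<dots> = W * (1 / 2) ^ N"
      by (simp add: W_def integral_inverse_1_plus_square)
    finally show ?thesis .
  qed
  moreover have "(\<lambda>N. W * (1 / 2) ^ N) \<longlonglongrightarrow> W * 0"
    by (intro tendsto_intros LIMSEQ_power_zero) auto
  ultimately have "(\<lambda>N. (LBINT t. indicator {a..b} t * K N (t - y)) - of_real \<theta>) \<longlonglongrightarrow> 0"
    by (intro Lim_null_comparison[OF always_eventually[OF allI[OF le]]]) simp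
  then have "(\<lambda>N. LBINT t. indicator {a..b} t * K N (t - y)) \<longlonglongrightarrow> of_real \<theta>"
    by (simp add: LIM_zero_iff)
  moreover have "complex_of_real \<theta> = indicator {a..b} y" by (simp add: \<theta>_def indicator_def)
  ultimately show ?thesis by (simp only:)
qed

end

section \<open>Faber coefficients as tensor products\<close>

lemma finite_fun_set:
  fixes B :: "'d::finite \<Rightarrow> 'b set"
  assumes "\<And>i. finite (B i)"
  shows "finite {g. \<forall>i. g i \<in> B i}"
proof -
  have "{g. \<forall>i. g i \<in> B i} = PiE UNIV B" by (auto simp: PiE_UNIV_domain Pi_def)
  then show ?thesis using assms by (auto intro!: finite_PiE)
qed

text \<open>Distributivity over multi-index sets: it reduces sums over nodes, shifts, levels and
  frequencies to products of one-dimensional sums.\<close>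

lemma sum_prod_fun_set:
  fixes f :: "'d::finite \<Rightarrow> 'b \<Rightarrow> 'c :: comm_semiring_1"
  assumes "\<And>i. finite (B i)"
  shows "(\<Sum>g | \<forall>i. g i \<in> B i. \<Prod>i\<in>UNIV. f i (g i)) = (\<Prod>i\<in>UNIV. \<Sum>y\<in>B i. f i y)"
proof -
  have "{g. \<forall>i. g i \<in> B i} = PiE UNIV B" by (auto simp: PiE_UNIV_domain Pi_def)
  then show ?thesis using assms by (subst prod_sum_PiE) auto
qed

lemma sum_PiE_insert:
  assumes "finite A" "x \<notin> A" "\<And>i. finite (B i)"
  shows "(\<Sum>g\<in>PiE (insert x A) B. F g) = (\<Sum>y\<in>B x. \<Sum>g\<in>PiE A B. F (g(x := y)))"
proof -
  have "(\<Sum>g\<in>PiE (insert x A) B. F g) = (\<Sum>(y, g)\<in>B x \<times> PiE A B. F (g(x := y)))"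
    using assms
    by (intro sum.reindex_bij_witness[of _ "\<lambda>(y,g). g(x := y)" "\<lambda>g. (g x, g(x := undefined))"])
       (auto simp: PiE_def extensional_def)
  also have "\<dots> = (\<Sum>y\<in>B x. \<Sum>g\<in>PiE A B. F (g(x := y)))"
    by (subst sum.cartesian_product) auto
  finally show ?thesis .
qed

text \<open>The coefficients 1, -2, 1 of a second difference at its nodes s = 0, 1, 2.\<close>

definition diff_weight :: "nat \<Rightarrow> complex" where
  "diff_weight s = (if s = 1 then - 2 else 1)"

text \<open>Replaces the folded composition of operators by one sum over 3^|e| sample points, which
  can be matched with tensor products.\<close>

lemma mixed_diff_expand:
  assumes "finite e"
  shows "mixed_diff e h f x = (\<Sum>s\<in>PiE e (\<lambda>_. {..<3}).
    (\<Prod>i\<in>e. diff_weight (s i)) * f (x + (\<Sum>i\<in>e. (h i * real (s i)) *\<^sub>R axis i 1)))"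
  using assms
proof (induction e arbitrary: x rule: finite_induct)
  case empty
  then show ?case by (simp add: mixed_diff_def)
next
  case (insert i e)
  interpret comp_fun_commute "\<lambda>i. second_diff i (h i)" by (rule comp_fun_commute_second_diff)
  let ?S = "PiE e (\<lambda>_. {..<3::nat})"
  let ?v = "\<lambda>s. \<Sum>i\<in>e. (h i * real (s i)) *\<^sub>R axis i 1"
  let ?G = "\<lambda>s x. (\<Prod>i\<in>e. diff_weight (s i)) * f (x + ?v s)"
  have 3: "{..<3::nat} = {0, 1, 2}" by auto
  have "mixed_diff (insert i e) h f x = second_diff i (h i) (mixed_diff e h f) x"
    using insert by (simp add: mixed_diff_def)
  also have "\<dots> = (\<Sum>y<3. \<Sum>s\<in>?S. diff_weight y * ?G s (x + (h i * real y) *\<^sub>R axis i 1))"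
    by (simp add: second_diff_def insert.IH 3 diff_weight_def sum_negf mult.commute[of _ "2::real"] sum_distrib_left)
  also have "\<dots> = (\<Sum>y<3. \<Sum>s\<in>?S. (\<Prod>l\<in>insert i e. diff_weight ((s(i := y)) l))
      * f (x + (\<Sum>l\<in>insert i e. (h l * real ((s(i := y)) l)) *\<^sub>R axis l 1)))"
  proof (intro sum.cong refl)
    fix y s
    have "(\<Prod>l\<in>insert i e. diff_weight ((s(i := y)) l)) = diff_weight y * (\<Prod>l\<in>e. diff_weight (s l))"
    proof -
      have "(\<Prod>l\<in>e. diff_weight ((s(i := y)) l)) = (\<Prod>l\<in>e. diff_weight (s l))"
        by (rule prod.cong) (use insert in auto)
      then show ?thesis unfolding prod.insert[OF insert(1,2)] by simp
    qed
    moreover have "(\<Sum>l\<in>insert i e. (h l * real ((s(i := y)) l)) *\<^sub>R axis l (1::real)) = (h i * real y) *\<^sub>R axis i 1 + ?v s"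
    proof -
      have "(\<Sum>l\<in>e. (h l * real ((s(i := y)) l)) *\<^sub>R axis l (1::real)) = ?v s"
        by (rule sum.cong) (use insert in auto)
      then show ?thesis unfolding sum.insert[OF insert(1,2)] by simp
    qed
    ultimately show "diff_weight y * ?G s (x + (h i * real y) *\<^sub>R axis i 1)
        = (\<Prod>l\<in>insert i e. diff_weight ((s(i := y)) l))
        * f (x + (\<Sum>l\<in>insert i e. (h l * real ((s(i := y)) l)) *\<^sub>R axis l 1))"
      by (simp only: mult.assoc add.assoc)
  qed
  also have "\<dots> = (\<Sum>s\<in>PiE (insert i e) (\<lambda>_. {..<3}). (\<Prod>i\<in>insert i e. diff_weight (s i))
      * f (x + (\<Sum>i\<in>insert i e. (h i * real (s i)) *\<^sub>R axis i 1)))"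
    by (subst sum_PiE_insert) (use insert in auto)
  finally show ?case .
qed

text \<open>The s-th point sampled by a one-dimensional coefficient. Level -1 samples only the point
  k; it is padded to three nodes so that active and inactive coordinates obey the same product
  formula.\<close>

definition node :: "int \<Rightarrow> nat \<Rightarrow> nat \<Rightarrow> real" where
  "node j k s = 2 powi (- max j 0) * real k + (if j = -1 then 0 else 2 powi (- (j + 1)) * real s)"

text \<open>A factor -1/2 in each active coordinate absorbs the prefactor (-2)^(-|e(j)|); on level
  -1 the weight 0 cancels the padded nodes.\<close>

definition weight :: "int \<Rightarrow> nat \<Rightarrow> complex" where
  "weight j s = (if j = -1 then (if s = 0 then 1 else 0) else - diff_weight s / 2)"

text \<open>This exhibits the coefficient functional as a tensor product of one-dimensional
  three-point functionals.\<close>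

lemma faber_coeff_expand:
  fixes f :: "real^'d \<Rightarrow> complex"
  shows "faber_coeff f j k = (\<Sum>s | \<forall>i. s i \<in> {..<3}. (\<Prod>i\<in>UNIV. weight (j i) (s i)) * f (\<chi> i. node (j i) (k i) (s i)))"
proof -
  let ?e = "active j"
  let ?F = "\<lambda>s. (\<Prod>i\<in>UNIV. weight (j i) (s i)) * f (\<chi> i. node (j i) (k i) (s i))"
  have "(\<Sum>s | \<forall>i. s i \<in> {..<3}. ?F s) = (\<Sum>s | \<forall>i. s i \<in> (if i \<in> ?e then {..<3} else {0}). ?F s)"
  proof (rule sum.mono_neutral_right)
    show "finite {s :: 'd \<Rightarrow> nat. \<forall>i. s i \<in> {..<3}}" by (rule finite_fun_set) auto
    show "\<forall>s\<in>{s. \<forall>i. s i \<in> {..<3}} - {s. \<forall>i. s i \<in> (if i \<in> ?e then {..<3} else {0})}. ?F s = 0"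
    proof
      fix s :: "'d \<Rightarrow> nat" assume "s \<in> {s. \<forall>i. s i \<in> {..<3}} - {s. \<forall>i. s i \<in> (if i \<in> ?e then {..<3} else {0})}"
      then obtain i where "i \<notin> ?e" "s i \<noteq> 0" by (auto split: if_splits)
      then have "weight (j i) (s i) = 0" by (auto simp: active_def weight_def)
      then have "(\<Prod>i\<in>UNIV. weight (j i) (s i)) = 0" by (intro prod_zero) auto
      then show "?F s = 0" by simp
    qed
    show "{s. \<forall>i. s i \<in> (if i \<in> ?e then {..<3} else {0})} \<subseteq> {s. \<forall>i. s i \<in> {..<3::nat}}"
      by clarify (metis lessThan_iff singletonD zero_less_numeral)
  qed
  \<comment> \<open>The surviving s are node choices on the active coordinates, extended by 0 to the
    others.\<close>
  also have "\<dots> = (\<Sum>s\<in>PiE ?e (\<lambda>_. {..<3}). ?F (\<lambda>i. if i \<in> ?e then s i else 0))"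
  proof (rule sum.reindex_bij_witness[of _ "\<lambda>s i. if i \<in> ?e then s i else 0" "\<lambda>s. restrict s ?e"])
    fix s :: "'d \<Rightarrow> nat" assume "s \<in> {s. \<forall>i. s i \<in> (if i \<in> ?e then {..<3} else {0})}"
    then show *: "(\<lambda>i. if i \<in> ?e then restrict s ?e i else 0) = s"
      by (auto simp: fun_eq_iff split: if_splits)
    show "?F (\<lambda>i. if i \<in> ?e then restrict s ?e i else 0) = ?F s"
      by (rule arg_cong[OF *, where f="?F"])
  qed (auto simp: fun_eq_iff PiE_def extensional_def Pi_def split: if_splits)
  also have "\<dots> = (\<Sum>s\<in>PiE ?e (\<lambda>_. {..<3}). (-2) powi (- int (card ?e)) * ((\<Prod>i\<in>?e. diff_weight (s i)) *
     f (dyadic_point j k + (\<Sum>i\<in>?e. (2 powi (- (j i + 1)) * real (s i)) *\<^sub>R axis i 1))))"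
  proof (intro sum.cong refl)
    fix s assume s: "s \<in> PiE ?e (\<lambda>_. {..<3::nat})"
    have "(\<Prod>i\<in>UNIV. weight (j i) (if i \<in> ?e then s i else 0)) = (\<Prod>i\<in>?e. - diff_weight (s i) / 2)"
      by (intro prod.mono_neutral_cong_right) (auto simp: active_def weight_def)
    also have "\<dots> = (\<Prod>i\<in>?e. (- 1 / 2) * diff_weight (s i))" by simp
    also have "\<dots> = (- 1 / 2) ^ card ?e * (\<Prod>i\<in>?e. diff_weight (s i))"
      by (simp only: prod.distrib prod_constant)
    also have "(- 1 / 2 :: complex) ^ card ?e = (-2) powi (- int (card ?e))"
      by (simp add: power_int_minus flip: power_inverse)
    finally have 1: "(\<Prod>i\<in>UNIV. weight (j i) (if i \<in> ?e then s i else 0))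
        = (-2) powi (- int (card ?e)) * (\<Prod>i\<in>?e. diff_weight (s i))" .
    have 2: "(\<chi> i. node (j i) (k i) (if i \<in> ?e then s i else 0))
      = dyadic_point j k + (\<Sum>i\<in>?e. (2 powi (- (j i + 1)) * real (s i)) *\<^sub>R axis i 1)"
      by (auto simp: vec_eq_iff node_def dyadic_point_def axis_def active_def sum.delta' if_distrib cong: if_cong)
    show "?F (\<lambda>i. if i \<in> ?e then s i else 0) = (-2) powi (- int (card ?e)) * ((\<Prod>i\<in>?e. diff_weight (s i)) *
     f (dyadic_point j k + (\<Sum>i\<in>?e. (2 powi (- (j i + 1)) * real (s i)) *\<^sub>R axis i 1)))"
      unfolding 1 2 by (rule mult.assoc)
  qed
  also have "\<dots> = faber_coeff f j k"
    by (simp add: faber_coeff_def mixed_diff_expand[OF finite] sum_distrib_left)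
  finally show ?thesis by (rule sym)
qed

lemma finite_dyadic_shifts [simp]: "finite (dyadic_shifts j)"
  by (simp add: dyadic_shifts_def)

lemma node_nonneg_level: "node (int n) k s = real (2 * k + s) / 2 ^ (n + 1)"
proof -
  have "(2::real) powi (- (int n + 1)) = 2 powi (- int (Suc n))" by (simp add: algebra_simps)
  also have "\<dots> = 1 / 2 ^ (n + 1)" by (simp only: power_int_minus power_int_of_nat) (simp add: field_simps)
  finally show ?thesis
    unfolding node_def by (simp only: power_int_minus power_int_of_nat) (simp add: power_int_minus field_simps)
qed

lemma sum_pairs: "(\<Sum>k<M. a (2 * k) + a (2 * k + 1)) = (\<Sum>m<2 * M. a m)"
  for a :: "nat \<Rightarrow> 'a::comm_monoid_add" and M :: nat
  by (induction M) (auto simp: add.assoc)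

lemma sum_lessThan_3: "(\<Sum>s<3. f s) = f 0 + f 1 + f (2::nat)" for f :: "nat \<Rightarrow> 'a::comm_monoid_add"
  by (simp add: numeral_3_eq_3 numeral_2_eq_2)

lemma level_cases:
  fixes j :: int
  assumes "j \<ge> -1"
  obtains "j = -1" | n where "j = int n"
  using assms by (metis int_eq_iff add.commute add.right_inverse linorder_not_less order_less_le zle_add1_eq_le)

context resolution
begin

text \<open>The one-dimensional coefficient functional applied to K centred at y. Integrated against
  u it gives the coefficient of the convolution of \<open>K N\<close> with u.\<close>

definition diff_kernel :: "nat \<Rightarrow> int \<Rightarrow> nat \<Rightarrow> real \<Rightarrow> complex" where
  "diff_kernel N j k y = (\<Sum>s<3. weight j s * K N (node j k s - y))"

lemma diff_kernel_integrable: "integrable lborel (diff_kernel N j k)"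
  unfolding diff_kernel_def[abs_def]
  by (intro Bochner_Integration.integrable_sum integrable_mult_right K_shift_integrable)

text \<open>The absolute weights add up to 1/2 + 1 + 1/2 = 2 on an active level and to 1 on level
  -1.\<close>

lemma diff_kernel_L1: "(LBINT y. norm (diff_kernel N j k y)) \<le> 2 * K_const"
proof -
  have "(LBINT y. norm (diff_kernel N j k y))
      \<le> (LBINT y. (\<Sum>s<3. norm (weight j s) * norm (K N (node j k s - y))))"
  proof (rule integral_mono)
    show "norm (diff_kernel N j k y) \<le> (\<Sum>s<3. norm (weight j s) * norm (K N (node j k s - y)))" for y
      unfolding diff_kernel_def by (rule order_trans[OF norm_sum]) (simp add: norm_mult)
  qed (auto intro!: diff_kernel_integrable Bochner_Integration.integrable_sum integrable_mult_right
      integrable_norm K_shift_integrable)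
  also have "\<dots> = (\<Sum>s<3. norm (weight j s) * (LBINT y. norm (K N (node j k s - y))))"
    by (subst Bochner_Integration.integral_sum)
      (auto intro!: integrable_mult_right integrable_norm K_shift_integrable)
  also have "\<dots> \<le> (\<Sum>s<3. norm (weight j s) * K_const)"
    by (intro sum_mono mult_left_mono K_shift_L1) auto
  also have "\<dots> \<le> 2 * K_const"
    using K_const_pos by (auto simp: sum_lessThan_3 weight_def diff_weight_def)
  finally show ?thesis .
qed

text \<open>A second difference is a difference of two neighbouring first differences, and over all
  k these run once through the grid of mesh 2^(-(n+1)). So the sum is controlled by the total
  variation of K, whatever the level j. On level -1 the sup bound at two points is enough.\<close>

lemma diff_kernel_sum:
  assumes "j \<ge> -1"
  shows "(\<Sum>k\<in>dyadic_shifts j. norm (diff_kernel N j k y)) \<le> 2 * K_const * 2 ^ N"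
  using assms
proof (cases rule: level_cases)
  case 1
  have "norm (diff_kernel N j k y) \<le> K_const * 2 ^ N" for k
    unfolding diff_kernel_def 1 sum_lessThan_3 by (simp add: weight_def K_sup)
  from this[of 0] this[of 1] show ?thesis by (simp add: dyadic_shifts_def 1)
next
  case (2 n)
  define h :: real where "h = 1 / 2 ^ (n + 1)"
  define a where "a m = norm (K N (h * real (Suc m) - y) - K N (h * real m - y))" for m
  have nd: "node (int n) k s = h * real (2 * k + s)" for k s
    by (simp add: node_nonneg_level h_def)
  have "norm (diff_kernel N j k y) \<le> a (2 * k) + a (2 * k + 1)" for k
  proof -
    have "diff_kernel N j k y = ((K N (h * real (Suc (2 * k)) - y) - K N (h * real (2 * k) - y))
       - (K N (h * real (Suc (2 * k + 1)) - y) - K N (h * real (2 * k + 1) - y))) / 2"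
      unfolding diff_kernel_def 2 sum_lessThan_3 nd
      by (simp add: weight_def diff_weight_def field_simps)
    also have "norm \<dots> \<le> (a (2 * k) + a (2 * k + 1)) / 2"
      unfolding a_def norm_divide
      by (simp only: norm_numeral) (intro divide_right_mono norm_triangle_ineq4, simp)
    also have "\<dots> \<le> a (2 * k) + a (2 * k + 1)" by (simp add: a_def)
    finally show ?thesis .
  qed
  then have "(\<Sum>k\<in>dyadic_shifts j. norm (diff_kernel N j k y)) \<le> (\<Sum>k<2 ^ n. a (2 * k) + a (2 * k + 1))"
    by (auto simp: dyadic_shifts_def 2 lessThan_atLeast0 intro!: sum_mono)
  also have "\<dots> \<le> K_const * 2 ^ N"
    unfolding sum_pairs unfolding a_def by (rule K_total_variation) (simp add: h_def)
  also have "\<dots> \<le> 2 * K_const * 2 ^ N" using K_const_pos by simp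
  finally show ?thesis .
qed

end

section \<open>Interpolation by the Faber series\<close>

lemma hat_bounds: "0 \<le> hat x" "hat x \<le> 1"
  by (auto simp: hat_def)

lemma hat_eq_0: "x \<le> 0 \<or> x \<ge> 1 \<Longrightarrow> hat x = 0"
  by (auto simp: hat_def)

lemma faber1_nonneg: "0 \<le> t \<Longrightarrow> t \<le> 1 \<Longrightarrow> 0 \<le> faber1 j k t"
  by (auto simp: faber1_def hat_bounds)

lemma sum_hat_cell:
  fixes F :: "nat \<Rightarrow> complex"
  assumes "real m \<le> 2 ^ n * t" "2 ^ n * t \<le> real m + 1" "m < 2 ^ n"
  shows "(\<Sum>k\<in>dyadic_shifts (int n). of_real (faber1 (int n) k t) * F k) = of_real (hat (2 ^ n * t - m)) * F m"
proof -
  have "(\<Sum>k\<in>dyadic_shifts (int n). of_real (faber1 (int n) k t) * F k)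
      = (\<Sum>k\<in>{m}. of_real (faber1 (int n) k t) * F k)"
  proof (rule sum.mono_neutral_right)
    show "\<forall>k\<in>dyadic_shifts (int n) - {m}. of_real (faber1 (int n) k t) * F k = 0"
    proof
      fix k assume "k \<in> dyadic_shifts (int n) - {m}"
      then have "k < m \<or> m < k" by auto
      then have "2 ^ n * t - real k \<le> 0 \<or> 2 ^ n * t - real k \<ge> 1" using assms by auto
      then have "hat (2 ^ n * t - real k) = 0" by (rule hat_eq_0)
      then show "of_real (faber1 (int n) k t) * F k = 0" by (simp add: faber1_def)
    qed
  qed (use assms in \<open>auto simp: dyadic_shifts_def\<close>)
  then show ?thesis by (simp add: faber1_def)
qed

text \<open>Cells are closed so that t = 1 falls into the last one; at common endpoints the hats of
  both cells vanish, so the choice of cell does not matter.\<close>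

lemma dyadic_cell:
  fixes t :: real
  assumes "0 \<le> t" "t \<le> 1"
  obtains m where "m < 2 ^ n" "real m \<le> 2 ^ n * t" "2 ^ n * t \<le> real m + 1"
proof (cases "t = 1")
  case True
  show ?thesis by (rule that[of "2 ^ n - 1"]) (auto simp: True of_nat_diff)
next
  case False
  let ?m = "nat \<lfloor>2 ^ n * t\<rfloor>"
  have nn: "0 \<le> 2 ^ n * t" using assms by simp
  have lt: "2 ^ n * t < 2 ^ n * 1" using False assms by (intro mult_strict_left_mono) auto
  have eq: "real ?m = of_int \<lfloor>2 ^ n * t\<rfloor>" using nn by simp
  have "real ?m < 2 ^ n" unfolding eq using lt of_int_floor_le[of "2 ^ n * t"] by linarith
  then have "?m < 2 ^ n" by (metis of_nat_less_iff of_nat_numeral of_nat_power)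
  then show ?thesis by (rule that) (use eq in linarith)+
qed

lemma faber1_sum_le:
  assumes "j \<ge> -1" "0 \<le> t" "t \<le> 1"
  shows "(\<Sum>k\<in>dyadic_shifts j. faber1 j k t) \<le> 1"
  using assms(1)
proof (cases rule: level_cases)
  case 1
  then show ?thesis by (simp add: dyadic_shifts_def faber1_def)
next
  case (2 n)
  obtain m where m: "m < 2 ^ n" "real m \<le> 2 ^ n * t" "2 ^ n * t \<le> real m + 1"
    using dyadic_cell[OF assms(2,3)] by blast
  have "complex_of_real (\<Sum>k\<in>dyadic_shifts j. faber1 j k t) = of_real (hat (2 ^ n * t - m))"
    using sum_hat_cell[OF m(2,3,1), of "\<lambda>_. 1"] 2 by simp
  then have "(\<Sum>k\<in>dyadic_shifts j. faber1 j k t) = hat (2 ^ n * t - m)"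
    by (simp only: of_real_eq_iff)
  then show ?thesis using hat_bounds by simp
qed

lemma levels_Suc: "{-1..<int (Suc n)} = insert (int n) {-1..<int n}"
  by auto

text \<open>The levels below n reproduce linear interpolation at mesh 2^(-n). By induction: level n
  adds, on a cell of length 2^(-n), the hat times the midpoint defect, which is the change from one
  linear piece to two.\<close>

lemma faber_interpolation:
  fixes u :: "real \<Rightarrow> complex"
  assumes "m < 2 ^ n" "real m \<le> 2 ^ n * t" "2 ^ n * t \<le> real m + 1"
  shows "(\<Sum>j\<in>{-1..<int n}. \<Sum>k\<in>dyadic_shifts j. of_real (faber1 j k t) * (\<Sum>s<3. weight j s * u (node j k s)))
    = of_real (1 - (2 ^ n * t - real m)) * u (real m / 2 ^ n) + of_real (2 ^ n * t - real m) * u (real (Suc m) / 2 ^ n)"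
  using assms
proof (induction n arbitrary: m)
  case 0
  have "{-1..<0::int} = {-1}" by auto
  then show ?case using 0
    by (simp add: dyadic_shifts_def faber1_def sum_lessThan_3 weight_def node_def)
next
  case (Suc n)
  \<comment> \<open>The parent cell of the m-th cell; \<theta> is the relative position of t inside
    it.\<close>
  define l where "l = m div 2"
  define \<theta> where "\<theta> = 2 ^ n * t - real l"
  have ml: "m = 2 * l \<or> m = Suc (2 * l)" unfolding l_def by presburger
  have l: "l < 2 ^ n" "real l \<le> 2 ^ n * t" "2 ^ n * t \<le> real l + 1"
    using ml Suc.prems by auto
  let ?a = "real l / 2 ^ n" and ?b = "real (Suc l) / 2 ^ n" and ?c = "real (Suc (2 * l)) / 2 ^ (Suc n)"
  have nodes: "node (int n) l 0 = ?a" "node (int n) l 1 = ?c" "node (int n) l 2 = ?b"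
    by (simp_all add: node_nonneg_level field_simps)
  have step: "(\<Sum>k\<in>dyadic_shifts (int n). of_real (faber1 (int n) k t) * (\<Sum>s<3. weight (int n) s * u (node (int n) k s)))
      = of_real (hat \<theta>) * (u ?c - u ?a / 2 - u ?b / 2)"
    unfolding sum_hat_cell[OF l(2,3,1)] \<theta>_def[symmetric] sum_lessThan_3 nodes
    by (simp add: weight_def diff_weight_def)
  have "(\<Sum>j\<in>{-1..<int (Suc n)}. \<Sum>k\<in>dyadic_shifts j. of_real (faber1 j k t) * (\<Sum>s<3. weight j s * u (node j k s)))
      = of_real (hat \<theta>) * (u ?c - u ?a / 2 - u ?b / 2) + (of_real (1 - \<theta>) * u ?a + of_real \<theta> * u ?b)"
    unfolding levels_Suc by (subst sum.insert) (use step Suc.IH[OF l] in \<open>auto simp: \<theta>_def\<close>)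
  also have "\<dots> = of_real (1 - (2 ^ Suc n * t - real m)) * u (real m / 2 ^ Suc n)
      + of_real (2 ^ Suc n * t - real m) * u (real (Suc m) / 2 ^ Suc n)"
    using ml
  proof
    assume m: "m = 2 * l"
    then have t: "2 ^ Suc n * t - real m = 2 * \<theta>" by (simp add: \<theta>_def)
    have "\<theta> \<le> 1 / 2" "0 \<le> \<theta>" using Suc.prems t by auto
    then have h: "hat \<theta> = 2 * \<theta>" by (simp add: hat_def)
    have "real m / 2 ^ Suc n = ?a" "real (Suc m) / 2 ^ Suc n = ?c" by (simp_all add: m)
    moreover have "of_real (2 * \<theta>) * (C - A / 2 - B / 2) + (of_real (1 - \<theta>) * A + of_real \<theta> * B)
        = of_real (1 - 2 * \<theta>) * A + of_real (2 * \<theta>) * C" for A B C :: complex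
      by (simp add: field_simps)
    ultimately show ?thesis unfolding t h by (simp only:)
  next
    assume m: "m = Suc (2 * l)"
    then have t: "2 ^ Suc n * t - real m = 2 * \<theta> - 1" by (simp add: \<theta>_def)
    have "\<theta> \<ge> 1 / 2" "\<theta> \<le> 1" using Suc.prems t by auto
    then have h: "hat \<theta> = 2 * (1 - \<theta>)" by (auto simp: hat_def)
    have "real m / 2 ^ Suc n = ?c" "real (Suc m) / 2 ^ Suc n = ?b" by (simp_all add: m divide_simps)
    moreover have "of_real (2 * (1 - \<theta>)) * (C - A / 2 - B / 2) + (of_real (1 - \<theta>) * A + of_real \<theta> * B)
        = of_real (1 - (2 * \<theta> - 1)) * C + of_real (2 * \<theta> - 1) * B" for A B C :: complex
      by (simp add: field_simps)
    ultimately show ?thesis unfolding t h by (simp only:)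
  qed
  finally show ?case .
qed

section \<open>Multilinear interpolation in d dimensions\<close>

lemma prod_indicator_eq:
  fixes z q :: "'d::finite \<Rightarrow> real"
  shows "(\<Prod>i\<in>UNIV. if z i = q i then 1 else 0 :: complex) = (if z = q then 1 else 0)"
  by (auto simp: fun_eq_iff)

text \<open>Writing a function on a finite grid as a combination of tensor products of point masses
  reduces multilinear identities to the one-dimensional case.\<close>

lemma point_mass_expansion:
  fixes F :: "('d::finite \<Rightarrow> real) \<Rightarrow> complex"
  assumes "finite Q" "\<And>i. z i \<in> Q"
  shows "F z = (\<Sum>q | \<forall>i. q i \<in> Q. F q * (\<Prod>i\<in>UNIV. if z i = q i then 1 else 0))"
proof -
  have "(\<Sum>q | \<forall>i. q i \<in> Q. F q * (\<Prod>i\<in>UNIV. if z i = q i then 1 else 0))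
      = (\<Sum>q | \<forall>i. q i \<in> Q. if z = q then F q else 0)"
    unfolding prod_indicator_eq by (intro sum.cong) auto
  also have "\<dots> = F z"
    using assms finite_fun_set[of "\<lambda>_. Q"] by (subst sum.delta') auto
  finally show ?thesis by (rule sym)
qed

abbreviation shift_set :: "('d \<Rightarrow> int) \<Rightarrow> ('d \<Rightarrow> nat) set" where
  "shift_set j \<equiv> {k. \<forall>i. k i \<in> dyadic_shifts (j i)}"

text \<open>A full cube of levels, in contrast to the truncation by |j|_1: over a cube the partial
  sum is a tensor product of one-dimensional interpolations.\<close>

definition levels_below :: "nat \<Rightarrow> ('d \<Rightarrow> int) set" where
  "levels_below n = {j. \<forall>i. j i \<in> {-1..<int n}}"

definition faber_level :: "(real^'d \<Rightarrow> complex) \<Rightarrow> real^'d \<Rightarrow> ('d \<Rightarrow> int) \<Rightarrow> complex" where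
  "faber_level f x j = (\<Sum>k\<in>shift_set j. faber_coeff f j k * of_real (faber j k x))"

text \<open>Both sides are linear in finitely many values of f, so it is enough to treat point
  masses on a product grid. For these all sums factorise and \<open>faber_interpolation\<close>
  applies in each coordinate.\<close>

lemma tensor_interpolation:
  fixes f :: "real^'d \<Rightarrow> complex" and m :: "'d \<Rightarrow> nat"
  assumes m: "\<And>i. m i < 2 ^ n" "\<And>i. real (m i) \<le> 2 ^ n * x $ i" "\<And>i. 2 ^ n * x $ i \<le> real (m i) + 1"
  shows "(\<Sum>j\<in>levels_below n. faber_level f x j)
    = (\<Sum>b | \<forall>i. b i \<in> {..<2}. (\<Prod>i\<in>UNIV. of_real (if b i = 0 then 1 - (2 ^ n * x $ i - real (m i)) else 2 ^ n * x $ i - real (m i)))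
          * f (\<chi> i. real (m i + b i) / 2 ^ n))"
proof -
  \<comment> \<open>All one-dimensional nodes occurring on the left side, together with the
    coordinates of the cell corners on the right.\<close>
  define Q where "Q = (\<lambda>(j, k, s). node j k s) ` (SIGMA j:{-1..<int n}. SIGMA k:dyadic_shifts j. {..<3})
     \<union> (\<lambda>(i, b). real (m i + b) / 2 ^ n) ` (UNIV \<times> {..<2})"
  have finQ: "finite Q" unfolding Q_def by auto
  have Q1: "node j k s \<in> Q" if "j \<in> {-1..<int n}" "k \<in> dyadic_shifts j" "s \<in> {..<3}" for j k s
    unfolding Q_def using that by force
  have Q2: "real (m i + b) / 2 ^ n \<in> Q" if "b \<in> {..<2}" for i b
    unfolding Q_def using that by force
  define F where "F z = f (\<chi> i. z i)" for z
  let ?w = "\<lambda>q i j k. \<Sum>s<3. weight j s * (if node j k s = q i then 1 else 0)"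
  let ?Qs = "{q::'d \<Rightarrow> real. \<forall>i. q i \<in> Q}"
  let ?cell = "\<lambda>i b. of_real (if b = (0::nat) then 1 - (2 ^ n * x $ i - real (m i)) else 2 ^ n * x $ i - real (m i)) :: complex"
  have coeff: "faber_coeff f j k * of_real (faber j k x)
      = (\<Sum>q\<in>?Qs. F q * (\<Prod>i\<in>UNIV. of_real (faber1 (j i) (k i) (x $ i)) *
          ?w q i (j i) (k i)))"
    if "j \<in> levels_below n" "\<forall>i. k i \<in> dyadic_shifts (j i)" for j k
  proof -
    have "faber_coeff f j k * of_real (faber j k x)
        = (\<Sum>s | \<forall>i. s i \<in> {..<3}. (\<Prod>i\<in>UNIV. weight (j i) (s i)) * F (\<lambda>i. node (j i) (k i) (s i)))
            * (\<Prod>i\<in>UNIV. of_real (faber1 (j i) (k i) (x $ i)))"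
      unfolding faber_coeff_expand F_def faber_def by simp
    also have "\<dots> = (\<Sum>s | \<forall>i. s i \<in> {..<3}. \<Sum>q\<in>?Qs. F q * (\<Prod>i\<in>UNIV. of_real (faber1 (j i) (k i) (x $ i)) *
          (weight (j i) (s i) * (if node (j i) (k i) (s i) = q i then 1 else 0))))"
      unfolding sum_distrib_right
    proof (intro sum.cong refl)
      fix s assume "s \<in> {s :: 'd \<Rightarrow> nat. \<forall>i. s i \<in> {..<3}}"
      then have "\<And>i. node (j i) (k i) (s i) \<in> Q"
        using that by (intro Q1) (auto simp: levels_below_def)
      then have *: "F (\<lambda>i. node (j i) (k i) (s i)) = (\<Sum>q\<in>?Qs. F q * (\<Prod>i\<in>UNIV. if node (j i) (k i) (s i) = q i then 1 else 0))"
        using finQ by (intro point_mass_expansion) auto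
      show "(\<Prod>i\<in>UNIV. weight (j i) (s i)) * F (\<lambda>i. node (j i) (k i) (s i)) * (\<Prod>i\<in>UNIV. of_real (faber1 (j i) (k i) (x $ i)))
          = (\<Sum>q\<in>?Qs. F q * (\<Prod>i\<in>UNIV. of_real (faber1 (j i) (k i) (x $ i)) *
          (weight (j i) (s i) * (if node (j i) (k i) (s i) = q i then 1 else 0))))"
        unfolding * by (simp only: sum_distrib_left sum_distrib_right prod.distrib mult_ac)
    qed
    also have "\<dots> = (\<Sum>q\<in>?Qs. F q * (\<Sum>s | \<forall>i. s i \<in> {..<3}. \<Prod>i\<in>UNIV. of_real (faber1 (j i) (k i) (x $ i)) *
          (weight (j i) (s i) * (if node (j i) (k i) (s i) = q i then 1 else 0))))"
      by (subst sum.swap) (simp add: sum_distrib_left)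
    also have "\<dots> = (\<Sum>q\<in>?Qs. F q * (\<Prod>i\<in>UNIV. of_real (faber1 (j i) (k i) (x $ i)) *
          ?w q i (j i) (k i)))"
    proof (intro sum.cong refl arg_cong2[where f="(*)"])
      fix q :: "'d \<Rightarrow> real"
      show "(\<Sum>s | \<forall>i. s i \<in> {..<3}. \<Prod>i\<in>UNIV. of_real (faber1 (j i) (k i) (x $ i)) *
            (weight (j i) (s i) * (if node (j i) (k i) (s i) = q i then 1 else 0)))
          = (\<Prod>i\<in>UNIV. of_real (faber1 (j i) (k i) (x $ i)) *
            ?w q i (j i) (k i))"
        unfolding sum_distrib_left
        by (rule sum_prod_fun_set[where f="\<lambda>i s. of_real (faber1 (j i) (k i) (x $ i)) *
            (weight (j i) s * (if node (j i) (k i) s = q i then 1 else 0))"]) auto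
    qed
    finally show ?thesis .
  qed
  have "(\<Sum>j\<in>levels_below n. faber_level f x j)
      = (\<Sum>j\<in>levels_below n. \<Sum>k\<in>shift_set j. \<Sum>q\<in>?Qs. F q * (\<Prod>i\<in>UNIV. of_real (faber1 (j i) (k i) (x $ i)) *
          ?w q i (j i) (k i)))"
    unfolding faber_level_def by (intro sum.cong refl coeff) auto
  also have "\<dots> = (\<Sum>q\<in>?Qs. F q * (\<Sum>j\<in>levels_below n. \<Sum>k\<in>shift_set j. \<Prod>i\<in>UNIV. of_real (faber1 (j i) (k i) (x $ i)) *
          ?w q i (j i) (k i)))"
    unfolding sum_distrib_left by (subst sum.swap[of _ ?Qs], subst sum.swap[of _ ?Qs]) (rule refl)
  also have "\<dots> = (\<Sum>q\<in>?Qs. F q * (\<Prod>i\<in>UNIV. \<Sum>j\<in>{-1..<int n}. \<Sum>k\<in>dyadic_shifts j. of_real (faber1 j k (x $ i)) *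
          ?w q i j k))"
  proof (intro sum.cong refl arg_cong2[where f="(*)"])
    fix q :: "'d \<Rightarrow> real"
    define T where "T i j k = of_real (faber1 j k (x $ i)) *
          ?w q i j k" for i j k
    have "(\<Sum>j\<in>levels_below n. \<Sum>k\<in>shift_set j. \<Prod>i\<in>UNIV. T i (j i) (k i))
        = (\<Sum>j\<in>levels_below n. \<Prod>i\<in>UNIV. \<Sum>k\<in>dyadic_shifts (j i). T i (j i) k)"
      by (rule sum.cong[OF refl], rule sum_prod_fun_set[where f="\<lambda>i. T i (_ i)"]) simp
    also have "\<dots> = (\<Prod>i\<in>UNIV. \<Sum>j\<in>{-1..<int n}. \<Sum>k\<in>dyadic_shifts j. T i j k)"
      unfolding levels_below_def by (rule sum_prod_fun_set[where f="\<lambda>i j. \<Sum>k\<in>dyadic_shifts j. T i j k"]) simp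
    finally show "(\<Sum>j\<in>levels_below n. \<Sum>k\<in>shift_set j. \<Prod>i\<in>UNIV. of_real (faber1 (j i) (k i) (x $ i)) *
          ?w q i (j i) (k i))
        = (\<Prod>i\<in>UNIV. \<Sum>j\<in>{-1..<int n}. \<Sum>k\<in>dyadic_shifts j. of_real (faber1 j k (x $ i)) *
          ?w q i j k)"
      unfolding T_def .
  qed
  also have "\<dots> = (\<Sum>q\<in>?Qs. F q * (\<Prod>i\<in>UNIV. \<Sum>b<2. ?cell i b * (if real (m i + b) / 2 ^ n = q i then 1 else 0)))"
  proof (intro sum.cong refl arg_cong2[where f="(*)"] prod.cong)
    fix q :: "'d \<Rightarrow> real" and i
    have 2: "{..<2::nat} = {0, 1}" by auto
    show "(\<Sum>j\<in>{-1..<int n}. \<Sum>k\<in>dyadic_shifts j. of_real (faber1 j k (x $ i)) *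
          ?w q i j k)
       = (\<Sum>b<2. ?cell i b * (if real (m i + b) / 2 ^ n = q i then 1 else 0))"
      unfolding faber_interpolation[OF m, where u="\<lambda>t. if t = q i then 1 else 0"] 2 by (simp add: add.commute)
  qed
  also have "\<dots> = (\<Sum>q\<in>?Qs. F q * (\<Sum>b | \<forall>i. b i \<in> {..<2}. \<Prod>i\<in>UNIV. ?cell i (b i) * (if real (m i + b i) / 2 ^ n = q i then 1 else 0)))"
    by (intro sum.cong refl arg_cong2[where f="(*)"]
        sum_prod_fun_set[where f="\<lambda>i b. ?cell i b * (if real (m i + b) / 2 ^ n = _ i then 1 else 0)", symmetric]) auto
  also have "\<dots> = (\<Sum>b | \<forall>i. b i \<in> {..<2}. (\<Prod>i\<in>UNIV. ?cell i (b i)) *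
      (\<Sum>q\<in>?Qs. F q * (\<Prod>i\<in>UNIV. if real (m i + b i) / 2 ^ n = q i then 1 else 0)))"
    unfolding sum_distrib_left by (subst sum.swap) (simp only: prod.distrib mult_ac)
  also have "\<dots> = (\<Sum>b | \<forall>i. b i \<in> {..<2}. (\<Prod>i\<in>UNIV. ?cell i (b i)) * F (\<lambda>i. real (m i + b i) / 2 ^ n))"
    by (intro sum.cong refl arg_cong2[where f="(*)"] point_mass_expansion[symmetric] finQ Q2) auto
  finally show ?thesis unfolding F_def .
qed

text \<open>The multilinear interpolant is a convex combination of the values at the corners of a
  cell containing x, and these corners tend to x.\<close>

lemma faber_series_tendsto:
  fixes f :: "real^'d \<Rightarrow> complex"
  assumes cont: "continuous_on unit_cube f" and x: "x \<in> unit_cube"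
  shows "(\<lambda>n. \<Sum>j\<in>levels_below n. faber_level f x j) \<longlonglongrightarrow> f x"
proof (rule LIMSEQ_I)
  fix e :: real assume e: "e > 0"
  obtain \<delta> where \<delta>: "\<delta> > 0" "\<And>z. z \<in> unit_cube \<Longrightarrow> dist z x < \<delta> \<Longrightarrow> dist (f z) (f x) < e / 2"
    using cont x e unfolding continuous_on_iff by (metis half_gt_zero)
  have "(\<lambda>n. real CARD('d) * (1 / 2) ^ n) \<longlonglongrightarrow> real CARD('d) * 0"
    by (intro tendsto_intros LIMSEQ_power_zero) auto
  then have "\<forall>\<^sub>F n in sequentially. real CARD('d) * (1 / 2) ^ n < \<delta>"
    using \<delta> by (intro order_tendstoD) auto
  then obtain N where N: "\<And>n. n \<ge> N \<Longrightarrow> real CARD('d) * (1 / 2) ^ n < \<delta>"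
    by (auto simp: eventually_sequentially)
  show "\<exists>N. \<forall>n\<ge>N. norm ((\<Sum>j\<in>levels_below n. faber_level f x j) - f x) < e"
  proof (intro exI[of _ N] allI impI)
    fix n assume n: "n \<ge> N"
    have "\<exists>m. m < 2 ^ n \<and> real m \<le> 2 ^ n * x $ i \<and> 2 ^ n * x $ i \<le> real m + 1" for i
      using dyadic_cell[of "x $ i" n] x by (auto simp: unit_cube_def)
    then obtain m where m: "\<And>i. m i < 2 ^ n" "\<And>i. real (m i) \<le> 2 ^ n * x $ i" "\<And>i. 2 ^ n * x $ i \<le> real (m i) + 1"
      by metis
    define c where "c i b = (if b = (0::nat) then 1 - (2 ^ n * x $ i - real (m i)) else 2 ^ n * x $ i - real (m i))" for i b
    let ?z = "\<lambda>b. \<chi> i. real (m i + b i) / 2 ^ n"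
    let ?B = "{b :: 'd \<Rightarrow> nat. \<forall>i. b i \<in> {..<2}}"
    have c0: "c i b \<ge> 0" for i b using m[of i] by (simp add: c_def)
    have "(\<Sum>b\<in>?B. \<Prod>i\<in>UNIV. c i (b i)) = (\<Prod>i\<in>UNIV. \<Sum>b<2. c i b)"
      by (rule sum_prod_fun_set) auto
    also have "\<dots> = 1" by (simp add: numeral_2_eq_2 c_def)
    finally have c1: "(\<Sum>b\<in>?B. \<Prod>i\<in>UNIV. c i (b i)) = 1" .
    have near: "norm (f (?z b) - f x) \<le> e / 2" if "b \<in> ?B" for b
    proof -
      have b: "b i = 0 \<or> b i = 1" for i using that by (auto simp: less_2_cases_iff)
      have "?z b \<in> unit_cube"
      proof -
        have "m i + b i \<le> 2 ^ n" for i using b[of i] m(1)[of i] by auto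
        then have "real (m i + b i) \<le> 2 ^ n" for i by (metis of_nat_le_iff of_nat_numeral of_nat_power)
        then show ?thesis by (auto simp: unit_cube_def)
      qed
      moreover have "dist (?z b) x < \<delta>"
      proof -
        have "\<bar>real (m i + b i) / 2 ^ n - x $ i\<bar> \<le> (1 / 2) ^ n" for i
        proof -
          have "\<bar>real (m i + b i) - 2 ^ n * x $ i\<bar> \<le> 1" using b[of i] m(2,3)[of i] by auto
          then have "\<bar>(real (m i + b i) - 2 ^ n * x $ i) / 2 ^ n\<bar> \<le> 1 / 2 ^ n"
            unfolding abs_divide by (simp add: divide_right_mono)
          then show ?thesis by (simp add: diff_divide_distrib power_one_over)
        qed
        then have "norm (?z b - x) \<le> (\<Sum>i\<in>(UNIV::'d set). (1 / 2) ^ n)"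
          by (intro order_trans[OF norm_le_l1_cart] sum_mono) auto
        then show ?thesis using N[OF n] by (simp add: dist_norm)
      qed
      ultimately show ?thesis using \<delta>(2)[of "?z b"] by (simp add: dist_norm)
    qed
    have "(\<Sum>j\<in>levels_below n. faber_level f x j) - f x
        = (\<Sum>b\<in>?B. of_real (\<Prod>i\<in>UNIV. c i (b i)) * f (?z b)) - of_real (\<Sum>b\<in>?B. \<Prod>i\<in>UNIV. c i (b i)) * f x"
      unfolding c1 by (subst tensor_interpolation[OF m]) (simp add: c_def)
    also have "\<dots> = (\<Sum>b\<in>?B. of_real (\<Prod>i\<in>UNIV. c i (b i)) * (f (?z b) - f x))"
      by (simp only: of_real_sum sum_distrib_right right_diff_distrib sum_subtractf)
    also have "norm \<dots> \<le> (\<Sum>b\<in>?B. (\<Prod>i\<in>UNIV. c i (b i)) * (e / 2))"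
    proof (rule sum_norm_le)
      fix b assume b: "b \<in> ?B"
      have "(\<Prod>i\<in>UNIV. c i (b i)) \<ge> 0" by (intro prod_nonneg) (simp add: c0)
      then show "norm (of_real (\<Prod>i\<in>UNIV. c i (b i)) * (f (?z b) - f x)) \<le> (\<Prod>i\<in>UNIV. c i (b i)) * (e / 2)"
        using near[OF b] by (simp only: norm_mult norm_of_real abs_of_nonneg mult_left_mono)
    qed
    also have "\<dots> = e / 2" unfolding sum_distrib_right[symmetric] c1 by simp
    also have "\<dots> < e" using e by simp
    finally show "norm ((\<Sum>j\<in>levels_below n. faber_level f x j) - f x) < e" .
  qed
qed

section \<open>Weights of the levels\<close>

text \<open>One factor t + 4 is absorbed by (sqrt x)^t, which leaves a lower power with the ratio
  sqrt x. The shift by 4 is the one that arises from counting levels in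
  \<open>level_weight_tail\<close>.\<close>

lemma summable_poly_geometric:
  fixes x :: real
  assumes "0 < x" "x < 1"
  shows "summable (\<lambda>t. real (t + 4) ^ m * x ^ t)"
  using assms
proof (induction m arbitrary: x)
  case 0
  then show ?case by (simp add: summable_geometric)
next
  case (Suc m)
  define y where "y = sqrt x"
  have y: "0 < y" "y < 1" "x = y * y" using Suc.prems by (auto simp: y_def)
  have "(\<lambda>t. real t * y ^ t + 4 * y ^ t) \<longlonglongrightarrow> 0 + 4 * 0"
    using y by (intro tendsto_intros powser_times_n_limit_0 LIMSEQ_power_zero) auto
  then have "Bseq (\<lambda>t. real t * y ^ t + 4 * y ^ t)" by (intro convergent_imp_Bseq convergentI) auto
  then obtain B where B: "\<And>t. norm (real t * y ^ t + 4 * y ^ t) \<le> B" by (auto simp: Bseq_def)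
  have "summable (\<lambda>t. B * (real (t + 4) ^ m * y ^ t))"
    using Suc.IH[OF y(1,2)] by (rule summable_mult)
  then show ?case
  proof (rule summable_comparison_test')
    fix t :: nat
    have "norm (real (t + 4) ^ Suc m * x ^ t) = norm (real t * y ^ t + 4 * y ^ t) * (real (t + 4) ^ m * y ^ t)"
      using y by (simp add: power_mult_distrib algebra_simps)
    also have "\<dots> \<le> B * (real (t + 4) ^ m * y ^ t)"
      using y by (intro mult_right_mono B) auto
    finally show "norm (real (t + 4) ^ Suc m * x ^ t) \<le> B * (real (t + 4) ^ m * y ^ t)" .
  qed
qed

definition sphere_levels :: "nat \<Rightarrow> ('d \<Rightarrow> int) set" where
  "sphere_levels s = {j. (\<forall>i. j i \<ge> -1) \<and> (\<Sum>i\<in>UNIV. \<bar>j i\<bar>) = int s}"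

lemma abs_level_le_sum: "\<bar>j i\<bar> \<le> (\<Sum>i\<in>UNIV. \<bar>j i\<bar>)" for j :: "'d::finite \<Rightarrow> int"
  by (rule member_le_sum) auto

text \<open>Given the other coordinates, |j i0| is fixed by the sum, and the sign is ambiguous only
  between 1 and -1. This leaves d - 1 coordinates with s + 2 values each and a factor 2, the origin
  of the power d - 1 in the theorem.\<close>

lemma
  shows finite_sphere_levels: "finite (sphere_levels s :: ('d::finite \<Rightarrow> int) set)"
    and card_sphere_levels: "card (sphere_levels s :: ('d \<Rightarrow> int) set) \<le> 2 * (s + 2) ^ (CARD('d) - 1)"
proof -
  obtain i0 :: 'd where True by blast
  let ?U = "UNIV - {i0}"
  let ?g = "\<lambda>j :: 'd \<Rightarrow> int. (restrict j ?U, j i0 = -1)"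
  let ?T = "PiE ?U (\<lambda>_. {-1..int s}) \<times> (UNIV :: bool set)"
  have inj: "inj_on ?g (sphere_levels s)"
  proof (rule inj_onI)
    fix j l :: "'d \<Rightarrow> int" assume j: "j \<in> sphere_levels s" and l: "l \<in> sphere_levels s" and eq: "?g j = ?g l"
    have jl: "j i = l i" if "i \<noteq> i0" for i
    proof -
      have "restrict j ?U i = restrict l ?U i" using eq by simp
      then show ?thesis using that by simp
    qed
    have "(\<Sum>i\<in>UNIV. \<bar>j i\<bar>) = \<bar>j i0\<bar> + (\<Sum>i\<in>?U. \<bar>j i\<bar>)" "(\<Sum>i\<in>UNIV. \<bar>l i\<bar>) = \<bar>l i0\<bar> + (\<Sum>i\<in>?U. \<bar>l i\<bar>)"
      by (simp_all add: sum.remove[of UNIV i0])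
    moreover have "(\<Sum>i\<in>?U. \<bar>j i\<bar>) = (\<Sum>i\<in>?U. \<bar>l i\<bar>)" using jl by (intro sum.cong) auto
    ultimately have "\<bar>j i0\<bar> = \<bar>l i0\<bar>" using j l by (simp add: sphere_levels_def)
    moreover have "j i0 \<ge> -1" "l i0 \<ge> -1" "(j i0 = -1) = (l i0 = -1)"
      using j l eq by (auto simp: sphere_levels_def)
    ultimately have "j i0 = l i0" by linarith
    then show "j = l" using jl by (metis ext)
  qed
  have sub: "?g ` sphere_levels s \<subseteq> ?T"
  proof (intro image_subsetI SigmaI restrict_PiE_iff[THEN iffD2] ballI)
    fix j :: "'d \<Rightarrow> int" and i
    assume "j \<in> sphere_levels s"
    then have "j i \<ge> -1" "(\<Sum>i\<in>UNIV. \<bar>j i\<bar>) = int s" by (auto simp: sphere_levels_def)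
    then show "j i \<in> {-1..int s}" using abs_level_le_sum[of j i] by simp
  qed auto
  have fin: "finite ?T" by (intro finite_cartesian_product finite_PiE) auto
  show "finite (sphere_levels s :: ('d \<Rightarrow> int) set)"
    using finite_imageD[OF finite_subset[OF sub fin] inj] .
  have "card (sphere_levels s :: ('d \<Rightarrow> int) set) \<le> card ?T"
    by (rule card_inj_on_le[OF inj sub fin])
  also have "\<dots> = 2 * (s + 2) ^ (CARD('d) - 1)"
    by (simp add: card_cartesian_product card_PiE nat_add_distrib)
  finally show "card (sphere_levels s :: ('d \<Rightarrow> int) set) \<le> 2 * (s + 2) ^ (CARD('d) - 1)" .
qed

text \<open>The p-th root of the bound for the integral of one Faber function of level j over the
  cube. Level -1 is supported on the whole interval and counts as 0 here, although it counts as 1 in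
  |j|_1.\<close>

definition level_weight :: "real \<Rightarrow> ('d::finite \<Rightarrow> int) \<Rightarrow> real" where
  "level_weight p j = 2 powr (- real_of_int (\<Sum>i\<in>UNIV. max (j i) 0) / p)"

lemma level_weight_pos: "level_weight p j > 0"
  by (simp add: level_weight_def)

text \<open>Stated for finite sets, the form in which levels beyond the truncation arrive. The
  levels are grouped by |j|_1 = n + 1 + t; their number grows polynomially and their weight decays
  geometrically in t.\<close>

lemma level_weight_tail:
  fixes p :: real
  assumes p: "p \<ge> 1"
  shows "\<exists>C>0. \<forall>n\<ge>1. \<forall>S :: ('d::finite \<Rightarrow> int) set. finite S \<longrightarrow>
     (\<forall>j\<in>S. (\<forall>i. j i \<ge> -1) \<and> (\<Sum>i\<in>UNIV. \<bar>j i\<bar>) > int n) \<longrightarrow>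
     (\<Sum>j\<in>S. level_weight p j) \<le> C * 2 powr (- real n / p) * real n ^ (CARD('d) - 1)"
proof -
  define \<beta> where "\<beta> = 2 powr (- 1 / p)"
  have \<beta>: "0 < \<beta>" "\<beta> < 1" using p by (auto simp: \<beta>_def powr_less_one)
  have \<beta>_pow: "\<beta> ^ n = 2 powr (- real n / p)" for n
    by (simp add: \<beta>_def powr_realpow[symmetric] powr_powr)
  let ?D = "CARD('d) - 1"
  let ?a = "\<lambda>t. real (t + 4) ^ ?D * \<beta> ^ t"
  have sm: "summable ?a" using \<beta> by (rule summable_poly_geometric)
  define C where "C = 2 ^ CARD('d) * (2 * suminf ?a) + 1"
  have sa: "suminf ?a \<ge> 0" using \<beta> by (intro suminf_nonneg sm) auto
  have C: "C > 0" using sa by (auto simp: C_def intro: add_nonneg_pos)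
  \<comment> \<open>Each coordinate satisfies max(j_i, 0) \<ge> |j_i| - 1, which costs at most
    2^(d/p) \<le> 2^d.\<close>
  have w: "level_weight p j \<le> 2 ^ CARD('d) * \<beta> ^ s" if "j \<in> sphere_levels s" for j :: "'d \<Rightarrow> int" and s
  proof -
    have "int s - int CARD('d) = (\<Sum>i\<in>UNIV. \<bar>j i\<bar> - 1)" using that by (simp add: sphere_levels_def sum_subtractf)
    also have "\<dots> \<le> (\<Sum>i\<in>UNIV. max (j i) 0)"
      using that by (intro sum_mono) (auto simp: sphere_levels_def max_def)
    finally have "real_of_int (int s - int CARD('d)) \<le> real_of_int (\<Sum>i\<in>UNIV. max (j i) 0)"
      by (simp only: of_int_le_iff)
    then have "- real_of_int (\<Sum>i\<in>UNIV. max (j i) 0) / p \<le> (real CARD('d) - real s) / p"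
      using p by (intro divide_right_mono) auto
    also have "\<dots> = real CARD('d) / p - real s / p" by (rule diff_divide_distrib)
    also have "\<dots> \<le> real CARD('d) + - real s / p"
      using p by (simp add: divide_le_eq mult_le_cancel_left1)
    finally have "level_weight p j \<le> 2 powr (real CARD('d) + - real s / p)"
      unfolding level_weight_def by (intro powr_mono) auto
    also have "\<dots> = 2 ^ CARD('d) * \<beta> ^ s"
      by (simp only: powr_add \<beta>_pow powr_realpow zero_less_numeral)
    finally show ?thesis .
  qed
  show ?thesis
  proof (intro exI[of _ C] conjI C allI impI)
    fix n :: nat and S :: "('d \<Rightarrow> int) set"
    assume n: "n \<ge> 1" and fin: "finite S" and S: "\<forall>j\<in>S. (\<forall>i. j i \<ge> -1) \<and> (\<Sum>i\<in>UNIV. \<bar>j i\<bar>) > int n"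
    \<comment> \<open>The excess of |j|_1 over n + 1, its least possible value on S.\<close>
    define h where "h j = nat (\<Sum>i\<in>UNIV. \<bar>j i\<bar>) - (n + 1)" for j :: "'d \<Rightarrow> int"
    have h: "j \<in> sphere_levels (n + 1 + h j)" if "j \<in> S" for j
    proof -
      have "(\<Sum>i\<in>UNIV. \<bar>j i\<bar>) > int n" "\<And>i. j i \<ge> -1" using S that by auto
      then show ?thesis unfolding sphere_levels_def h_def by auto
    qed
    have "(\<Sum>j\<in>S. level_weight p j) = (\<Sum>t\<in>h ` S. \<Sum>j\<in>{j \<in> S. h j = t}. level_weight p j)"
      by (rule sum.image_gen[OF fin])
    also have "\<dots> \<le> (\<Sum>t\<in>h ` S. 2 ^ CARD('d) * 2 * \<beta> ^ n * real n ^ ?D * ?a t)"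
    proof (rule sum_mono)
      fix t
      have sub: "{j \<in> S. h j = t} \<subseteq> sphere_levels (n + 1 + t)" using h by auto
      have "(\<Sum>j\<in>{j \<in> S. h j = t}. level_weight p j) \<le> (\<Sum>j\<in>{j \<in> S. h j = t}. 2 ^ CARD('d) * \<beta> ^ (n + 1 + t))"
        using sub by (intro sum_mono w) auto
      also have "\<dots> = real (card {j \<in> S. h j = t}) * (2 ^ CARD('d) * \<beta> ^ (n + 1 + t))" by simp
      also have "\<dots> \<le> (2 * real (n + t + 3) ^ ?D) * (2 ^ CARD('d) * \<beta> ^ (n + t))"
      proof (intro mult_mono)
        have "card {j \<in> S. h j = t} \<le> card (sphere_levels (n + 1 + t) :: ('d \<Rightarrow> int) set)"
          by (intro card_mono finite_sphere_levels sub)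
        also have "\<dots> \<le> 2 * (n + 1 + t + 2) ^ ?D" by (rule card_sphere_levels)
        finally have "real (card {j \<in> S. h j = t}) \<le> real (2 * (n + 1 + t + 2) ^ ?D)" by (simp only: of_nat_le_iff)
        also have "\<dots> = 2 * real (n + t + 3) ^ ?D" by (simp add: add_ac)
        finally show "real (card {j \<in> S. h j = t}) \<le> 2 * real (n + t + 3) ^ ?D" .
        show "\<beta> ^ (n + 1 + t) \<le> \<beta> ^ (n + t)" using \<beta> by (intro power_decreasing) auto
      qed (use \<beta> in auto)
      also have "\<dots> \<le> (2 * (real n * real (t + 4)) ^ ?D) * (2 ^ CARD('d) * \<beta> ^ (n + t))"
      proof (intro mult_right_mono mult_left_mono power_mono)
        \<comment> \<open>By n \<ge> 1, n + t + 3 \<le> n (t + 4); this separates n^(d-1) from a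
          convergent sum over t.\<close>
        have "1 * (real t + 3) \<le> real n * (real t + 3)" using n by (intro mult_right_mono) auto
        then show "real (n + t + 3) \<le> real n * real (t + 4)" by (simp add: algebra_simps)
      qed (use \<beta> in auto)
      also have "\<dots> = 2 ^ CARD('d) * 2 * \<beta> ^ n * real n ^ ?D * ?a t"
        by (simp only: power_mult_distrib power_add mult_ac)
      finally show "(\<Sum>j\<in>{j \<in> S. h j = t}. level_weight p j) \<le> 2 ^ CARD('d) * 2 * \<beta> ^ n * real n ^ ?D * ?a t" .
    qed
    also have "\<dots> = 2 ^ CARD('d) * 2 * \<beta> ^ n * real n ^ ?D * (\<Sum>t\<in>h ` S. ?a t)"
      by (rule sum_distrib_left[symmetric])
    also have "\<dots> \<le> 2 ^ CARD('d) * 2 * \<beta> ^ n * real n ^ ?D * suminf ?a"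
      using \<beta> fin by (intro mult_left_mono sum_le_suminf sm) auto
    also have "\<dots> = (2 ^ CARD('d) * (2 * suminf ?a)) * (\<beta> ^ n * real n ^ ?D)" by (simp only: mult_ac)
    also have "\<dots> \<le> C * (\<beta> ^ n * real n ^ ?D)"
      using \<beta> by (intro mult_right_mono) (auto simp: C_def)
    finally show "(\<Sum>j\<in>S. level_weight p j) \<le> C * 2 powr (- real n / p) * real n ^ (CARD('d) - 1)"
      by (simp only: \<beta>_pow mult.assoc)
  qed
qed

section \<open>Measurability and integrals of the Faber functions\<close>

lemma hat_measurable [measurable]: "hat \<in> borel_measurable borel"
  unfolding hat_def[abs_def] by measurable

lemma faber1_measurable [measurable]: "faber1 j k \<in> borel_measurable borel"
  unfolding faber1_def[abs_def] by measurable

lemma faber_measurable [measurable]: "faber j k \<in> borel_measurable (borel :: (real^'d) measure)"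
proof -
  have [measurable]: "(\<lambda>x::real^'d. x $ i) \<in> borel_measurable borel" for i
    by (intro borel_measurable_continuous_onI continuous_intros)
  show ?thesis unfolding faber_def[abs_def] by measurable
qed

lemma unit_cube_measurable [measurable]: "(unit_cube :: (real^'d) set) \<in> sets borel"
proof -
  have eq: "unit_cube = cbox 0 (1 :: real^'d)" by (auto simp: unit_cube_def mem_box_cart)
  show ?thesis unfolding eq by (intro borel_closed closed_cbox)
qed

text \<open>Comparison with the indicator of the support, an interval of length 2^(-max j
  0).\<close>

lemma
  assumes "j \<ge> -1"
  shows faber1_integrable: "integrable lborel (\<lambda>t. indicator {0..1} t * faber1 j k t)"
    and faber1_integral_le: "(LBINT t. indicator {0..1} t * faber1 j k t) \<le> 2 powr (- real_of_int (max j 0))"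
proof -
  have "\<exists>a b. a \<le> b \<and> b - a = 2 powr (- real_of_int (max j 0)) \<and>
      (\<forall>t. indicator {0..1} t * faber1 j k t \<le> indicator {a..b} t)"
    using assms
  proof (cases rule: level_cases)
    case 1
    then show ?thesis by (intro exI[of _ 0] exI[of _ 1]) (auto simp: indicator_def faber1_def)
  next
    case (2 n)
    have "2 powr (- real_of_int (max j 0)) = 1 / 2 ^ n"
      by (simp add: 2 powr_minus powr_realpow divide_inverse)
    moreover have "indicator {0..1} t * faber1 j k t \<le> indicator {real k / 2 ^ n..(real k + 1) / 2 ^ n} t" for t
    proof (cases "t \<in> {real k / 2 ^ n..(real k + 1) / 2 ^ n}")
      case True
      then show ?thesis using hat_bounds by (auto simp: indicator_def faber1_def 2)
    next
      case False
      then have "2 ^ n * t - real k \<le> 0 \<or> 2 ^ n * t - real k \<ge> 1" by (auto simp: field_simps)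
      then show ?thesis using False by (auto simp: faber1_def 2 hat_eq_0)
    qed
    ultimately show ?thesis
      by (intro exI[of _ "real k / 2 ^ n"] exI[of _ "(real k + 1) / 2 ^ n"]) (auto simp: field_simps)
  qed
  then obtain a b where ab: "a \<le> b" "b - a = 2 powr (- real_of_int (max j 0))"
      "\<And>t. indicator {0..1} t * faber1 j k t \<le> indicator {a..b} t" by blast
  have nn: "0 \<le> indicator {0..1} t * faber1 j k t" for t
    by (auto simp: indicator_def faber1_nonneg)
  have i: "integrable lborel (indicator {a..b} :: real \<Rightarrow> real)"
    by (intro integrable_real_indicator) (use ab in auto)
  show int: "integrable lborel (\<lambda>t. indicator {0..1} t * faber1 j k t)"
    by (rule integrable_dominated[OF i]) (use ab nn in \<open>auto simp: abs_of_nonneg\<close>)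
  have "(LBINT t. indicator {0..1} t * faber1 j k t) \<le> (LBINT t. indicator {a..b} t)"
    by (intro integral_mono int i ab)
  then show "(LBINT t. indicator {0..1} t * faber1 j k t) \<le> 2 powr (- real_of_int (max j 0))"
    using ab by simp
qed

lemma indicator_unit_cube: "indicator unit_cube x = (\<Prod>i\<in>UNIV. indicator {0..1} (x $ i) :: real)"
proof (cases "x \<in> unit_cube")
  case False
  then obtain i where "x $ i \<notin> {0..1}" by (auto simp: unit_cube_def)
  then have "(\<Prod>i\<in>UNIV. indicator {0..1} (x $ i) :: real) = 0" by (intro prod_zero bexI[of _ i]) (simp_all add: indicator_def)
  then show ?thesis using False by simp
qed (auto simp: unit_cube_def)

lemma
  fixes j :: "'d::finite \<Rightarrow> int"
  assumes "\<And>i. j i \<ge> -1"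
  shows faber_integrable: "integrable lborel (\<lambda>x::real^'d. indicator unit_cube x * faber j k x)"
    and faber_integral_le: "integral\<^sup>L lborel (\<lambda>x::real^'d. indicator unit_cube x * faber j k x)
      \<le> 2 powr (- real_of_int (\<Sum>i\<in>UNIV. max (j i) 0))"
proof -
  have eq: "indicator unit_cube x * faber j k x = (\<Prod>i\<in>UNIV. indicator {0..1} (x $ i) * faber1 (j i) (k i) (x $ i))"
    for x :: "real^'d"
    by (simp add: indicator_unit_cube faber_def prod.distrib)
  show "integrable lborel (\<lambda>x::real^'d. indicator unit_cube x * faber j k x)"
    unfolding eq by (intro integrable_prod_vec faber1_integrable assms)
  have "integral\<^sup>L lborel (\<lambda>x::real^'d. indicator unit_cube x * faber j k x)
      = (\<Prod>i\<in>UNIV. LBINT t. indicator {0..1} t * faber1 (j i) (k i) t)"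
    unfolding eq by (intro integral_prod_vec faber1_integrable assms)
  also have "\<dots> \<le> (\<Prod>i\<in>UNIV. 2 powr (- real_of_int (max (j i) 0)))"
    by (intro prod_mono conjI faber1_integral_le assms Bochner_Integration.integral_nonneg)
      (auto simp: indicator_def faber1_nonneg)
  also have "\<dots> = 2 powr (\<Sum>i\<in>UNIV. - real_of_int (max (j i) 0))"
    by (simp add: powr_sum)
  finally show "integral\<^sup>L lborel (\<lambda>x::real^'d. indicator unit_cube x * faber j k x)
      \<le> 2 powr (- real_of_int (\<Sum>i\<in>UNIV. max (j i) 0))"
    by (simp only: sum_negf of_int_sum)
qed

section \<open>Truncation error from a coefficient bound\<close>

lemma finite_levels_below: "finite (levels_below n :: ('d::finite \<Rightarrow> int) set)"
  unfolding levels_below_def by (rule finite_fun_set) auto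

lemma faber_level_measurable [measurable]: "(\<lambda>x. faber_level f x j) \<in> borel_measurable borel"
  unfolding faber_level_def by measurable

lemma faber_nonneg: "x \<in> unit_cube \<Longrightarrow> 0 \<le> faber j k x"
  unfolding faber_def by (intro prod_nonneg ballI faber1_nonneg) (auto simp: unit_cube_def)

lemma faber_sum_le:
  fixes j :: "'d::finite \<Rightarrow> int"
  assumes "x \<in> unit_cube" "\<And>i. j i \<ge> -1"
  shows "(\<Sum>k\<in>shift_set j. faber j k x) \<le> 1"
proof -
  have x: "0 \<le> x $ i" "x $ i \<le> 1" for i using assms(1) by (auto simp: unit_cube_def)
  have "(\<Sum>k\<in>shift_set j. faber j k x) = (\<Prod>i\<in>UNIV. \<Sum>k\<in>dyadic_shifts (j i). faber1 (j i) k (x $ i))"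
    unfolding faber_def by (rule sum_prod_fun_set) simp
  also have "\<dots> \<le> 1"
    using x assms by (intro prod_le_1) (auto intro!: sum_nonneg faber1_nonneg faber1_sum_le)
  finally show ?thesis .
qed

lemma faber_truncation_levels:
  fixes f :: "real^'d \<Rightarrow> complex"
  shows "faber_truncation n f x = (\<Sum>j | (\<forall>i. j i \<ge> -1) \<and> (\<Sum>i\<in>UNIV. \<bar>j i\<bar>) \<le> int n. faber_level f x j)"
  by (simp add: faber_truncation_def faber_level_def)

lemma truncation_subset_levels_below:
  assumes "n < N"
  shows "{j :: 'd::finite \<Rightarrow> int. (\<forall>i. j i \<ge> -1) \<and> (\<Sum>i\<in>UNIV. \<bar>j i\<bar>) \<le> int n} \<subseteq> levels_below N"
proof clarify
  fix j :: "'d \<Rightarrow> int" assume j: "\<forall>i. j i \<ge> -1" "(\<Sum>i\<in>UNIV. \<bar>j i\<bar>) \<le> int n"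
  have "j i < int N" for i using abs_level_le_sum[of j i] j(2) assms by linarith
  then show "j \<in> levels_below N" using j by (simp add: levels_below_def)
qed

text \<open>Hoelder over levels and shifts in one stroke: each coefficient enters Young's inequality
  with b times the weight of its level as parameter. As the functions of one level sum to at most 1,
  the remainders add up to b times the sum of the level weights, hence at most b * W.\<close>

lemma level_sum_pointwise:
  fixes f :: "real^'d \<Rightarrow> complex"
  assumes p: "p \<ge> 1" and x: "x \<in> unit_cube" and fin: "finite S" and S: "\<And>j i. j \<in> S \<Longrightarrow> j i \<ge> -1"
    and W: "(\<Sum>j\<in>S. level_weight p j) \<le> W" "W > 0"
  shows "norm (\<Sum>j\<in>S. faber_level f x j) powr p \<le> W powr (p - 1) *
    (\<Sum>j\<in>S. level_weight p j powr (1 - p) *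
      (\<Sum>k\<in>shift_set j. norm (faber_coeff f j k) powr p * faber j k x))"
proof (rule powr_le_of_young[OF p])
  fix b :: real assume b: "b > 0"
  let ?K = "\<lambda>j :: 'd \<Rightarrow> int. shift_set j"
  let ?w = "level_weight p"
  have v: "0 \<le> faber j k x" for j k using x by (rule faber_nonneg)
  have "norm (\<Sum>j\<in>S. faber_level f x j) \<le> (\<Sum>j\<in>S. \<Sum>k\<in>?K j. norm (faber_coeff f j k) * faber j k x)"
    unfolding faber_level_def
    by (intro sum_norm_le order_trans[OF norm_sum] sum_mono) (simp add: norm_mult v)
  also have "\<dots> \<le> (\<Sum>j\<in>S. b powr (1 - p) * (?w j powr (1 - p) * (\<Sum>k\<in>?K j. norm (faber_coeff f j k) powr p * faber j k x)) / p
      + (1 - 1 / p) * b * ?w j)"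
  proof (rule sum_mono)
    fix j assume j: "j \<in> S"
    have bw: "b * ?w j > 0" using b level_weight_pos by (rule mult_pos_pos)
    have "(\<Sum>k\<in>?K j. norm (faber_coeff f j k) * faber j k x)
        \<le> (\<Sum>k\<in>?K j. ((b * ?w j) powr (1 - p) * norm (faber_coeff f j k) powr p / p + (1 - 1 / p) * (b * ?w j)) * faber j k x)"
      by (intro sum_mono mult_right_mono young_weighted v bw p) auto
    also have "\<dots> = (b * ?w j) powr (1 - p) / p * (\<Sum>k\<in>?K j. norm (faber_coeff f j k) powr p * faber j k x)
        + (1 - 1 / p) * (b * ?w j) * (\<Sum>k\<in>?K j. faber j k x)"
      unfolding distrib_right sum.distrib sum_distrib_left
      by (simp only: times_divide_eq_left times_divide_eq_right mult_ac)
    also have "(1 - 1 / p) * (b * ?w j) * (\<Sum>k\<in>?K j. faber j k x) \<le> (1 - 1 / p) * (b * ?w j) * 1"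
      using p bw by (intro mult_left_mono faber_sum_le x S j) auto
    also have "(b * ?w j) powr (1 - p) / p * (\<Sum>k\<in>?K j. norm (faber_coeff f j k) powr p * faber j k x)
        = b powr (1 - p) * (?w j powr (1 - p) * (\<Sum>k\<in>?K j. norm (faber_coeff f j k) powr p * faber j k x)) / p"
      using b level_weight_pos[of p j] by (simp add: powr_mult)
    finally show "(\<Sum>k\<in>?K j. norm (faber_coeff f j k) * faber j k x)
        \<le> b powr (1 - p) * (?w j powr (1 - p) * (\<Sum>k\<in>?K j. norm (faber_coeff f j k) powr p * faber j k x)) / p
      + (1 - 1 / p) * b * ?w j" by simp
  qed
  also have "\<dots> = b powr (1 - p) * (\<Sum>j\<in>S. ?w j powr (1 - p) * (\<Sum>k\<in>?K j. norm (faber_coeff f j k) powr p * faber j k x)) / p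
      + (1 - 1 / p) * b * (\<Sum>j\<in>S. ?w j)"
    by (simp only: sum.distrib sum_distrib_left sum_divide_distrib)
  also have "(1 - 1 / p) * b * (\<Sum>j\<in>S. ?w j) \<le> (1 - 1 / p) * b * W"
    using p b W by (intro mult_left_mono) auto
  finally show "norm (\<Sum>j\<in>S. faber_level f x j) \<le> b powr (1 - p) * (\<Sum>j\<in>S. ?w j powr (1 - p) *
      (\<Sum>k\<in>?K j. norm (faber_coeff f j k) powr p * faber j k x)) / p + (1 - 1 / p) * b * W" by simp
next
  show "0 \<le> (\<Sum>j\<in>S. level_weight p j powr (1 - p) *
      (\<Sum>k\<in>shift_set j. norm (faber_coeff f j k) powr p * faber j k x))"
    by (intro sum_nonneg mult_nonneg_nonneg faber_nonneg x) auto
qed (use W in auto)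

text \<open>Each Faber function integrates to at most the p-th power of its level weight w. Since
  w^(1-p) w^p = w, integrating the pointwise bound leaves W^(p-1) times the sum of w * M, at most
  W^p M.\<close>

lemma level_sum_Lp:
  fixes f :: "real^'d \<Rightarrow> complex"
  assumes p: "p \<ge> 1" and fin: "finite S" and S: "\<And>j i. j \<in> S \<Longrightarrow> j i \<ge> -1"
    and W: "(\<Sum>j\<in>S. level_weight p j) \<le> W" "W > 0"
    and M: "\<And>j. j \<in> S \<Longrightarrow> (\<Sum>k\<in>shift_set j. norm (faber_coeff f j k) powr p) \<le> M" "M \<ge> 0"
  shows "(\<integral>\<^sup>+x. ennreal (indicator unit_cube x * norm (\<Sum>j\<in>S. faber_level f x j) powr p) \<partial>lborel) \<le> ennreal (W powr p * M)"
proof -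
  let ?K = "\<lambda>j :: 'd \<Rightarrow> int. shift_set j"
  let ?w = "level_weight p"
  let ?J = "\<lambda>j k. integral\<^sup>L lborel (\<lambda>x::real^'d. indicator unit_cube x * faber j k x)"
  let ?E = "\<lambda>x. W powr (p - 1) * (\<Sum>j\<in>S. ?w j powr (1 - p) *
      (\<Sum>k\<in>?K j. norm (faber_coeff f j k) powr p * (indicator unit_cube x * faber j k x)))"
  have int: "integrable lborel ?E"
    by (intro integrable_mult_right Bochner_Integration.integrable_sum faber_integrable S)
  have le: "indicator unit_cube x * norm (\<Sum>j\<in>S. faber_level f x j) powr p \<le> ?E x" for x
  proof (cases "x \<in> unit_cube")
    case True
    have "norm (\<Sum>j\<in>S. faber_level f x j) powr p \<le> W powr (p - 1) *
      (\<Sum>j\<in>S. ?w j powr (1 - p) * (\<Sum>k\<in>?K j. norm (faber_coeff f j k) powr p * faber j k x))"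
      by (rule level_sum_pointwise[OF p True fin _ W]) (rule S)
    then show ?thesis using True by simp
  qed simp
  have "integral\<^sup>L lborel ?E = W powr (p - 1) * (\<Sum>j\<in>S. ?w j powr (1 - p) *
      (\<Sum>k\<in>?K j. norm (faber_coeff f j k) powr p * ?J j k))"
    by (subst integral_mult_right_zero, subst Bochner_Integration.integral_sum)
      (auto simp: Bochner_Integration.integral_sum faber_integrable S
        intro!: integrable_mult_right Bochner_Integration.integrable_sum sum.cong)
  also have "\<dots> \<le> W powr (p - 1) * (\<Sum>j\<in>S. ?w j * M)"
  proof (intro mult_left_mono sum_mono)
    fix j assume j: "j \<in> S"
    have "?w j powr p = 2 powr (- real_of_int (\<Sum>i\<in>UNIV. max (j i) 0))"
      using p by (simp add: level_weight_def powr_powr)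
    then have *: "?J j k \<le> ?w j powr p" for k
      using faber_integral_le[of j k] S[OF j] by simp
    have "?w j powr (1 - p) * (\<Sum>k\<in>?K j. norm (faber_coeff f j k) powr p * ?J j k)
        \<le> ?w j powr (1 - p) * (\<Sum>k\<in>?K j. norm (faber_coeff f j k) powr p * ?w j powr p)"
      by (intro mult_left_mono sum_mono *) auto
    also have "\<dots> = (?w j powr (1 - p) * ?w j powr p) * (\<Sum>k\<in>?K j. norm (faber_coeff f j k) powr p)"
      unfolding sum_distrib_right[symmetric] by (simp only: mult_ac)
    also have "?w j powr (1 - p) * ?w j powr p = ?w j"
      using level_weight_pos[of p j] by (simp flip: powr_add)
    also have "?w j * (\<Sum>k\<in>?K j. norm (faber_coeff f j k) powr p) \<le> ?w j * M"
      using level_weight_pos[of p j] by (intro mult_left_mono M j) auto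
    finally show "?w j powr (1 - p) * (\<Sum>k\<in>?K j. norm (faber_coeff f j k) powr p * ?J j k)
        \<le> ?w j * M" .
  qed auto
  also have "\<dots> = W powr (p - 1) * ((\<Sum>j\<in>S. ?w j) * M)" by (simp add: sum_distrib_right)
  also have "\<dots> \<le> W powr (p - 1) * (W * M)"
    using W M(2) by (intro mult_left_mono mult_right_mono) auto
  also have "\<dots> = W powr p * M" using W by (simp add: powr_diff)
  finally have fl: "integral\<^sup>L lborel ?E \<le> W powr p * M" .
  have "(\<integral>\<^sup>+x. ennreal (indicator unit_cube x * norm (\<Sum>j\<in>S. faber_level f x j) powr p) \<partial>lborel) \<le> (\<integral>\<^sup>+x. ennreal (?E x) \<partial>lborel)"
    by (intro nn_integral_mono ennreal_leI le)
  also have "\<dots> = ennreal (integral\<^sup>L lborel ?E)"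
  proof (rule nn_integral_eq_integral[OF int])
    have "0 \<le> ?E x" for x using le[of x] by (rule order_trans[rotated]) auto
    then show "AE x in lborel. 0 \<le> ?E x" by auto
  qed
  also have "\<dots> \<le> ennreal (W powr p * M)" by (intro ennreal_leI fl)
  finally show ?thesis .
qed

text \<open>The error is the pointwise limit of finite sums of levels beyond the truncation, taken
  along full cubes of levels, where convergence is known. Fatou's lemma carries the uniform bound
  over to the limit.\<close>

lemma truncation_error_of_coefficient_bound:
  fixes f :: "real^'d \<Rightarrow> complex"
  assumes p: "p \<ge> 1" and cont: "continuous_on unit_cube f"
    and W: "\<And>S :: ('d \<Rightarrow> int) set. finite S \<Longrightarrow> (\<And>j. j \<in> S \<Longrightarrow> (\<forall>i. j i \<ge> -1) \<and> (\<Sum>i\<in>UNIV. \<bar>j i\<bar>) > int n) \<Longrightarrow> (\<Sum>j\<in>S. level_weight p j) \<le> W" "W > 0"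
    and M: "\<And>j. (\<And>i. j i \<ge> -1) \<Longrightarrow> (\<Sum>k\<in>shift_set j. norm (faber_coeff f j k) powr p) \<le> M powr p" "M \<ge> 0"
  shows "Lp_norm p unit_cube (\<lambda>x. f x - faber_truncation n f x) \<le> W * M"
proof -
  let ?T = "{j :: 'd \<Rightarrow> int. (\<forall>i. j i \<ge> -1) \<and> (\<Sum>i\<in>UNIV. \<bar>j i\<bar>) \<le> int n}"
  \<comment> \<open>The levels of the cube beyond the truncation; for N > n the truncation lies
    inside the cube.\<close>
  define S where "S N = levels_below N - ?T" for N
  define u where "u N x = indicator unit_cube x * norm (\<Sum>j\<in>S N. faber_level f x j) powr p" for N and x :: "real^'d"
  let ?e = "\<lambda>x. indicator unit_cube x * norm (f x - faber_truncation n f x) powr p"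
  have S: "finite (S N)" "\<And>j. j \<in> S N \<Longrightarrow> (\<forall>i. j i \<ge> -1) \<and> (\<Sum>i\<in>UNIV. \<bar>j i\<bar>) > int n" for N
    unfolding S_def using finite_levels_below by (auto simp: levels_below_def)
  have S1: "j i \<ge> -1" if "j \<in> S N" for j i N using S(2)[OF that] by blast
  have SW: "(\<Sum>j\<in>S N. level_weight p j) \<le> W" for N
    by (rule W(1)) (use S in auto)
  have [measurable]: "u N \<in> borel_measurable lborel" for N unfolding u_def by measurable
  have lim: "(\<lambda>N. u N x) \<longlonglongrightarrow> ?e x" for x
  proof (cases "x \<in> unit_cube")
    case True
    have "(\<Sum>j\<in>levels_below N. faber_level f x j) - faber_truncation n f x = (\<Sum>j\<in>S N. faber_level f x j)" if "N > n" for N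
      unfolding faber_truncation_levels S_def
      by (rule sum_diff[symmetric]) (use truncation_subset_levels_below[OF that] finite_levels_below in auto)
    then have ev: "\<forall>\<^sub>F N in sequentially. (\<Sum>j\<in>levels_below N. faber_level f x j) - faber_truncation n f x = (\<Sum>j\<in>S N. faber_level f x j)"
      by (intro eventually_sequentiallyI[of "Suc n"]) auto
    have "(\<lambda>N. (\<Sum>j\<in>levels_below N. faber_level f x j) - faber_truncation n f x) \<longlonglongrightarrow> f x - faber_truncation n f x"
      by (intro tendsto_intros faber_series_tendsto cont True)
    then have "(\<lambda>N. \<Sum>j\<in>S N. faber_level f x j) \<longlonglongrightarrow> f x - faber_truncation n f x"
      by (rule Lim_transform_eventually[OF _ ev])
    then have "(\<lambda>N. norm (\<Sum>j\<in>S N. faber_level f x j) powr p) \<longlonglongrightarrow> norm (f x - faber_truncation n f x) powr p"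
      using p by (intro tendsto_powr' tendsto_norm tendsto_const) auto
    then show ?thesis using True by (simp add: u_def)
  qed (simp add: u_def)
  have "(\<integral>\<^sup>+x. ennreal (?e x) \<partial>lborel) = (\<integral>\<^sup>+x. liminf (\<lambda>N. ennreal (u N x)) \<partial>lborel)"
    by (intro nn_integral_cong lim_imp_Liminf[symmetric] tendsto_ennrealI lim) auto
  also have "\<dots> \<le> liminf (\<lambda>N. \<integral>\<^sup>+x. ennreal (u N x) \<partial>lborel)"
    by (rule nn_integral_liminf) simp
  also have "\<dots> \<le> ennreal (W powr p * M powr p)"
  proof (rule Liminf_le)
    show "\<forall>\<^sub>F N in sequentially. (\<integral>\<^sup>+x. ennreal (u N x) \<partial>lborel) \<le> ennreal (W powr p * M powr p)"
      unfolding u_def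
      by (intro always_eventually allI level_sum_Lp p S(1) SW W(2) M) (auto intro: S1)
  qed simp
  finally have nn: "(\<integral>\<^sup>+x. ennreal (?e x) \<partial>lebesgue) \<le> ennreal (W powr p * M powr p)"
    by (simp add: nn_integral_completion)
  have "(LINT x:unit_cube|lebesgue. norm (f x - faber_truncation n f x) powr p) \<le> W powr p * M powr p"
    unfolding set_lebesgue_integral_def real_scaleR_def
    by (rule integral_real_bounded[OF _ nn]) auto
  moreover have "0 \<le> (LINT x:unit_cube|lebesgue. norm (f x - faber_truncation n f x) powr p)"
    unfolding set_lebesgue_integral_def by (intro Bochner_Integration.integral_nonneg) auto
  ultimately have "Lp_norm p unit_cube (\<lambda>x. f x - faber_truncation n f x) \<le> (W powr p * M powr p) powr (1 / p)"
    unfolding Lp_norm_def using p by (intro powr_mono2) auto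
  also have "\<dots> = W * M" using p W M by (simp add: powr_mult powr_powr)
  finally show ?thesis .
qed

section \<open>Tensor products of Fourier multipliers\<close>

lemma cis_inner: "cis (\<xi> \<bullet> x) = (\<Prod>i\<in>UNIV. cis (\<xi> $ i * x $ i))" for \<xi> x :: "real^'d"
  by (simp add: cis_conv_exp inner_vec_def sum_distrib_left exp_sum)

lemma vec_nth_measurable [measurable]: "(\<lambda>x::real^'d. x $ i) \<in> borel_measurable borel"
  by (intro borel_measurable_continuous_onI continuous_intros)

definition fourier_const :: "'d::finite itself \<Rightarrow> real" where
  "fourier_const _ = (2 * pi) powr (- real CARD('d) / 2)"

lemma fourier_const_pos: "fourier_const d > 0"
  by (simp add: fourier_const_def)

text \<open>The two unitary factors cancel against the d factors 2 pi hidden in the kernels.\<close>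

lemma fourier_const_square: "fourier_const TYPE('d::finite) * fourier_const TYPE('d) * (2 * pi) ^ CARD('d) = 1"
proof -
  have "fourier_const TYPE('d) * fourier_const TYPE('d) * (2 * pi) ^ CARD('d)
      = (2 * pi) powr (- real CARD('d) / 2 + - real CARD('d) / 2 + real CARD('d))"
    unfolding fourier_const_def powr_add by (simp add: powr_realpow)
  then show ?thesis by simp
qed

text \<open>For Borel functions the Lebesgue integrals of the definition become
  \<open>lborel\<close> integrals, where product measures are available.\<close>

lemma fourier_eq:
  fixes g :: "real^'d \<Rightarrow> complex"
  assumes [measurable]: "g \<in> borel_measurable borel"
  shows "fourier g \<xi> = fourier_const TYPE('d) * (LBINT y. g y * cis (- (\<xi> \<bullet> y)))"
proof -
  have "(\<lambda>y. g y * cis (- (\<xi> \<bullet> y))) \<in> borel_measurable lborel" by measurable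
  moreover have "exp (- \<i> * complex_of_real (\<xi> \<bullet> y)) = cis (- (\<xi> \<bullet> y))" for y
    by (simp add: cis_conv_exp)
  ultimately show ?thesis unfolding fourier_def fourier_const_def
    by (simp only: integral_completion)
qed

lemma inv_fourier_eq:
  fixes h :: "real^'d \<Rightarrow> complex"
  assumes [measurable]: "h \<in> borel_measurable borel"
  shows "inv_fourier h x = fourier_const TYPE('d) * (LBINT \<xi>. h \<xi> * cis (\<xi> \<bullet> x))"
proof -
  have "(\<lambda>\<xi>. h \<xi> * cis (\<xi> \<bullet> x)) \<in> borel_measurable lborel" by measurable
  moreover have "exp (\<i> * complex_of_real (\<xi> \<bullet> x)) = cis (\<xi> \<bullet> x)" for \<xi>
    by (simp add: cis_conv_exp)
  ultimately show ?thesis unfolding inv_fourier_def fourier_const_def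
    by (simp only: integral_completion)
qed

lemma fourier_measurable:
  fixes g :: "real^'d \<Rightarrow> complex"
  assumes [measurable]: "g \<in> borel_measurable borel"
  shows "fourier g \<in> borel_measurable borel"
proof -
  have "(\<lambda>\<xi>. LBINT y. g y * cis (- (\<xi> \<bullet> y))) \<in> borel_measurable borel"
    by measurable
  then show ?thesis unfolding fourier_eq[OF assms, abs_def] by measurable
qed

lemma fourier_bounded:
  fixes g :: "real^'d \<Rightarrow> complex"
  assumes "integrable lborel g"
  shows "\<exists>B\<ge>0. \<forall>\<xi>. norm (fourier g \<xi>) \<le> B"
proof (intro exI conjI allI)
  have [measurable]: "g \<in> borel_measurable borel" using assms by simp
  fix \<xi>
  have "norm (LBINT y. g y * cis (- (\<xi> \<bullet> y))) \<le> (LBINT y. norm (g y * cis (- (\<xi> \<bullet> y))))"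
    by (rule integral_norm_bound)
  then show "norm (fourier g \<xi>) \<le> fourier_const TYPE('d) * (LBINT y. norm (g y))"
    using fourier_const_pos[of "TYPE('d)"] by (simp add: fourier_eq norm_mult abs_of_pos)
qed (use fourier_const_pos in \<open>auto intro!: mult_nonneg_nonneg intro: less_imp_le\<close>)

text \<open>After Fubini the frequency integral of the product symbol factorises into
  one-dimensional kernels.\<close>

lemma inv_fourier_tensor_fourier:
  fixes g :: "real^'d \<Rightarrow> complex" and a :: "'d \<Rightarrow> real \<Rightarrow> complex"
  assumes g: "integrable lborel g" and a: "\<And>i. integrable lborel (a i)"
  shows "inv_fourier (\<lambda>\<xi>. (\<Prod>i\<in>UNIV. a i (\<xi> $ i)) * fourier g \<xi>) x
    = (LBINT y. (\<Prod>i\<in>UNIV. kern (a i) (x $ i - y $ i)) * g y)"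
proof -
  let ?c = "complex_of_real (fourier_const TYPE('d))"
  let ?P = "\<lambda>\<xi> y :: real^'d. \<Prod>i\<in>UNIV. a i (\<xi> $ i) * cis (\<xi> $ i * (x $ i - y $ i))"
  have [measurable]: "g \<in> borel_measurable borel" "\<And>i. a i \<in> borel_measurable borel" using g a by auto
  have [measurable]: "fourier g \<in> borel_measurable borel" by (rule fourier_measurable) simp
  have cx: "cis (- (\<xi> \<bullet> y)) * cis (\<xi> \<bullet> x) = (\<Prod>i\<in>UNIV. cis (\<xi> $ i * (x $ i - y $ i)))" for \<xi> y
  proof -
    have "cis (- (\<xi> \<bullet> y)) * cis (\<xi> \<bullet> x) = cis (\<xi> \<bullet> (x - y))" by (simp add: cis_mult inner_diff_right)
    then show ?thesis by (simp only: cis_inner vector_minus_component)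
  qed
  have "inv_fourier (\<lambda>\<xi>. (\<Prod>i\<in>UNIV. a i (\<xi> $ i)) * fourier g \<xi>) x
      = ?c * (LBINT \<xi>. (\<Prod>i\<in>UNIV. a i (\<xi> $ i)) * fourier g \<xi> * cis (\<xi> \<bullet> x))"
    by (rule inv_fourier_eq) measurable
  also have "(\<lambda>\<xi>. (\<Prod>i\<in>UNIV. a i (\<xi> $ i)) * fourier g \<xi> * cis (\<xi> \<bullet> x))
      = (\<lambda>\<xi>. ?c * (LBINT y. ?P \<xi> y * g y))"
  proof
    fix \<xi>
    have "(\<Prod>i\<in>UNIV. a i (\<xi> $ i)) * fourier g \<xi> * cis (\<xi> \<bullet> x)
        = ?c * (((\<Prod>i\<in>UNIV. a i (\<xi> $ i)) * cis (\<xi> \<bullet> x)) * (LBINT y. g y * cis (- (\<xi> \<bullet> y))))"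
      by (simp add: fourier_eq)
    also have "((\<Prod>i\<in>UNIV. a i (\<xi> $ i)) * cis (\<xi> \<bullet> x)) * (LBINT y. g y * cis (- (\<xi> \<bullet> y)))
        = (LBINT y. ((\<Prod>i\<in>UNIV. a i (\<xi> $ i)) * cis (\<xi> \<bullet> x)) * (g y * cis (- (\<xi> \<bullet> y))))"
      by (rule integral_mult_right_zero[symmetric])
    also have "\<dots> = (LBINT y. ?P \<xi> y * g y)"
      unfolding prod.distrib cx[symmetric] by (simp only: mult_ac)
    finally show "(\<Prod>i\<in>UNIV. a i (\<xi> $ i)) * fourier g \<xi> * cis (\<xi> \<bullet> x)
      = ?c * (LBINT y. ?P \<xi> y * g y)" .
  qed
  also have "(LBINT \<xi>. ?c * (LBINT y. ?P \<xi> y * g y))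
      = ?c * (LBINT \<xi>. (LBINT y. ?P \<xi> y * g y))"
    by (rule integral_mult_right_zero)
  also have "(LBINT \<xi>. (LBINT y. ?P \<xi> y * g y))
      = (LBINT y. (LBINT \<xi>. ?P \<xi> y * g y))"
  proof (rule fubini_dominated[where a="\<lambda>\<xi>. norm (\<Prod>i\<in>UNIV. a i (\<xi> $ i))" and b="\<lambda>y. norm (g y)"])
    show "(\<lambda>(\<xi>, y). ?P \<xi> y * g y) \<in> borel_measurable borel"
      unfolding borel_prod[symmetric] by measurable
    show "norm (?P \<xi> y * g y)
        \<le> norm (\<Prod>i\<in>UNIV. a i (\<xi> $ i)) * norm (g y)" for \<xi> y
      by (simp add: norm_mult prod_norm[symmetric])
  qed (intro integrable_norm integrable_prod_vec a g)+
  also have "\<dots> = (LBINT y. (2 * pi) ^ CARD('d) * ((\<Prod>i\<in>UNIV. kern (a i) (x $ i - y $ i)) * g y))"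
  proof (intro Bochner_Integration.integral_cong refl)
    fix y
    have i: "integrable lborel (\<lambda>t. a i t * cis (t * s))" for i s
      by (rule integrable_dominated[OF integrable_norm[OF a[of i]]]) (auto simp: norm_mult)
    have "(LBINT \<xi>. ?P \<xi> y * g y)
        = (LBINT \<xi>. ?P \<xi> y) * g y"
      by (rule integral_mult_left_zero)
    also have "(LBINT \<xi>. ?P \<xi> y)
        = (\<Prod>i\<in>UNIV. LBINT t. a i t * cis (t * (x $ i - y $ i)))"
      by (rule integral_prod_vec[OF i])
    also have "\<dots> = (\<Prod>i\<in>UNIV. (2 * pi) * kern (a i) (x $ i - y $ i))"
      by (simp add: kern_def)
    finally show "(LBINT \<xi>. ?P \<xi> y * g y)
        = (2 * pi) ^ CARD('d) * ((\<Prod>i\<in>UNIV. kern (a i) (x $ i - y $ i)) * g y)"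
      by (simp only: prod.distrib prod_constant mult.assoc) simp
  qed
  also have "\<dots> = (2 * pi) ^ CARD('d) * (LBINT y. (\<Prod>i\<in>UNIV. kern (a i) (x $ i - y $ i)) * g y)"
    by (rule integral_mult_right_zero)
  also have "?c * (?c * (complex_of_real ((2 * pi) ^ CARD('d)) * I)) = I" for I
  proof -
    have "?c * (?c * (complex_of_real ((2 * pi) ^ CARD('d)) * I)) = of_real (fourier_const TYPE('d) * fourier_const TYPE('d) * (2 * pi) ^ CARD('d)) * I"
      by (simp only: of_real_mult mult.assoc)
    then show ?thesis by (simp only: fourier_const_square of_real_1 mult_1)
  qed
  finally show ?thesis by simp
qed

text \<open>Boundedness of G makes all integrals against the integrable tensor weight finite. The
  estimate is Hoelder's inequality with respect to this weight.\<close>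

lemma norm_tensor_integral_powr_le:
  fixes u :: "'d::finite \<Rightarrow> real \<Rightarrow> complex" and G :: "real^'d \<Rightarrow> complex"
  assumes p: "p \<ge> 1" and u: "\<And>i. integrable lborel (u i)" "\<And>i. (LBINT t. norm (u i t)) \<le> a" and a: "a > 0"
    and G: "G \<in> borel_measurable borel" "\<And>z. norm (G z) \<le> B"
  shows "integrable lborel (\<lambda>z. (\<Prod>i\<in>UNIV. norm (u i (z $ i))) * norm (G z) powr p)"
    and "norm (LBINT z. (\<Prod>i\<in>UNIV. u i (z $ i)) * G z) powr p
      \<le> (a ^ CARD('d)) powr (p - 1) * (LBINT z. (\<Prod>i\<in>UNIV. norm (u i (z $ i))) * norm (G z) powr p)"
proof -
  let ?U = "\<lambda>z::real^'d. \<Prod>i\<in>UNIV. norm (u i (z $ i))"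
  have [measurable]: "G \<in> borel_measurable borel" "\<And>i. u i \<in> borel_measurable borel" using G u by auto
  have B: "B \<ge> 0" using order_trans[OF norm_ge_zero G(2)[of 0]] .
  have U: "integrable lborel ?U" by (intro integrable_prod_vec integrable_norm u)
  have U0: "?U z \<ge> 0" for z by (intro prod_nonneg) auto
  have i1: "integrable lborel (\<lambda>z. ?U z * norm (G z))"
    by (rule integrable_dominated[OF integrable_mult_left[OF U, of B]])
      (use U0 G(2) in \<open>auto simp: abs_mult intro!: mult_mono\<close>)
  show i2: "integrable lborel (\<lambda>z. ?U z * norm (G z) powr p)"
    by (rule integrable_dominated[OF integrable_mult_left[OF U, of "B powr p"]])
      (use U0 G(2) p in \<open>auto simp: abs_mult intro!: mult_mono powr_mono2\<close>)
  have "integral\<^sup>L lborel ?U = (\<Prod>i\<in>UNIV. LBINT t. norm (u i t))"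
    by (intro integral_prod_vec integrable_norm u)
  also have "\<dots> \<le> (\<Prod>i\<in>(UNIV::'d set). a)" by (intro prod_mono) (auto simp: u)
  finally have Z: "integral\<^sup>L lborel ?U \<le> a ^ CARD('d)" by simp
  have "norm (LBINT z. (\<Prod>i\<in>UNIV. u i (z $ i)) * G z) \<le> (LBINT z. ?U z * norm (G z))"
    by (rule order_trans[OF integral_norm_bound]) (simp add: norm_mult prod_norm)
  then have "norm (LBINT z. (\<Prod>i\<in>UNIV. u i (z $ i)) * G z) powr p \<le> (LBINT z. ?U z * norm (G z)) powr p"
    using p by (intro powr_mono2) auto
  also have "\<dots> \<le> (a ^ CARD('d)) powr (p - 1) * (LBINT z. ?U z * norm (G z) powr p)"
    by (rule powr_integral_le[OF p U i2 i1 U0 _ Z]) (use a in auto)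
  finally show "norm (LBINT z. (\<Prod>i\<in>UNIV. u i (z $ i)) * G z) powr p
      \<le> (a ^ CARD('d)) powr (p - 1) * (LBINT z. ?U z * norm (G z) powr p)" .
qed

section \<open>Building blocks\<close>

context resolution
begin

text \<open>The support of \<phi>_n reaches up to 2^(n+1), while \<open>low_pass 0 N\<close> is 1
  strictly below 2^N; the index n + 2 leaves room between the two.\<close>

lemma phi_low_pass: "\<phi> n x * low_pass 0 (n + 2) x = \<phi> n x"
proof (cases "\<bar>x\<bar> < 2 ^ (n + 2)")
  case False
  then have "\<bar>x\<bar> > 2 ^ (n + 1)"
    using power_strict_increasing[of "n + 1" "n + 2" "2::real"] by linarith
  then show ?thesis by (simp add: phi_zero_above)
qed (simp add: low_pass_one)

lemma phi_eq_low_pass: "\<phi> n x = (if n = 0 then low_pass 0 0 x else low_pass 0 n x - low_pass 0 (n - 1) x)"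
  by (cases n) (auto simp: low_pass_def iter_deriv_0)

lemma phi_integrable: "integrable lborel (\<phi> n)"
proof -
  have "\<phi> n = (if n = 0 then low_pass 0 0 else (\<lambda>x. low_pass 0 n x - low_pass 0 (n - 1) x))"
    by (rule ext) (simp add: phi_eq_low_pass)
  then show ?thesis by (auto intro: low_pass_integrable)
qed

lemma phi_measurable [measurable]: "\<phi> n \<in> borel_measurable borel"
  using phi_integrable[of n] by simp

lemma K_measurable [measurable]: "K N \<in> borel_measurable borel"
  using K_integrable by simp

lemma K_shift_transform: "(LBINT z. K N (x - z) * cis (\<xi> * z)) = cis (\<xi> * x) * low_pass 0 N \<xi>"
proof -
  have "(LBINT z. K N (x - z) * cis (\<xi> * z)) = \<bar>-1\<bar> *\<^sub>R (LBINT z. K N (x - (x + (-1) * z)) * cis (\<xi> * (x + (-1) * z)))"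
    by (rule lborel_integral_real_affine) simp
  also have "\<dots> = (LBINT z. cis (\<xi> * x) * (K N z * cis (- (\<xi> * z))))"
  proof -
    have "cis (\<xi> * (x + (-1) * z)) = cis (\<xi> * x) * cis (- (\<xi> * z))" for z
      by (simp add: cis_mult right_diff_distrib)
    then show ?thesis by (simp add: mult_ac)
  qed
  also have "\<dots> = cis (\<xi> * x) * low_pass 0 N \<xi>"
    by (simp only: integral_mult_right_zero K_inversion)
  finally show ?thesis .
qed

end

text \<open>Integrability refers to \<open>lborel\<close>, so g is Borel measurable; a general
  Lebesgue representative is replaced by a Borel one before this locale is entered.\<close>

locale besov_function = resolution \<phi> for \<phi> +
  fixes g :: "real^'d \<Rightarrow> complex" and p :: real
  assumes g_integrable: "integrable lborel g" and p: "1 \<le> p" and g_SB: "g \<in> SB \<phi> (1/p) p 1"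
begin

abbreviation "block l \<equiv> dyadic_block \<phi> g l"

abbreviation "besov_term l \<equiv> SB_terms \<phi> (1/p) p 1 g l"

lemma g_measurable [measurable]: "g \<in> borel_measurable borel"
  using g_integrable by simp

lemma Fg_measurable [measurable]: "fourier g \<in> borel_measurable borel"
  by (rule fourier_measurable) simp

lemma block_eq:
  "block l x = fourier_const TYPE('d) * (LBINT \<xi>. (\<Prod>i\<in>UNIV. \<phi> (l i) (\<xi> $ i)) * fourier g \<xi> * cis (\<xi> \<bullet> x))"
  unfolding dyadic_block_def by (rule inv_fourier_eq) measurable

lemma symbol_integrable: "integrable lborel (\<lambda>\<xi>. (\<Prod>i\<in>UNIV. \<phi> (l i) (\<xi> $ i)) * fourier g \<xi>)"
proof -
  obtain B where B: "B \<ge> 0" "\<And>\<xi>. norm (fourier g \<xi>) \<le> B" using fourier_bounded[OF g_integrable] by blast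
  show ?thesis
  proof (rule integrable_dominated)
    show "integrable lborel (\<lambda>\<xi>::real^'d. norm (\<Prod>i\<in>UNIV. \<phi> (l i) (\<xi> $ i)) * B)"
      by (intro integrable_mult_left integrable_norm integrable_prod_vec phi_integrable)
    show "norm ((\<Prod>i\<in>UNIV. \<phi> (l i) (\<xi> $ i)) * fourier g \<xi>) \<le> norm (\<Prod>i\<in>UNIV. \<phi> (l i) (\<xi> $ i)) * B" for \<xi>
      unfolding norm_mult by (intro mult_left_mono B) auto
  qed measurable
qed

lemma block_continuous: "continuous_on A (block l)"
proof (rule continuous_on_subset)
  show "continuous_on UNIV (block l)"
  proof (rule continuous_at_imp_continuous_on, rule ballI, unfold continuous_at_sequentially, intro allI impI)
    fix x :: "real^'d" and X :: "nat \<Rightarrow> real^'d" assume X: "X \<longlonglongrightarrow> x"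
    have "(\<lambda>n. LBINT \<xi>. (\<Prod>i\<in>UNIV. \<phi> (l i) (\<xi> $ i)) * fourier g \<xi> * cis (\<xi> \<bullet> X n))
        \<longlonglongrightarrow> (LBINT \<xi>. (\<Prod>i\<in>UNIV. \<phi> (l i) (\<xi> $ i)) * fourier g \<xi> * cis (\<xi> \<bullet> x))"
    proof (rule integral_dominated_convergence[where w="\<lambda>\<xi>. norm ((\<Prod>i\<in>UNIV. \<phi> (l i) (\<xi> $ i)) * fourier g \<xi>)"])
      show "AE \<xi> in lborel. (\<lambda>n. (\<Prod>i\<in>UNIV. \<phi> (l i) (\<xi> $ i)) * fourier g \<xi> * cis (\<xi> \<bullet> X n))
          \<longlonglongrightarrow> (\<Prod>i\<in>UNIV. \<phi> (l i) (\<xi> $ i)) * fourier g \<xi> * cis (\<xi> \<bullet> x)"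
        by (intro AE_I2 tendsto_intros X)
    qed (use integrable_norm[OF symbol_integrable[of l]] in \<open>auto simp: norm_mult\<close>)
    then show "(block l \<circ> X) \<longlonglongrightarrow> block l x"
      unfolding block_eq o_def by (intro tendsto_intros)
  qed
qed simp

lemma block_measurable [measurable]: "block l \<in> borel_measurable borel"
  by (intro borel_measurable_continuous_onI block_continuous)

lemma block_bounded: "\<exists>B\<ge>0. \<forall>x. norm (block l x) \<le> B"
proof (intro exI conjI allI)
  let ?I = "\<integral>\<xi>. norm ((\<Prod>i\<in>UNIV. \<phi> (l i) (\<xi> $ i)) * fourier g \<xi>) \<partial>lborel"
  fix x
  have "norm (LBINT \<xi>. (\<Prod>i\<in>UNIV. \<phi> (l i) (\<xi> $ i)) * fourier g \<xi> * cis (\<xi> \<bullet> x)) \<le> ?I"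
    by (rule order_trans[OF integral_norm_bound]) (simp add: norm_mult)
  then show "norm (block l x) \<le> fourier_const TYPE('d) * ?I"
    using fourier_const_pos[of "TYPE('d)"] by (simp add: block_eq norm_mult abs_of_pos)
qed (use fourier_const_pos in \<open>auto intro!: mult_nonneg_nonneg intro: less_imp_le\<close>)

text \<open>Convolving a plane wave with K multiplies it by the low-pass symbol, which is 1 on the
  frequencies of the block. The block is a superposition of plane waves with integrable symbol, so
  Fubini applies.\<close>

lemma block_reproducing:
  "block l x = (LBINT z. (\<Prod>i\<in>UNIV. K (l i + 2) (x $ i - z $ i)) * block l z)"
proof -
  let ?c = "complex_of_real (fourier_const TYPE('d))"
  let ?a = "\<lambda>\<xi>. (\<Prod>i\<in>UNIV. \<phi> (l i) (\<xi> $ i)) * fourier g \<xi>"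
  let ?K = "\<lambda>z::real^'d. \<Prod>i\<in>UNIV. K (l i + 2) (x $ i - z $ i)"
  have iK: "integrable lborel ?K" by (intro integrable_prod_vec K_shift_integrable)
  have "(LBINT z. ?K z * block l z) = (LBINT z. ?c * (LBINT \<xi>. ?a \<xi> * (?K z * cis (\<xi> \<bullet> z))))"
  proof (intro Bochner_Integration.integral_cong refl)
    fix z
    have "?K z * block l z = ?c * (?K z * (LBINT \<xi>. ?a \<xi> * cis (\<xi> \<bullet> z)))"
      unfolding block_eq by (simp only: mult_ac)
    also have "?K z * (LBINT \<xi>. ?a \<xi> * cis (\<xi> \<bullet> z)) = (LBINT \<xi>. ?a \<xi> * (?K z * cis (\<xi> \<bullet> z)))"
      unfolding integral_mult_right_zero[symmetric] by (simp only: mult_ac)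
    finally show "?K z * block l z = ?c * (LBINT \<xi>. ?a \<xi> * (?K z * cis (\<xi> \<bullet> z)))" .
  qed
  also have "\<dots> = ?c * (LBINT z. (LBINT \<xi>. ?a \<xi> * (?K z * cis (\<xi> \<bullet> z))))"
    by (rule integral_mult_right_zero)
  also have "(LBINT z. (LBINT \<xi>. ?a \<xi> * (?K z * cis (\<xi> \<bullet> z))))
      = (LBINT \<xi>. (LBINT z. ?a \<xi> * (?K z * cis (\<xi> \<bullet> z))))"
  proof (rule fubini_dominated[where a="\<lambda>z. norm (?K z)" and b="\<lambda>\<xi>. norm (?a \<xi>)"])
    show "(\<lambda>(z, \<xi>). ?a \<xi> * (?K z * cis (\<xi> \<bullet> z))) \<in> borel_measurable borel"
      unfolding borel_prod[symmetric] by measurable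
    show "norm (?a \<xi> * (?K z * cis (\<xi> \<bullet> z))) \<le> norm (?K z) * norm (?a \<xi>)" for z \<xi>
      by (simp add: norm_mult)
  qed (intro integrable_norm iK symbol_integrable)+
  also have "\<dots> = (LBINT \<xi>. ?a \<xi> * cis (\<xi> \<bullet> x))"
  proof (intro Bochner_Integration.integral_cong refl)
    fix \<xi> :: "real^'d"
    have i: "integrable lborel (\<lambda>z. K (l i + 2) (x $ i - z) * cis (\<xi> $ i * z))" for i
      by (rule integrable_dominated[OF integrable_norm[OF K_shift_integrable[of "l i + 2" "x $ i"]]]) (auto simp: norm_mult)
    have "(LBINT z. ?a \<xi> * (?K z * cis (\<xi> \<bullet> z)))
        = ?a \<xi> * (LBINT z. (\<Prod>i\<in>UNIV. K (l i + 2) (x $ i - z $ i) * cis (\<xi> $ i * z $ i)))"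
      unfolding integral_mult_right_zero by (simp only: cis_inner prod.distrib)
    also have "integral\<^sup>L lborel (\<lambda>z::real^'d. \<Prod>i\<in>UNIV. K (l i + 2) (x $ i - z $ i) * cis (\<xi> $ i * z $ i))
        = (\<Prod>i\<in>UNIV. LBINT z. K (l i + 2) (x $ i - z) * cis (\<xi> $ i * z))"
      by (rule integral_prod_vec[OF i])
    also have "\<dots> = cis (\<xi> \<bullet> x) * (\<Prod>i\<in>UNIV. low_pass 0 (l i + 2) (\<xi> $ i))"
      by (simp only: K_shift_transform prod.distrib cis_inner)
    also have "?a \<xi> * (cis (\<xi> \<bullet> x) * (\<Prod>i\<in>UNIV. low_pass 0 (l i + 2) (\<xi> $ i)))
        = (\<Prod>i\<in>UNIV. \<phi> (l i) (\<xi> $ i) * low_pass 0 (l i + 2) (\<xi> $ i)) * fourier g \<xi> * cis (\<xi> \<bullet> x)"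
      by (simp only: prod.distrib mult_ac)
    finally show "(LBINT z. ?a \<xi> * (?K z * cis (\<xi> \<bullet> z))) = ?a \<xi> * cis (\<xi> \<bullet> x)"
      by (simp only: phi_low_pass)
  qed
  also have "?c * \<dots> = block l x" by (rule block_eq[symmetric])
  finally show ?thesis by (rule sym)
qed

lemma block_Lp: "integrable lborel (\<lambda>x. norm (block l x) powr p)"
proof -
  have "in_Lp p UNIV (block l)" using g_SB by (simp add: SB_def)
  then have "integrable lebesgue (\<lambda>x. norm (block l x) powr p)"
    by (simp add: in_Lp_def set_integrable_def)
  then show ?thesis by (subst (asm) integrable_completion) auto
qed

lemma besov_term_nonneg: "besov_term l \<ge> 0"
  by (simp add: SB_terms_def)

lemma besov_term_summable: "besov_term summable_on UNIV"
  using g_SB by (simp add: SB_def)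

text \<open>For r = 1/p and q = 1 the p-th power of a term is the combination that the coefficient
  estimate of a block produces.\<close>

lemma besov_term_powr: "besov_term l powr p = 2 ^ (\<Sum>i\<in>UNIV. l i) * (LBINT x. norm (block l x) powr p)"
proof -
  let ?I = "\<integral>x. norm (block l x) powr p \<partial>lborel"
  have "(LINT x:UNIV|lebesgue. norm (block l x) powr p) = ?I"
    unfolding set_lebesgue_integral_def by (subst integral_completion) auto
  then have "besov_term l = 2 powr (real (\<Sum>i\<in>UNIV. l i) / p) * ?I powr (1 / p)"
    by (simp add: SB_terms_def Lp_norm_def)
  moreover have "?I \<ge> 0" by (intro Bochner_Integration.integral_nonneg) auto
  ultimately have "besov_term l powr p = 2 powr real (\<Sum>i\<in>UNIV. l i) * ?I"
    using p by (simp add: powr_mult powr_powr)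
  then show ?thesis by (simp only: powr_realpow zero_less_numeral)
qed

lemma faber_coeff_block:
  "faber_coeff (block l) j k = (LBINT z. (\<Prod>i\<in>UNIV. diff_kernel (l i + 2) (j i) (k i) (z $ i)) * block l z)"
proof -
  let ?n = "\<lambda>s i. node (j i) (k i) (s i)"
  obtain B where B: "B \<ge> 0" "\<And>x. norm (block l x) \<le> B" using block_bounded[of l] by blast
  have i: "integrable lborel (\<lambda>z. (\<Prod>i\<in>UNIV. K (l i + 2) (?n s i - z $ i)) * block l z)" for s
    by (rule integrable_dominated[OF integrable_mult_left[OF integrable_norm[OF integrable_prod_vec[OF K_shift_integrable]], where c=B]])
      (auto simp: norm_mult intro!: mult_left_mono B)
  have "faber_coeff (block l) j k = (\<Sum>s | \<forall>i. s i \<in> {..<3}. (\<Prod>i\<in>UNIV. weight (j i) (s i)) *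
     (LBINT z. (\<Prod>i\<in>UNIV. K (l i + 2) (?n s i - z $ i)) * block l z))"
    unfolding faber_coeff_expand by (subst block_reproducing) simp
  also have "\<dots> = (LBINT z. (\<Sum>s | \<forall>i. s i \<in> {..<3}. (\<Prod>i\<in>UNIV. weight (j i) (s i)) *
     ((\<Prod>i\<in>UNIV. K (l i + 2) (?n s i - z $ i)) * block l z)))"
    using i by (subst Bochner_Integration.integral_sum) auto
  also have "\<dots> = (LBINT z. (\<Prod>i\<in>UNIV. diff_kernel (l i + 2) (j i) (k i) (z $ i)) * block l z)"
  proof (intro Bochner_Integration.integral_cong refl)
    fix z :: "real^'d"
    have "(\<Sum>s | \<forall>i. s i \<in> {..<3}. (\<Prod>i\<in>UNIV. weight (j i) (s i)) * ((\<Prod>i\<in>UNIV. K (l i + 2) (?n s i - z $ i)) * block l z))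
        = (\<Sum>s | \<forall>i. s i \<in> {..<3}. \<Prod>i\<in>UNIV. weight (j i) (s i) * K (l i + 2) (?n s i - z $ i)) * block l z"
      unfolding sum_distrib_right prod.distrib by (simp only: mult.assoc)
    also have "(\<Sum>s | \<forall>i. s i \<in> {..<3}. \<Prod>i\<in>UNIV. weight (j i) (s i) * K (l i + 2) (?n s i - z $ i))
        = (\<Prod>i\<in>UNIV. diff_kernel (l i + 2) (j i) (k i) (z $ i))"
      unfolding diff_kernel_def
      by (rule sum_prod_fun_set[where f="\<lambda>i s. weight (j i) s * K (l i + 2) (node (j i) (k i) s - z $ i)"]) simp
    finally show "(\<Sum>s | \<forall>i. s i \<in> {..<3}. (\<Prod>i\<in>UNIV. weight (j i) (s i)) * ((\<Prod>i\<in>UNIV. K (l i + 2) (?n s i - z $ i)) * block l z))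
        = (\<Prod>i\<in>UNIV. diff_kernel (l i + 2) (j i) (k i) (z $ i)) * block l z" .
  qed
  finally show ?thesis .
qed

text \<open>The first factor is the Hoelder constant for kernels of L1 norm at most 2 * K_const. The
  second is the product over the coordinates of 2 * K_const * 2^(l_i + 2) with 2^|l|
  removed.\<close>

definition block_const :: real where
  "block_const = ((2 * K_const) ^ CARD('d)) powr (p - 1) * (8 * K_const) ^ CARD('d)"

lemma block_const_pos: "block_const > 0"
  using K_const_pos by (simp add: block_const_def)

lemma power_sum_levels: "(\<Prod>i\<in>(UNIV::'d set). 2 * K_const * 2 ^ (l i + 2)) = (8 * K_const) ^ CARD('d) * 2 ^ (\<Sum>i\<in>UNIV. l i)"
proof -
  have "(\<Prod>i\<in>(UNIV::'d set). 2 * K_const * 2 ^ (l i + 2)) = (\<Prod>i\<in>UNIV. (8 * K_const) * 2 ^ (l i))"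
    by (intro prod.cong) auto
  then show ?thesis by (simp only: prod.distrib prod_constant power_sum power_mult_distrib)
qed

text \<open>A Schur-type argument: Hoelder in z uses the L1 norm of each kernel, and the sum over k,
  taken under the integral, uses the bound of all kernels together at one point. The latter gives
  the factor 2^|l| whatever j is.\<close>

lemma faber_coeff_block_bound:
  assumes j: "\<And>i. j i \<ge> -1"
  shows "(\<Sum>k\<in>shift_set j. norm (faber_coeff (block l) j k) powr p) \<le> block_const * besov_term l powr p"
proof -
  let ?D = "\<lambda>k z. \<Prod>i\<in>(UNIV::'d set). norm (diff_kernel (l i + 2) (j i) (k i) (z $ i))"
  let ?S = "shift_set j"
  let ?a = "((2 * K_const) ^ CARD('d)) powr (p - 1)"
  obtain B where B: "B \<ge> 0" "\<And>x. norm (block l x) \<le> B" using block_bounded[of l] by blast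
  note est = norm_tensor_integral_powr_le[OF p diff_kernel_integrable diff_kernel_L1 _ block_measurable B(2)]
  have pos2: "2 * K_const > 0" using K_const_pos by simp
  have "(\<Sum>k\<in>?S. norm (faber_coeff (block l) j k) powr p) \<le> (\<Sum>k\<in>?S. ?a * (LBINT z. ?D k z * norm (block l z) powr p))"
    unfolding faber_coeff_block by (intro sum_mono est(2) pos2)
  also have "\<dots> = ?a * (LBINT z. (\<Sum>k\<in>?S. ?D k z) * norm (block l z) powr p)"
    unfolding sum_distrib_right
    by (subst Bochner_Integration.integral_sum) (auto simp: sum_distrib_left intro!: est(1) pos2)
  also have "\<dots> \<le> ?a * (LBINT z. ((8 * K_const) ^ CARD('d) * 2 ^ (\<Sum>i\<in>UNIV. l i)) * norm (block l z) powr p)"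
  proof (intro mult_left_mono integral_mono)
    show "integrable lborel (\<lambda>z. (\<Sum>k\<in>?S. ?D k z) * norm (block l z) powr p)"
      unfolding sum_distrib_right by (intro Bochner_Integration.integrable_sum est(1) pos2)
    show "(\<Sum>k\<in>?S. ?D k z) * norm (block l z) powr p \<le> ((8 * K_const) ^ CARD('d) * 2 ^ (\<Sum>i\<in>UNIV. l i)) * norm (block l z) powr p" for z
    proof (rule mult_right_mono)
      have "(\<Sum>k\<in>?S. ?D k z) = (\<Prod>i\<in>UNIV. \<Sum>k\<in>dyadic_shifts (j i). norm (diff_kernel (l i + 2) (j i) k (z $ i)))"
        by (rule sum_prod_fun_set[where f="\<lambda>i k. norm (diff_kernel (l i + 2) (j i) k (z $ i))"]) simp
      also have "\<dots> \<le> (\<Prod>i\<in>UNIV. 2 * K_const * 2 ^ (l i + 2))"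
        by (intro prod_mono conjI diff_kernel_sum j sum_nonneg) auto
      finally show "(\<Sum>k\<in>?S. ?D k z) \<le> (8 * K_const) ^ CARD('d) * 2 ^ (\<Sum>i\<in>UNIV. l i)"
        by (simp only: power_sum_levels)
    qed simp
  qed (auto intro!: integrable_mult_right block_Lp)
  also have "\<dots> = block_const * besov_term l powr p" by (simp add: block_const_def besov_term_powr)
  finally show ?thesis .
qed

text \<open>Nikolskii's inequality: passing from L^p to the sup norm costs 2^(|l|/p). The route is
  that of the coefficient bound, with translates of K in place of the difference kernels.\<close>

lemma block_sup_bound: "norm (block l x) \<le> block_const powr (1 / p) * besov_term l"
proof -
  let ?D = "\<lambda>z. \<Prod>i\<in>(UNIV::'d set). norm (K (l i + 2) (x $ i - z $ i))"
  let ?a = "((2 * K_const) ^ CARD('d)) powr (p - 1)"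
  obtain B where B: "B \<ge> 0" "\<And>x. norm (block l x) \<le> B" using block_bounded[of l] by blast
  \<comment> \<open>The L1 bound is relaxed to 2 * K_const so that the same
    \<open>block_const\<close> serves here.\<close>
  have L1: "(LBINT y. norm (K N (s - y))) \<le> 2 * K_const" for N s
    using K_shift_L1[of N s] K_const_pos by simp
  note est = norm_tensor_integral_powr_le[OF p K_shift_integrable L1 _ block_measurable B(2)]
  have pos2: "2 * K_const > 0" using K_const_pos by simp
  have "norm (block l x) powr p \<le> ?a * (LBINT z. ?D z * norm (block l z) powr p)"
    by (subst block_reproducing) (intro est(2) pos2)
  also have "\<dots> \<le> ?a * (LBINT z. ((8 * K_const) ^ CARD('d) * 2 ^ (\<Sum>i\<in>UNIV. l i)) * norm (block l z) powr p)"
  proof (intro mult_left_mono integral_mono est(1) pos2)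
    show "?D z * norm (block l z) powr p \<le> ((8 * K_const) ^ CARD('d) * 2 ^ (\<Sum>i\<in>UNIV. l i)) * norm (block l z) powr p" for z
    proof (rule mult_right_mono)
      have *: "norm (K N s) \<le> 2 * K_const * 2 ^ N" for N s
        by (rule order_trans[OF K_sup]) (use K_const_pos in simp)
      have "?D z \<le> (\<Prod>i\<in>UNIV. 2 * K_const * 2 ^ (l i + 2))"
        by (intro prod_mono conjI *) auto
      then show "?D z \<le> (8 * K_const) ^ CARD('d) * 2 ^ (\<Sum>i\<in>UNIV. l i)"
        by (simp only: power_sum_levels)
    qed simp
  qed (auto intro!: integrable_mult_right block_Lp)
  also have "\<dots> = block_const * besov_term l powr p" by (simp add: block_const_def besov_term_powr)
  finally have "(norm (block l x) powr p) powr (1 / p) \<le> (block_const * besov_term l powr p) powr (1 / p)"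
    using p by (intro powr_mono2) auto
  then show ?thesis using p block_const_pos besov_term_nonneg[of l] by (simp add: powr_powr powr_mult)
qed

end

section \<open>Identification of the sum of the blocks\<close>

text \<open>Discards the points on the faces of a box, which \<open>K_interval_tendsto\<close>
  excludes.\<close>

lemma AE_nth_neq: "AE x in lborel. (x :: real^'d) $ i \<noteq> c"
proof -
  have "negligible {x :: real^'d. x $ i = c}"
    unfolding cart_eq_inner_axis by (rule negligible_standard_hyperplane) simp
  then have "{x :: real^'d. x $ i = c} \<in> null_sets (completion lborel)"
    by (simp add: negligible_iff_null_sets)
  moreover have "closed {x :: real^'d. x $ i = c}"
    by (intro closed_Collect_eq continuous_intros)
  ultimately have "{x :: real^'d. x $ i = c} \<in> null_sets lborel"
    by (subst (asm) null_sets_completion_iff) auto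
  then show ?thesis by (rule AE_I') auto
qed

definition box_indicator :: "('d::finite \<Rightarrow> real) \<Rightarrow> ('d \<Rightarrow> real) \<Rightarrow> real^'d \<Rightarrow> real" where
  "box_indicator a b x = (\<Prod>i\<in>UNIV. indicator {a i..b i} (x $ i))"

lemma box_indicator_eq: "box_indicator a b x = (if \<forall>i. a i \<le> x $ i \<and> x $ i \<le> b i then 1 else 0)"
proof (cases "\<forall>i. a i \<le> x $ i \<and> x $ i \<le> b i")
  case False
  then obtain i where "x $ i \<notin> {a i..b i}" by auto
  then have "box_indicator a b x = 0"
    unfolding box_indicator_def by (intro prod_zero bexI[of _ i]) (simp_all add: indicator_def)
  then show ?thesis using False by simp
qed (simp add: box_indicator_def)

lemma
  assumes "\<And>i. a i \<le> b i"
  shows box_indicator_integrable: "integrable lborel (box_indicator a b)"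
    and box_indicator_integral: "integral\<^sup>L lborel (box_indicator a b) = (\<Prod>i\<in>UNIV. b i - a i)"
proof -
  have i: "integrable lborel (indicator {a i..b i} :: real \<Rightarrow> real)" for i
    by (intro integrable_real_indicator) (use assms in auto)
  show "integrable lborel (box_indicator a b)"
    unfolding box_indicator_def[abs_def] by (rule integrable_prod_vec[OF i])
  show "integral\<^sup>L lborel (box_indicator a b) = (\<Prod>i\<in>UNIV. b i - a i)"
    unfolding box_indicator_def[abs_def] integral_prod_vec[OF i] using assms by simp
qed

lemma box_indicator_measurable [measurable]: "box_indicator a b \<in> borel_measurable borel"
  unfolding box_indicator_def[abs_def] by measurable

text \<open>Cubes exhaust all multi-indices, and over a cube the block symbols add up to a product
  of low-pass symbols.\<close>

definition frequency_box :: "nat \<Rightarrow> ('d \<Rightarrow> nat) set" where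
  "frequency_box N = {l. \<forall>i. l i \<in> {..N}}"

lemma finite_frequency_box: "finite (frequency_box N :: ('d::finite \<Rightarrow> nat) set)"
  unfolding frequency_box_def by (rule finite_fun_set) simp

text \<open>Turns unordered summation into a limit along a sequence, as dominated convergence
  requires.\<close>

lemma filterlim_frequency_box:
  "filterlim (frequency_box :: nat \<Rightarrow> ('d::finite \<Rightarrow> nat) set) (finite_subsets_at_top UNIV) sequentially"
  unfolding filterlim_finite_subsets_at_top
proof (intro allI impI)
  fix X :: "('d \<Rightarrow> nat) set" assume X: "finite X \<and> X \<subseteq> UNIV"
  have "l \<in> frequency_box N" if "l \<in> X" "N \<ge> (\<Sum>l\<in>X. \<Sum>i\<in>UNIV. l i)" for l N
  proof -
    have "l i \<le> (\<Sum>l\<in>X. \<Sum>i\<in>UNIV. l i)" for i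
      using member_le_sum[of l X "\<lambda>l. \<Sum>i\<in>UNIV. l i"] member_le_sum[of i UNIV l] X that by fastforce
    then show ?thesis using that by (auto simp: frequency_box_def intro: order_trans)
  qed
  then show "\<forall>\<^sub>F N in sequentially. finite (frequency_box N :: ('d \<Rightarrow> nat) set) \<and> X \<subseteq> frequency_box N \<and> frequency_box N \<subseteq> UNIV"
    by (intro eventually_sequentiallyI[of "\<Sum>l\<in>X. \<Sum>i\<in>UNIV. l i"]) (auto simp: finite_frequency_box)
qed

section \<open>Summation of the blocks and comparison with g\<close>

context besov_function
begin

definition partial_sum :: "nat \<Rightarrow> real^'d \<Rightarrow> complex" where
  "partial_sum N x = (\<Sum>l\<in>frequency_box N. block l x)"

definition block_sum :: "real^'d \<Rightarrow> complex" where
  "block_sum x = (\<Sum>\<^sub>\<infinity>l. block l x)"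

text \<open>Nikolskii's inequality and the summable Besov terms give a Weierstrass majorant; this is
  the embedding into the continuous functions.\<close>

lemma partial_sum_uniform: "uniform_limit UNIV partial_sum block_sum sequentially"
proof -
  have "uniform_limit UNIV (\<lambda>X x. \<Sum>l\<in>X. block l x) (\<lambda>x. \<Sum>\<^sub>\<infinity>l. block l x) (finite_subsets_at_top UNIV)"
    by (rule Weierstrass_m_test_general[where M="\<lambda>l. block_const powr (1 / p) * besov_term l"])
      (auto intro: block_sup_bound summable_on_cmult_right besov_term_summable)
  then have "uniform_limit UNIV (\<lambda>N x. \<Sum>l\<in>frequency_box N. block l x) (\<lambda>x. \<Sum>\<^sub>\<infinity>l. block l x) sequentially"
    by (rule filterlim_compose[OF _ filterlim_frequency_box])
  then show ?thesis unfolding partial_sum_def[abs_def] block_sum_def[abs_def] .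
qed

lemma partial_sum_continuous: "continuous_on A (partial_sum N)"
  unfolding partial_sum_def[abs_def] by (intro continuous_intros block_continuous)

lemma block_sum_continuous: "continuous_on A block_sum"
proof (rule continuous_on_subset)
  show "continuous_on UNIV block_sum"
    by (rule uniform_limit_theorem[OF _ partial_sum_uniform])
      (auto intro: always_eventually partial_sum_continuous)
qed simp

lemma partial_sum_measurable [measurable]: "partial_sum N \<in> borel_measurable borel"
  by (intro borel_measurable_continuous_onI partial_sum_continuous)

lemma block_sum_measurable [measurable]: "block_sum \<in> borel_measurable borel"
  by (intro borel_measurable_continuous_onI block_sum_continuous)

text \<open>The symbols of a cube of frequencies add up to a product of low-pass symbols, so the
  partial sum is g smoothed by a tensor product approximate identity.\<close>

lemma partial_sum_convolution:
  "partial_sum N x = (LBINT y. (\<Prod>i\<in>UNIV. K N (x $ i - y $ i)) * g y)"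
proof -
  have "partial_sum N x = (\<Sum>l\<in>frequency_box N. fourier_const TYPE('d) *
      (LBINT \<xi>. (\<Prod>i\<in>UNIV. \<phi> (l i) (\<xi> $ i)) * fourier g \<xi> * cis (\<xi> \<bullet> x)))"
    unfolding partial_sum_def block_eq ..
  also have "\<dots> = fourier_const TYPE('d) *
      (LBINT \<xi>. (\<Sum>l\<in>frequency_box N. (\<Prod>i\<in>UNIV. \<phi> (l i) (\<xi> $ i)) * fourier g \<xi> * cis (\<xi> \<bullet> x)))"
  proof -
    have "integrable lborel (\<lambda>\<xi>. (\<Prod>i\<in>UNIV. \<phi> (l i) (\<xi> $ i)) * fourier g \<xi> * cis (\<xi> \<bullet> x))" for l
      by (rule integrable_dominated[OF integrable_norm[OF symbol_integrable[of l]]]) (auto simp: norm_mult)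
    then show ?thesis by (simp add: sum_distrib_left)
  qed
  also have "\<dots> = fourier_const TYPE('d) *
      (LBINT \<xi>. (\<Prod>i\<in>UNIV. low_pass 0 N (\<xi> $ i)) * fourier g \<xi> * cis (\<xi> \<bullet> x))"
  proof -
    have "(\<Sum>l\<in>frequency_box N. \<Prod>i\<in>UNIV. \<phi> (l i) (\<xi> $ i)) = (\<Prod>i\<in>UNIV. low_pass 0 N (\<xi> $ i))" for \<xi> :: "real^'d"
      unfolding frequency_box_def low_pass_def iter_deriv_0
      by (rule sum_prod_fun_set[where f="\<lambda>i n. \<phi> n (\<xi> $ i)"]) simp
    then show ?thesis by (simp only: sum_distrib_right[symmetric])
  qed
  also have "\<dots> = inv_fourier (\<lambda>\<xi>. (\<Prod>i\<in>UNIV. low_pass 0 N (\<xi> $ i)) * fourier g \<xi>) x"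
    by (rule inv_fourier_eq[symmetric]) measurable
  also have "\<dots> = (LBINT y. (\<Prod>i\<in>UNIV. K N (x $ i - y $ i)) * g y)"
    by (rule inv_fourier_tensor_fourier[OF g_integrable low_pass_integrable])
  finally show ?thesis .
qed

lemma partial_sum_box_integral:
  assumes "\<And>i. a i \<le> b i"
  shows "(LBINT x. box_indicator a b x * partial_sum N x)
    = (LBINT y. (\<Prod>i\<in>UNIV. LBINT t. indicator {a i..b i} t * K N (t - y $ i)) * g y)"
proof -
  have "(LBINT x. box_indicator a b x * partial_sum N x)
      = (LBINT x. (LBINT y. (\<Prod>i\<in>UNIV. indicator {a i..b i} (x $ i) * K N (x $ i - y $ i)) * g y))"
  proof (intro Bochner_Integration.integral_cong refl)
    fix x :: "real^'d"
    have *: "complex_of_real (box_indicator a b x) = (\<Prod>i\<in>UNIV. indicator {a i..b i} (x $ i))"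
      unfolding box_indicator_def of_real_prod by (intro prod.cong refl) (simp add: indicator_def)
    show "box_indicator a b x * partial_sum N x
        = (LBINT y. (\<Prod>i\<in>UNIV. indicator {a i..b i} (x $ i) * K N (x $ i - y $ i)) * g y)"
      unfolding partial_sum_convolution * prod.distrib mult.assoc integral_mult_right_zero ..
  qed
  also have "\<dots> = (LBINT y. (LBINT x. (\<Prod>i\<in>UNIV. indicator {a i..b i} (x $ i) * K N (x $ i - y $ i)) * g y))"
  proof (rule fubini_dominated[where a="\<lambda>x. (K_const * 2 ^ N) ^ CARD('d) * box_indicator a b x" and b="\<lambda>y. norm (g y)"])
    show "(\<lambda>(x, y). (\<Prod>i\<in>UNIV. indicator {a i..b i} (x $ i) * K N (x $ i - y $ i)) * g y) \<in> borel_measurable borel"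
      unfolding borel_prod[symmetric] by measurable
    show "norm ((\<Prod>i\<in>UNIV. indicator {a i..b i} (x $ i) * K N (x $ i - y $ i)) * g y)
        \<le> (K_const * 2 ^ N) ^ CARD('d) * box_indicator a b x * norm (g y)" for x y
    proof -
      have "norm (\<Prod>i\<in>UNIV. indicator {a i..b i} (x $ i) * K N (x $ i - y $ i))
          = (\<Prod>i\<in>UNIV. indicator {a i..b i} (x $ i) * norm (K N (x $ i - y $ i)))"
        unfolding prod_norm[symmetric] by (intro prod.cong refl) (simp add: norm_mult indicator_def)
      also have "\<dots> \<le> (\<Prod>i\<in>UNIV. indicator {a i..b i} (x $ i) * (K_const * 2 ^ N))"
        by (intro prod_mono conjI mult_left_mono K_sup mult_nonneg_nonneg) auto
      also have "\<dots> = (K_const * 2 ^ N) ^ CARD('d) * box_indicator a b x"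
        by (simp add: prod.distrib box_indicator_def)
      finally show ?thesis unfolding norm_mult by (intro mult_right_mono) auto
    qed
  qed (intro integrable_mult_right box_indicator_integrable integrable_norm g_integrable assms)+
  also have "\<dots> = (LBINT y. (\<Prod>i\<in>UNIV. LBINT t. indicator {a i..b i} t * K N (t - y $ i)) * g y)"
  proof (intro Bochner_Integration.integral_cong refl)
    fix y :: "real^'d"
    have i: "integrable lborel (\<lambda>t. indicator {a i..b i} t * K N (t - y $ i))" for i
    proof (rule integrable_dominated)
      show "integrable lborel (\<lambda>t. norm (K N (t - y $ i)))"
        using lborel_integrable_real_affine[OF K_integrable, of 1 N "- y $ i"] by (intro integrable_norm) simp
    qed (auto simp: indicator_def)
    show "(LBINT x. (\<Prod>i\<in>UNIV. indicator {a i..b i} (x $ i) * K N (x $ i - y $ i)) * g y)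
        = (\<Prod>i\<in>UNIV. LBINT t. indicator {a i..b i} t * K N (t - y $ i)) * g y"
      unfolding integral_mult_left_zero integral_prod_vec[OF i] ..
  qed
  finally show ?thesis .
qed

text \<open>By Fubini the box is smoothed instead of g. The smoothed indicator is bounded by
  K_const^d and converges off the hyperplanes through the faces, so a multiple of |g| is a
  majorant.\<close>

lemma partial_sum_box_tendsto:
  assumes ab: "\<And>i. a i \<le> b i"
  shows "(\<lambda>N. LBINT x. box_indicator a b x * partial_sum N x) \<longlonglongrightarrow> (LBINT x. box_indicator a b x * g x)"
  unfolding partial_sum_box_integral[OF ab]
proof (rule integral_dominated_convergence[where w="\<lambda>y. K_const ^ CARD('d) * norm (g y)"])
  have "AE y in lborel. \<forall>i. (y :: real^'d) $ i \<noteq> a i \<and> y $ i \<noteq> b i"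
    by (intro eventually_all_finite AE_conjI AE_nth_neq)
  then show "AE y in lborel. (\<lambda>N. (\<Prod>i\<in>UNIV. LBINT t. indicator {a i..b i} t * K N (t - y $ i)) * g y)
      \<longlonglongrightarrow> box_indicator a b y * g y"
  proof eventually_elim
    case (elim y)
    have *: "complex_of_real (box_indicator a b y) = (\<Prod>i\<in>UNIV. indicator {a i..b i} (y $ i))"
      unfolding box_indicator_def of_real_prod by (intro prod.cong refl) (simp add: indicator_def)
    show ?case unfolding * by (intro tendsto_intros K_interval_tendsto) (use elim in auto)
  qed
  show "AE y in lborel. norm ((\<Prod>i\<in>UNIV. LBINT t. indicator {a i..b i} t * K N (t - y $ i)) * g y)
      \<le> K_const ^ CARD('d) * norm (g y)" for N
  proof (rule AE_I2)
    fix y :: "real^'d"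
    have "norm (\<Prod>i\<in>UNIV. LBINT t. indicator {a i..b i} t * K N (t - y $ i)) \<le> (\<Prod>i\<in>(UNIV::'d set). K_const)"
      unfolding prod_norm[symmetric] by (intro prod_mono conjI K_interval_le) auto
    then show "norm ((\<Prod>i\<in>UNIV. LBINT t. indicator {a i..b i} t * K N (t - y $ i)) * g y)
      \<le> K_const ^ CARD('d) * norm (g y)"
      unfolding norm_mult by (intro mult_right_mono) auto
  qed
qed (auto intro!: integrable_mult_right integrable_norm g_integrable)

text \<open>One sequence with two limits: the box integrals of the partial sums tend to those of g,
  and by uniform convergence to those of \<open>block_sum\<close>.\<close>

lemma box_integral_block_sum:
  assumes ab: "\<And>i. a i \<le> b i"
  shows "(LBINT x. box_indicator a b x * g x) = (LBINT x. box_indicator a b x * block_sum x)"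
    and "integrable lborel (\<lambda>x. box_indicator a b x * block_sum x)"
proof -
  have int_box: "integrable lborel (box_indicator a b)" by (rule box_indicator_integrable[OF ab])
  have bound: "norm (partial_sum N x) \<le> block_const powr (1 / p) * (\<Sum>\<^sub>\<infinity>l. besov_term l)" for N x
  proof -
    have "norm (partial_sum N x) \<le> (\<Sum>l\<in>frequency_box N. block_const powr (1 / p) * besov_term l)"
      unfolding partial_sum_def by (intro sum_norm_le block_sup_bound)
    also have "\<dots> = block_const powr (1 / p) * (\<Sum>l\<in>frequency_box N. besov_term l)" by (rule sum_distrib_left[symmetric])
    also have "\<dots> \<le> block_const powr (1 / p) * (\<Sum>\<^sub>\<infinity>l. besov_term l)"
      by (intro mult_left_mono finite_sum_le_infsum besov_term_summable finite_frequency_box) (auto simp: besov_term_nonneg)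
    finally show ?thesis .
  qed
  have lim: "(\<lambda>N. partial_sum N x) \<longlonglongrightarrow> block_sum x" for x
    by (rule tendsto_uniform_limitI[OF partial_sum_uniform]) simp
  have w: "norm (complex_of_real (box_indicator a b x) * z) \<le> box_indicator a b x * c" if "norm z \<le> c" for x z c
    using that by (auto simp: box_indicator_eq)
  have conv: "(\<lambda>N. LBINT x. box_indicator a b x * partial_sum N x) \<longlonglongrightarrow> (LBINT x. box_indicator a b x * block_sum x)"
    by (rule integral_dominated_convergence[where w="\<lambda>x. box_indicator a b x * (block_const powr (1 / p) * (\<Sum>\<^sub>\<infinity>l. besov_term l))"])
      (auto intro!: AE_I2 tendsto_intros lim w bound integrable_mult_left int_box)
  show "(LBINT x. box_indicator a b x * g x) = (LBINT x. box_indicator a b x * block_sum x)"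
    by (rule LIMSEQ_unique[OF partial_sum_box_tendsto[OF ab] conv])
  have "norm (block_sum x) \<le> block_const powr (1 / p) * (\<Sum>\<^sub>\<infinity>l. besov_term l)" for x
    by (rule LIMSEQ_le_const2[OF tendsto_norm[OF lim]]) (use bound in auto)
  then show "integrable lborel (\<lambda>x. box_indicator a b x * block_sum x)"
    by (intro integrable_dominated[OF integrable_mult_left[OF int_box, where c="block_const powr (1 / p) * (\<Sum>\<^sub>\<infinity>l. besov_term l)"]] w) auto
qed

text \<open>Both sides are continuous on the cube and have equal averages over the boxes shrinking to \<open>x\<close>.\<close>

lemma eq_block_sum_on_cube:
  assumes cont: "continuous_on unit_cube f" and ae: "AE x in lebesgue. x \<in> unit_cube \<longrightarrow> g x = f x"
    and x: "x \<in> unit_cube"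
  shows "f x = block_sum x"
proof -
  let ?h = "\<lambda>z. f z - block_sum z"
  have "norm (?h x) \<le> e" if e: "e > 0" for e
  proof -
    have "continuous_on unit_cube ?h" by (intro continuous_intros cont block_sum_continuous)
    then obtain \<delta> where \<delta>: "\<delta> > 0" "\<And>z. z \<in> unit_cube \<Longrightarrow> dist z x < \<delta> \<Longrightarrow> dist (?h z) (?h x) < e"
      using x e unfolding continuous_on_iff by metis
    define r where "r = min 1 (\<delta> / (2 * CARD('d)))"
    have r: "0 < r" "r \<le> 1" "r * CARD('d) < \<delta>"
    proof -
      show "0 < r" "r \<le> 1" using \<delta> by (auto simp: r_def)
      have "r * CARD('d) \<le> \<delta> / (2 * CARD('d)) * CARD('d)" by (intro mult_right_mono) (auto simp: r_def)
      also have "\<dots> < \<delta>" using \<delta> by simp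
      finally show "r * CARD('d) < \<delta>" .
    qed
    \<comment> \<open>A cube of side r obtained by contracting towards x: it contains x and stays
      inside the unit cube even if x lies on the boundary.\<close>
    define a b where "a i = (1 - r) * x $ i" and "b i = (1 - r) * x $ i + r" for i
    have xi: "0 \<le> x $ i" "x $ i \<le> 1" for i using x by (auto simp: unit_cube_def)
    have ab: "a i \<le> b i" for i using r by (simp add: a_def b_def)
    have a0: "0 \<le> a i" and b1: "b i \<le> 1" for i
    proof -
      show "0 \<le> a i" using r xi by (simp add: a_def)
      have "(1 - r) * x $ i \<le> (1 - r) * 1" using r xi by (intro mult_left_mono) auto
      then show "b i \<le> 1" by (simp add: b_def)
    qed
    let ?I = "box_indicator a b"
    have near: "z \<in> unit_cube \<and> norm (?h z - ?h x) \<le> e" if "?I z \<noteq> 0" for z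
    proof -
      have z: "a i \<le> z $ i" "z $ i \<le> b i" for i using that by (auto simp: box_indicator_eq split: if_splits)
      have zc: "z \<in> unit_cube" using order_trans[OF a0 z(1)] order_trans[OF z(2) b1] by (auto simp: unit_cube_def)
      have "\<bar>z $ i - x $ i\<bar> \<le> r" for i
      proof -
        have "r * x $ i \<le> r" "0 \<le> r * x $ i" using r xi[of i] by (auto simp: mult_left_le)
        then show ?thesis using z[of i] by (simp add: a_def b_def algebra_simps abs_le_iff)
      qed
      then have "norm (z - x) \<le> (\<Sum>i\<in>(UNIV::'d set). r)"
        by (intro order_trans[OF norm_le_l1_cart] sum_mono) auto
      then have "dist z x < \<delta>" using r by (simp add: dist_norm mult.commute)
      then show ?thesis using \<delta>(2)[OF zc] zc by (simp add: dist_norm)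
    qed
    have g: "(LBINT z. ?I z * g z) = (LBINT z. ?I z * block_sum z)"
      by (rule box_integral_block_sum(1)[OF ab])
    have ae': "AE z in lborel. z \<in> unit_cube \<longrightarrow> g z = f z"
      using ae by (simp add: AE_completion_iff)
    have ig: "integrable lborel (\<lambda>z. ?I z * g z)"
      by (rule integrable_dominated[OF integrable_norm[OF g_integrable]]) (auto simp: box_indicator_eq)
    have ib: "integrable lborel (\<lambda>z. ?I z * block_sum z)" by (rule box_integral_block_sum(2)[OF ab])
    have iI: "integrable lborel ?I" by (rule box_indicator_integrable[OF ab])
    have "(LBINT z. ?I z * (g z - block_sum z)) = 0"
      using g ig ib by (simp add: right_diff_distrib)
    \<comment> \<open>The integral of g - \<open>block_sum\<close> over the box vanishes. As g = f
      almost everywhere there, only the oscillation of h near x remains.\<close>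
    then have "?h x * of_real (integral\<^sup>L lborel ?I) = (LBINT z. ?I z * ?h x) - (LBINT z. ?I z * (g z - block_sum z))"
      by (simp add: mult.commute)
    also have "\<dots> = (LBINT z. ?I z * ?h x - ?I z * (g z - block_sum z))"
      using ig ib iI
      by (intro Bochner_Integration.integral_diff[symmetric]) (auto simp: right_diff_distrib)
    finally have eq: "?h x * of_real (integral\<^sup>L lborel ?I) = (LBINT z. ?I z * ?h x - ?I z * (g z - block_sum z))" .
    have "norm (?h x * of_real (integral\<^sup>L lborel ?I)) \<le> (LBINT z. norm (?I z * ?h x - ?I z * (g z - block_sum z)))"
      unfolding eq by (rule integral_norm_bound)
    also have "\<dots> \<le> (LBINT z. ?I z * e)"
    proof (rule integral_mono_AE)
      have "integrable lborel (\<lambda>z. ?I z * ?h x - ?I z * (g z - block_sum z))"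
        using ig ib iI by (auto simp: right_diff_distrib)
      then show "integrable lborel (\<lambda>z. norm (?I z * ?h x - ?I z * (g z - block_sum z)))"
        by (rule integrable_norm)
      show "integrable lborel (\<lambda>z. ?I z * e)" by (intro integrable_mult_left box_indicator_integrable ab)
      show "AE z in lborel. norm (?I z * ?h x - ?I z * (g z - block_sum z)) \<le> ?I z * e"
        using ae'
      proof eventually_elim
        case (elim z)
        show ?case
        proof (cases "?I z = 0")
          case False
          then have "?I z = 1" by (simp add: box_indicator_eq split: if_splits)
          then show ?thesis using near[OF False] elim by (simp add: norm_minus_commute)
        qed simp
      qed
    qed
    also have "\<dots> = e * integral\<^sup>L lborel ?I" by simp
    finally have "norm (?h x) * \<bar>integral\<^sup>L lborel ?I\<bar> \<le> e * integral\<^sup>L lborel ?I"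
      by (simp only: norm_mult norm_of_real)
    moreover have "integral\<^sup>L lborel ?I > 0"
      unfolding box_indicator_integral[OF ab] by (intro prod_pos) (use r in \<open>auto simp: a_def b_def\<close>)
    ultimately show ?thesis by simp
  qed
  then have "norm (?h x) \<le> 0" using field_le_epsilon[of "norm (?h x)" 0] by simp
  then show ?thesis by simp
qed

end

section \<open>The error estimate\<close>

lemma node_in_unit_interval:
  assumes "j \<ge> -1" "k \<in> dyadic_shifts j" "s < 3"
  shows "0 \<le> node j k s" "node j k s \<le> 1"
proof -
  have "0 \<le> node j k s \<and> node j k s \<le> 1"
    using assms(1)
  proof (cases rule: level_cases)
    case 1
    then show ?thesis using assms by (auto simp: node_def dyadic_shifts_def)
  next
    case (2 n)
    then have "k < 2 ^ n" using assms by (simp add: dyadic_shifts_def)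
    then have "2 * k + s \<le> 2 ^ (n + 1)" using assms(3) by simp
    then have "real (2 * k + s) \<le> 2 ^ (n + 1)" by (metis of_nat_le_iff of_nat_numeral of_nat_power)
    then show ?thesis unfolding 2 node_nonneg_level by simp
  qed
  then show "0 \<le> node j k s" "node j k s \<le> 1" by auto
qed

section \<open>Coefficient bounds for the whole function\<close>

context besov_function
begin

text \<open>A coefficient samples finitely many points, all in the cube, where the partial sums
  converge to f.\<close>

lemma faber_coeff_tendsto:
  assumes f: "\<And>x. x \<in> unit_cube \<Longrightarrow> f x = block_sum x"
    and j: "\<And>i. j i \<ge> -1" and k: "\<And>i. k i \<in> dyadic_shifts (j i)"
  shows "(\<lambda>N. \<Sum>l\<in>frequency_box N. faber_coeff (block l) j k) \<longlonglongrightarrow> faber_coeff f j k"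
proof -
  have "(\<lambda>N. partial_sum N (\<chi> i. node (j i) (k i) (s i))) \<longlonglongrightarrow> f (\<chi> i. node (j i) (k i) (s i))"
    if "\<And>i. s i < 3" for s
  proof -
    have "(\<chi> i. node (j i) (k i) (s i)) \<in> unit_cube"
      using node_in_unit_interval[OF j k that] by (simp add: unit_cube_def)
    then show ?thesis using f tendsto_uniform_limitI[OF partial_sum_uniform] by simp
  qed
  then have "(\<lambda>N. faber_coeff (partial_sum N) j k) \<longlonglongrightarrow> faber_coeff f j k"
    unfolding faber_coeff_expand by (intro tendsto_sum tendsto_mult tendsto_const) auto
  moreover have "faber_coeff (partial_sum N) j k = (\<Sum>l\<in>frequency_box N. faber_coeff (block l) j k)" for N
    unfolding faber_coeff_expand partial_sum_def sum_distrib_left by (rule sum.swap)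
  ultimately show ?thesis by simp
qed

text \<open>The triangle inequality in l^p over the blocks, carried out as Jensen's inequality with
  the weights w = \<open>besov_term l\<close>. They match the block bound: w^(1-p) w^p = w, which is
  summable.\<close>

lemma faber_coeff_block_sum_bound:
  assumes j: "\<And>i. j i \<ge> -1" and fin: "finite L"
  shows "(\<Sum>k\<in>shift_set j. norm (\<Sum>l\<in>L. faber_coeff (block l) j k) powr p)
    \<le> block_const * (\<Sum>\<^sub>\<infinity>l. besov_term l) powr p"
proof -
  let ?S = "shift_set j"
  let ?T = "\<Sum>\<^sub>\<infinity>l. besov_term l"
  let ?d = "\<lambda>l k. faber_coeff (block l) j k"
  \<comment> \<open>The weights must be positive; blocks with vanishing Besov term have vanishing
    coefficients and drop out.\<close>
  define L' where "L' = {l \<in> L. besov_term l \<noteq> 0}"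
  have finS: "finite ?S" by (rule finite_fun_set) simp
  have fin': "finite L'" using fin by (simp add: L'_def)
  have T0: "?T \<ge> 0" by (intro infsum_nonneg besov_term_nonneg)
  have pos: "besov_term l > 0" if "l \<in> L'" for l using that besov_term_nonneg[of l] by (auto simp: L'_def)
  have zero: "?d l k = 0" if "besov_term l = 0" "k \<in> ?S" for l k
  proof -
    have "norm (?d l k) powr p \<le> (\<Sum>k\<in>?S. norm (?d l k) powr p)"
      by (rule member_le_sum[OF that(2) _ finS]) auto
    also have "\<dots> \<le> block_const * besov_term l powr p" by (rule faber_coeff_block_bound[OF j])
    finally show ?thesis using that p by simp
  qed
  have red: "(\<Sum>l\<in>L. ?d l k) = (\<Sum>l\<in>L'. ?d l k)" if "k \<in> ?S" for k
    by (intro sum.mono_neutral_right fin) (auto simp: L'_def zero that[simplified])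
  show ?thesis
  proof (cases "L' = {}")
    case True
    then have "(\<Sum>k\<in>?S. norm (\<Sum>l\<in>L. ?d l k) powr p) = 0" using red by (intro sum.neutral) auto
    then show ?thesis using block_const_pos by simp
  next
    case False
    have sumT: "sum besov_term L' \<le> ?T"
      by (intro finite_sum_le_infsum besov_term_summable fin') (auto simp: besov_term_nonneg)
    have "sum besov_term L' > 0" by (rule sum_pos[OF fin' False pos])
    then have Tpos: "?T > 0" using sumT by linarith
    have "(\<Sum>k\<in>?S. norm (\<Sum>l\<in>L. ?d l k) powr p) \<le> (\<Sum>k\<in>?S. ?T powr (p - 1) * (\<Sum>l\<in>L'. besov_term l powr (1 - p) * norm (?d l k) powr p))"
    proof (rule sum_mono)
      fix k assume k: "k \<in> ?S"
      have "norm (\<Sum>l\<in>L. ?d l k) powr p \<le> (\<Sum>l\<in>L'. norm (?d l k)) powr p"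
        unfolding red[OF k] using p by (intro powr_mono2 norm_sum) auto
      also have "\<dots> \<le> ?T powr (p - 1) * (\<Sum>l\<in>L'. besov_term l powr (1 - p) * norm (?d l k) powr p)"
        by (rule powr_sum_le_weighted[OF p fin' _ pos sumT Tpos]) auto
      finally show "norm (\<Sum>l\<in>L. ?d l k) powr p \<le> ?T powr (p - 1) * (\<Sum>l\<in>L'. besov_term l powr (1 - p) * norm (?d l k) powr p)" .
    qed
    also have "\<dots> = ?T powr (p - 1) * (\<Sum>l\<in>L'. besov_term l powr (1 - p) * (\<Sum>k\<in>?S. norm (?d l k) powr p))"
      unfolding sum_distrib_left by (rule sum.swap)
    also have "\<dots> \<le> ?T powr (p - 1) * (\<Sum>l\<in>L'. besov_term l powr (1 - p) * (block_const * besov_term l powr p))"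
      by (intro mult_left_mono sum_mono faber_coeff_block_bound j) auto
    also have "\<dots> = ?T powr (p - 1) * (\<Sum>l\<in>L'. block_const * besov_term l)"
    proof (rule arg_cong[where f="\<lambda>x. ?T powr (p - 1) * x"], rule sum.cong[OF refl])
      fix l assume "l \<in> L'"
      then have "besov_term l powr (1 - p) * besov_term l powr p = besov_term l" using pos[of l] by (simp flip: powr_add)
      then show "besov_term l powr (1 - p) * (block_const * besov_term l powr p) = block_const * besov_term l" by (simp only: mult.left_commute)
    qed
    also have "\<dots> = ?T powr (p - 1) * (block_const * sum besov_term L')" by (simp only: sum_distrib_left)
    also have "\<dots> \<le> ?T powr (p - 1) * (block_const * ?T)"
      using block_const_pos by (intro mult_left_mono sumT) auto
    also have "\<dots> = block_const * ?T powr p" using Tpos by (simp add: powr_diff)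
    finally show ?thesis .
  qed
qed

lemma faber_coeff_bound:
  assumes f: "\<And>x. x \<in> unit_cube \<Longrightarrow> f x = block_sum x" and j: "\<And>i. j i \<ge> -1"
  shows "(\<Sum>k\<in>shift_set j. norm (faber_coeff f j k) powr p)
    \<le> (block_const powr (1 / p) * (\<Sum>\<^sub>\<infinity>l. besov_term l)) powr p"
proof -
  have "(\<Sum>k\<in>shift_set j. norm (faber_coeff f j k) powr p) \<le> block_const * (\<Sum>\<^sub>\<infinity>l. besov_term l) powr p"
  proof (rule LIMSEQ_le_const2)
    show "(\<lambda>N. \<Sum>k\<in>shift_set j. norm (\<Sum>l\<in>frequency_box N. faber_coeff (block l) j k) powr p)
        \<longlonglongrightarrow> (\<Sum>k\<in>shift_set j. norm (faber_coeff f j k) powr p)"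
      using p by (intro tendsto_sum tendsto_powr' tendsto_norm tendsto_const faber_coeff_tendsto f j) auto
  qed (use faber_coeff_block_sum_bound[OF j finite_frequency_box] in auto)
  also have "\<dots> = (block_const powr (1 / p) * (\<Sum>\<^sub>\<infinity>l. besov_term l)) powr p"
    using p block_const_pos infsum_nonneg[of UNIV besov_term, OF besov_term_nonneg] by (simp add: powr_mult powr_powr)
  finally show ?thesis .
qed

end

section \<open>Borel representatives and passage to the norm on the cube\<close>

lemma completion_ex_borel_measurable_complex:
  fixes g :: "'a \<Rightarrow> complex"
  assumes "g \<in> borel_measurable (completion M)"
  shows "\<exists>g'\<in>borel_measurable M. (AE x in M. g x = g' x)"
proof -
  have "(\<lambda>x. Re (g x)) \<in> borel_measurable (completion M)" "(\<lambda>x. Im (g x)) \<in> borel_measurable (completion M)"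
    using assms by measurable
  then obtain u v where [measurable]: "u \<in> borel_measurable M" "v \<in> borel_measurable M"
    and uv: "AE x in M. Re (g x) = u x" "AE x in M. Im (g x) = v x"
    using completion_ex_borel_measurable_real by metis
  show ?thesis
  proof (intro bexI[of _ "\<lambda>x. of_real (u x) + \<i> * of_real (v x)"])
    show "AE x in M. g x = of_real (u x) + \<i> * of_real (v x)"
      using uv by eventually_elim (simp add: complex_eq_iff)
  qed measurable
qed

text \<open>The Fourier transform does not see null sets, so g and a Borel representative g' have
  identical blocks and Besov terms, and the results on Borel functions apply to g'.\<close>

lemma (in resolution) truncation_error_extension:
  fixes p :: real
  assumes p: "1 \<le> p"
  shows "\<exists>C>0. \<forall>n\<ge>1. \<forall>f g :: real^'d \<Rightarrow> complex.
     continuous_on unit_cube f \<longrightarrow> g \<in> SB_extensions \<phi> (1/p) p 1 f \<longrightarrow>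
     Lp_norm p unit_cube (\<lambda>x. f x - faber_truncation n f x)
       \<le> C * 2 powr (- real n / p) * real n ^ (CARD('d) - 1) * SB_norm \<phi> (1/p) p 1 g"
proof -
  obtain C where C: "C > 0 \<and> (\<forall>n\<ge>1. \<forall>S :: ('d \<Rightarrow> int) set. finite S \<longrightarrow>
     (\<forall>j\<in>S. (\<forall>i. j i \<ge> -1) \<and> (\<Sum>i\<in>UNIV. \<bar>j i\<bar>) > int n) \<longrightarrow>
     (\<Sum>j\<in>S. level_weight p j) \<le> C * 2 powr (- real n / p) * real n ^ (CARD('d) - 1))"
    using level_weight_tail[OF p, where 'd='d] by (rule exE)
  \<comment> \<open>The value of \<open>block_const\<close>, written out because that name belongs
    to a locale entered only after g is fixed, while the constant has to be chosen before.\<close>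
  define D where "D = ((2 * K_const) ^ CARD('d)) powr (p - 1) * (8 * K_const) ^ CARD('d)"
  have D: "D > 0" using K_const_pos by (simp add: D_def)
  show ?thesis
  proof (intro exI[of _ "C * D powr (1 / p)"] conjI allI impI)
    show "C * D powr (1 / p) > 0" using C D by simp
    fix n :: nat and f g :: "real^'d \<Rightarrow> complex"
    assume n: "n \<ge> 1" and cont: "continuous_on unit_cube f" and ext: "g \<in> SB_extensions \<phi> (1/p) p 1 f"
    have g: "g \<in> SB \<phi> (1/p) p 1" "AE x in lebesgue. x \<in> unit_cube \<longrightarrow> g x = f x" "integrable lebesgue g"
      using ext by (auto simp: SB_extensions_def SB_def)
    obtain g' where g': "g' \<in> borel_measurable lborel" "AE x in lborel. g x = g' x"
      using completion_ex_borel_measurable_complex[OF borel_measurable_integrable[OF g(3)]] by blast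
    have ae: "AE x in lebesgue. g x = g' x" using g'(2) by (simp add: AE_completion)
    have int': "integrable lebesgue g'"
      using g(3) by (rule integrable_cong_AE_imp) (use ae g' in \<open>auto intro: measurable_completion\<close>)
    have four: "fourier g = fourier g'"
    proof
      fix \<xi>
      have "(\<integral>x. g x * exp (- \<i> * of_real (\<xi> \<bullet> x)) \<partial>lebesgue) = (\<integral>x. g' x * exp (- \<i> * of_real (\<xi> \<bullet> x)) \<partial>lebesgue)"
      proof (rule integral_cong_AE)
        have [measurable]: "(\<lambda>x. exp (- \<i> * of_real (\<xi> \<bullet> x))) \<in> borel_measurable lebesgue"
          by (intro measurable_completion) measurable
        have [measurable]: "g \<in> borel_measurable lebesgue" "g' \<in> borel_measurable lebesgue"
          using g(3) int' by auto
        show "(\<lambda>x. g x * exp (- \<i> * of_real (\<xi> \<bullet> x))) \<in> borel_measurable lebesgue"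
          "(\<lambda>x. g' x * exp (- \<i> * of_real (\<xi> \<bullet> x))) \<in> borel_measurable lebesgue"
          by measurable
        show "AE x in lebesgue. g x * exp (- \<i> * of_real (\<xi> \<bullet> x)) = g' x * exp (- \<i> * of_real (\<xi> \<bullet> x))"
          using ae by eventually_elim simp
      qed
      then show "fourier g \<xi> = fourier g' \<xi>" by (simp only: fourier_def)
    qed
    have blocks: "dyadic_block \<phi> g = dyadic_block \<phi> g'" unfolding dyadic_block_def four ..
    have terms: "SB_terms \<phi> (1/p) p 1 g = SB_terms \<phi> (1/p) p 1 g'"
      unfolding SB_terms_def blocks ..
    have "g' \<in> SB \<phi> (1/p) p 1"
      using g(1) int' by (simp add: SB_def blocks terms)
    moreover have "integrable lborel g'" using int' g'(1) by (simp add: integrable_completion)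
    ultimately interpret besov_function \<phi> g' p
      by unfold_locales (use p in auto)
    have "AE x in lebesgue. x \<in> unit_cube \<longrightarrow> g' x = f x"
      using g(2) ae by eventually_elim auto
    then have eq: "f x = block_sum x" if "x \<in> unit_cube" for x
      using eq_block_sum_on_cube cont that by blast
    let ?W = "C * 2 powr (- real n / p) * real n ^ (CARD('d) - 1)"
    have T: "(\<Sum>\<^sub>\<infinity>l. besov_term l) \<ge> 0" by (intro infsum_nonneg besov_term_nonneg)
    have "Lp_norm p unit_cube (\<lambda>x. f x - faber_truncation n f x) \<le> ?W * (block_const powr (1 / p) * (\<Sum>\<^sub>\<infinity>l. besov_term l))"
    proof (rule truncation_error_of_coefficient_bound[OF p cont])
      show "?W > 0" using C n by simp
      show "(\<Sum>j\<in>S. level_weight p j) \<le> ?W"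
        if "finite S" "\<And>j. j \<in> S \<Longrightarrow> (\<forall>i. j i \<ge> -1) \<and> (\<Sum>i\<in>UNIV. \<bar>j i\<bar>) > int n" for S :: "('d \<Rightarrow> int) set"
        using C n that by simp
    qed (use T faber_coeff_bound[OF eq] in auto)
    also have "(\<Sum>\<^sub>\<infinity>l. besov_term l) = SB_norm \<phi> (1/p) p 1 g"
      using T by (simp add: SB_norm_def terms)
    finally show "Lp_norm p unit_cube (\<lambda>x. f x - faber_truncation n f x)
       \<le> C * D powr (1 / p) * 2 powr (- real n / p) * real n ^ (CARD('d) - 1) * SB_norm \<phi> (1/p) p 1 g"
      by (simp add: block_const_def D_def mult_ac)
  qed
qed

theorem theorem6p1:
  fixes \<phi> :: "nat \<Rightarrow> real \<Rightarrow> complex" and p :: real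
  assumes "dyadic_resolution \<phi>" and "1 \<le> p"
  shows "\<exists>C>0. \<forall>n::nat. n \<ge> 1 \<longrightarrow>
           (\<forall>f :: real^'d \<Rightarrow> complex.
              f \<in> SB_cube \<phi> (1/p) p 1 \<longrightarrow> continuous_on unit_cube f \<longrightarrow>
              Lp_norm p unit_cube (\<lambda>x. f x - faber_truncation n f x)
                \<le> C * 2 powr (- real n / p) * real n ^ (CARD('d) - 1)
                    * SB_cube_norm \<phi> (1/p) p 1 f)"
proof -
  interpret resolution \<phi> by unfold_locales fact
  obtain C where C: "C > 0" "\<And>n f g. n \<ge> 1 \<Longrightarrow> continuous_on unit_cube f \<Longrightarrow> g \<in> SB_extensions \<phi> (1/p) p 1 f \<Longrightarrow>
     Lp_norm p unit_cube (\<lambda>x. f x - faber_truncation n f x)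
       \<le> C * 2 powr (- real n / p) * real n ^ (CARD('d) - 1) * SB_norm \<phi> (1/p) p 1 (g :: real^'d \<Rightarrow> complex)"
    using truncation_error_extension[OF assms(2), where 'd='d] by blast
  show ?thesis
  proof (intro exI[of _ C] conjI allI impI C(1))
    fix n :: nat and f :: "real^'d \<Rightarrow> complex"
    assume n: "n \<ge> 1" and f: "f \<in> SB_cube \<phi> (1/p) p 1" and cont: "continuous_on unit_cube f"
    let ?W = "C * 2 powr (- real n / p) * real n ^ (CARD('d) - 1)"
    let ?E = "Lp_norm p unit_cube (\<lambda>x. f x - faber_truncation n f x)"
    have W: "?W > 0" using C n by simp
    \<comment> \<open>Since C is the same for all extensions g, the quotient is a lower bound of all
      their norms and hence of the infimum; the set of extensions is nonempty for f in
      \<open>SB_cube\<close>.\<close>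
    have "?E / ?W \<le> SB_cube_norm \<phi> (1/p) p 1 f"
      unfolding SB_cube_norm_def
    proof (rule cINF_greatest)
      show "SB_extensions \<phi> (1/p) p 1 f \<noteq> {}" using f by (simp add: SB_cube_def)
      fix g assume "g \<in> SB_extensions \<phi> (1/p) p 1 f"
      then have "?E \<le> ?W * SB_norm \<phi> (1/p) p 1 g" by (rule C(2)[OF n cont])
      then show "?E / ?W \<le> SB_norm \<phi> (1/p) p 1 g"
        using W by (simp only: pos_divide_le_eq mult.commute)
    qed
    then show "?E \<le> ?W * SB_cube_norm \<phi> (1/p) p 1 f"
      using W by (simp only: pos_divide_le_eq mult.commute)
  qed
qed

end
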